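(* Let $a<b$ be real numbers, $n\ge 1$ an integer, $0<d<\pi$, $0<\alpha\le 1$, and $\mathbf{r}\in\mathbb{C}^n$. Let $K=[k_{ij}]$ be an $n\times n$ matrix of functions and $\mathbf{g}=[g_1,\ldots,g_n]^{\mathrm T}$ a vector of functions, and put $Q(z)=(z-a)(b-z)$. Assume that $k_{ij}Q\in \mathbf{L}_{\alpha}(\psi^{\mathrm{SE}}(\mathscr{D}_d))$ for all $i,j=1,\ldots,n$ and $g_iQ\in \mathbf{L}_{\alpha}(\psi^{\mathrm{SE}}(\mathscr{D}_d))$ for all $i=1,\ldots,n$. Let $\mathbf{y}=[y_1,\ldots,y_n]^{\mathrm T}$ be the solution of $\mathbf{y}'(t)=K(t)\mathbf{y}(t)+\mathbf{g}(t)$ $(a\le t\le b)$, $\mathbf{y}(a)=\mathbf{r}$, and for each positive integer $N$ let $h=\sqrt{\pi d/(\alpha N)}$. Then there exist $N_0$ and a constant $C$ independent of $N$ such that for all $N\ge N_0$ the SE-Sinc linear system (defined in the context) is uniquely solvable, and the SE-Sinc-collocation solution $\tilde{\mathbf{y}}^{(N)}=[\tilde y_1^{(N)},\ldots,\tilde y_n^{(N)}]^{\mathrm T}$ (defined in the context) satisfies $$\max_{i=1,\ldots,n}\Bigl\{\max_{a\le t\le b}|y_i(t)-\tilde y_i^{(N)}(t)|\Bigr\}\le C\sqrt{N}\exp\left(-\sqrt{\pi d\alpha N}\right).$$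
   Context: $\mathscr{D}_d=\{\zeta\in\mathbb{C}:|\operatorname{Im}\zeta|<d\}$, $\psi^{\mathrm{SE}}(\zeta)=\frac{b-a}{2}\tanh(\zeta/2)+\frac{b+a}{2}$, with inverse $\phi^{\mathrm{SE}}(t)=\log\frac{t-a}{b-t}$ on $(a,b)$, and $\psi^{\mathrm{SE}}(\mathscr{D}_d)$ is the image of $\mathscr{D}_d$ under $\psi^{\mathrm{SE}}$, a bounded simply connected domain containing $(a,b)$. For $\mathscr{D}=\psi^{\mathrm{SE}}(\mathscr{D}_d)$ and $\alpha>0$, $\mathbf{L}_{\alpha}(\mathscr{D})$ is the set of bounded analytic functions $f$ on $\mathscr{D}$ for which there is a constant $L$ with $|f(z)|\le L|Q(z)|^{\alpha}$ for all $z\in\mathscr{D}$, where $Q(z)=(z-a)(b-z)$. The initial value problem is understood in the equivalent integrated form $\mathbf{y}(t)=\mathbf{r}+\int_a^t\{\mathbf{g}(s)+K(s)\mathbf{y}(s)\}\,ds$, $a\le t\le b$, with $\mathbf{y}$ continuous on $[a,b]$ ($k_{ij},g_i$ may have integrable singularities at $a,b$); under the stated assumptions it has a unique solution. Sampling points: $t_j^{\mathrm{SE}}=\psi^{\mathrm{SE}}(jh)$, $j=-N,\ldots,N$. Sine integral: $\operatorname{Si}(x)=\int_0^x\frac{\sin u}{u}\,du$. SE-Sinc linear system: let $\sigma_k=\frac12+\frac1\pi\operatorname{Si}(\pi k)$, $I_N^{(-1)}=[\sigma_{i-j}]_{i,j=-N}^{N}$ (a $(2N+1)\times(2N+1)$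 matrix), $D_N^{\mathrm{SE}}=\operatorname{diag}[(\psi^{\mathrm{SE}})'(-Nh),\ldots,(\psi^{\mathrm{SE}})'(Nh)]$, $K_{ij}^{\mathrm{SE}}=\operatorname{diag}[k_{ij}(t_{-N}^{\mathrm{SE}}),\ldots,k_{ij}(t_N^{\mathrm{SE}})]$, and $[K_{ij}^{\mathrm{SE}}]$ the $n\times n$ block matrix with blocks $K_{ij}^{\mathrm{SE}}$. Let $I_N$, $I_n$ be the identity matrices of order $2N+1$ and $n$, respectively. Let $\mathbf{R}=[r_1,\ldots,r_1,r_2,\ldots,r_2,\ldots,r_n]^{\mathrm T}$ (each $r_i$ repeated $2N+1$ times) and $\mathbf{G}^{\mathrm{SE}}=[g_1(t_{-N}^{\mathrm{SE}}),\ldots,g_1(t_N^{\mathrm{SE}}),\ldots,g_n(t_{-N}^{\mathrm{SE}}),\ldots,g_n(t_N^{\mathrm{SE}})]^{\mathrm T}$. The system for the unknown vector $\mathbf{Y}$ of order $(2N+1)n$ is $$\bigl(I_n\otimes I_N-\bigl(I_n\otimes\{hI_N^{(-1)}D_N^{\mathrm{SE}}\}\bigr)[K_{ij}^{\mathrm{SE}}]\bigr)\mathbf{Y}=\bigl(I_n\otimes\{hI_N^{(-1)}D_N^{\mathrm{SE}}\}\bigr)\mathbf{G}^{\mathrm{SE}}+\mathbf{R},$$ where $\otimes$ is the Kronecker product. SE-Sinc-collocation solution: write the solution of the system as $\mathbf{Y}=[y_{1,-N},\ldots,y_{1,N},y_{2,-N},\ldots,y_{2,N},\ldots,y_{n,N}]^{\mathrm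 T}$. With $w_a(t)=\frac{b-t}{b-a}$, $w_b(t)=\frac{t-a}{b-a}$ and $S(j,h)(x)=\frac{\sin\pi(x/h-j)}{\pi(x/h-j)}$ (equal to $1$ at $x=jh$; and $S(j,h)(\phi^{\mathrm{SE}}(t))$ is taken as its limit $0$ at $t=a,b$), $$\tilde y_i^{(N)}(t)=y_{i,-N}w_a(t)+y_{i,N}w_b(t)+\sum_{j=-N}^N\{y_{i,j}-y_{i,-N}w_a(t_j^{\mathrm{SE}})-y_{i,N}w_b(t_j^{\mathrm{SE}})\}S(j,h)(\phi^{\mathrm{SE}}(t)),\quad i=1,\ldots,n.$$ *)

theory Defs
  imports
    "HOL-Complex_Analysis.Complex_Analysis"
    "HOL-Probability.Sinc_Integral"
    Jordan_Normal_Form.Matrix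
begin

definition strip :: "real \<Rightarrow> complex set" where
  "strip d = {\<zeta>. \<bar>Im \<zeta>\<bar> < d}"

(* Polymorphic: the complex instance gives the domain psi_SE(strip d), the real instance gives the
   sampling points and the derivative at them. *)
definition psi_SE :: "real \<Rightarrow> real \<Rightarrow> 'a \<Rightarrow> 'a::{real_normed_field, banach}" where
  "psi_SE a b \<zeta> = of_real ((b - a) / 2) * tanh (\<zeta> / 2) + of_real ((b + a) / 2)"

definition phi_SE :: "real \<Rightarrow> real \<Rightarrow> real \<Rightarrow> real" where
  "phi_SE a b t = ln ((t - a) / (b - t))"

definition Q_fun :: "real \<Rightarrow> real \<Rightarrow> complex \<Rightarrow> complex" where
  "Q_fun a b z = (z - of_real a) * (of_real b - z)"

definition L_space :: "real \<Rightarrow> real \<Rightarrow> real \<Rightarrow> complex set \<Rightarrow> (complex \<Rightarrow> complex) set" where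
  "L_space a b \<alpha> D = {f. f analytic_on D \<and> bounded (f ` D) \<and>
     (\<exists>L::real. \<forall>z\<in>D. cmod (f z) \<le> L * cmod (Q_fun a b z) powr \<alpha>)}"

(* The components of vectors and matrices of order n carry indices 0, ..., n - 1 throughout. *)

(* y' = K y + g, y(a) = r in integrated form. The functions in K and g need not be continuous (or
   meaningful) at the end points. If K and g satisfy the growth bounds of L_space (after
   multiplication by Q_fun), the integrand is absolutely integrable for continuous y, so the
   gauge integral used here agrees with the Lebesgue integral. *)
definition ivp_solution ::
  "nat \<Rightarrow> real \<Rightarrow> real \<Rightarrow> (nat \<Rightarrow> nat \<Rightarrow> complex \<Rightarrow> complex) \<Rightarrow> (nat \<Rightarrow> complex \<Rightarrow> complex) \<Rightarrow>
   (nat \<Rightarrow> complex) \<Rightarrow> (nat \<Rightarrow> real \<Rightarrow> complex) \<Rightarrow> bool" where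
  "ivp_solution n a b k g r y \<longleftrightarrow>
     (\<forall>i<n. continuous_on {a..b} (y i)) \<and>
     (\<forall>i<n. \<forall>t\<in>{a..b}.
        ((\<lambda>s. g i (of_real s) + (\<Sum>j<n. k i j (of_real s) * y j s)) has_integral (y i t - r i)) {a..t})"

definition t_SE :: "real \<Rightarrow> real \<Rightarrow> real \<Rightarrow> int \<Rightarrow> real" where
  "t_SE a b h j = psi_SE a b (of_int j * h)"

definition sigma :: "int \<Rightarrow> real" where
  "sigma k = 1 / 2 + 1 / pi * Si (pi * of_int k)"

(* Row and column numbers p = 0, ..., 2N of the matrices of order 2N+1 stand for the
   indices -N, ..., N. *)
definition idx :: "nat \<Rightarrow> nat \<Rightarrow> int" where
  "idx N p = int p - int N"

definition I_int :: "nat \<Rightarrow> complex mat" where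
  "I_int N = Matrix.mat (2*N+1) (2*N+1) (\<lambda>(p, q). of_real (sigma (idx N p - idx N q)))"

definition D_SE :: "real \<Rightarrow> real \<Rightarrow> real \<Rightarrow> nat \<Rightarrow> complex mat" where
  "D_SE a b h N = mat_diag (2*N+1)
     (\<lambda>p. of_real (deriv (psi_SE a b :: real \<Rightarrow> real) (of_int (idx N p) * h)))"

definition K_SE :: "real \<Rightarrow> real \<Rightarrow> real \<Rightarrow> nat \<Rightarrow> (complex \<Rightarrow> complex) \<Rightarrow> complex mat" where
  "K_SE a b h N f = mat_diag (2*N+1) (\<lambda>p. f (of_real (t_SE a b h (idx N p))))"

definition block_mat :: "nat \<Rightarrow> nat \<Rightarrow> (nat \<Rightarrow> nat \<Rightarrow> 'a mat) \<Rightarrow> 'a mat" where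
  "block_mat n m B = Matrix.mat (n*m) (n*m) (\<lambda>(p, q). B (p div m) (q div m) $$ (p mod m, q mod m))"

definition kronecker :: "'a::times mat \<Rightarrow> 'a mat \<Rightarrow> 'a mat" (infixl "\<otimes>\<^sub>K" 72) where
  "A \<otimes>\<^sub>K B = Matrix.mat (dim_row A * dim_row B) (dim_col A * dim_col B)
     (\<lambda>(p, q). A $$ (p div dim_row B, q div dim_col B) * B $$ (p mod dim_row B, q mod dim_col B))"

definition R_vec :: "nat \<Rightarrow> nat \<Rightarrow> (nat \<Rightarrow> complex) \<Rightarrow> complex Matrix.vec" where
  "R_vec n N r = Matrix.vec (n * (2*N+1)) (\<lambda>p. r (p div (2*N+1)))"

definition G_SE ::
  "real \<Rightarrow> real \<Rightarrow> real \<Rightarrow> nat \<Rightarrow> nat \<Rightarrow> (nat \<Rightarrow> complex \<Rightarrow> complex) \<Rightarrow> complex Matrix.vec" where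
  "G_SE a b h n N g = Matrix.vec (n * (2*N+1))
     (\<lambda>p. g (p div (2*N+1)) (of_real (t_SE a b h (idx N (p mod (2*N+1))))))"

definition int_mat_SE :: "real \<Rightarrow> real \<Rightarrow> real \<Rightarrow> nat \<Rightarrow> nat \<Rightarrow> complex mat" where
  "int_mat_SE a b h n N = 1\<^sub>m n \<otimes>\<^sub>K (of_real h \<cdot>\<^sub>m (I_int N * D_SE a b h N))"

definition sinc_system ::
  "real \<Rightarrow> real \<Rightarrow> real \<Rightarrow> nat \<Rightarrow> nat \<Rightarrow> (nat \<Rightarrow> nat \<Rightarrow> complex \<Rightarrow> complex) \<Rightarrow>
   (nat \<Rightarrow> complex \<Rightarrow> complex) \<Rightarrow> (nat \<Rightarrow> complex) \<Rightarrow> complex Matrix.vec \<Rightarrow> bool" where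
  "sinc_system a b h n N k g r Y \<longleftrightarrow> Y \<in> carrier_vec (n * (2*N+1)) \<and>
     (1\<^sub>m n \<otimes>\<^sub>K 1\<^sub>m (2*N+1) - int_mat_SE a b h n N * block_mat n (2*N+1) (\<lambda>i j. K_SE a b h N (k i j)))
       *\<^sub>v Y
     = int_mat_SE a b h n N *\<^sub>v G_SE a b h n N g + R_vec n N r"

definition w_a :: "real \<Rightarrow> real \<Rightarrow> real \<Rightarrow> real" where
  "w_a a b t = (b - t) / (b - a)"

definition w_b :: "real \<Rightarrow> real \<Rightarrow> real \<Rightarrow> real" where
  "w_b a b t = (t - a) / (b - a)"

definition S_sinc :: "int \<Rightarrow> real \<Rightarrow> real \<Rightarrow> real" where
  "S_sinc j h x = sinc (pi * (x / h - of_int j))"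

(* S(j,h) composed with phi_SE, extended to the end points a, b by its limit 0. *)
definition S_phi :: "real \<Rightarrow> real \<Rightarrow> real \<Rightarrow> int \<Rightarrow> real \<Rightarrow> real" where
  "S_phi a b h j t = (if t = a \<or> t = b then 0 else S_sinc j h (phi_SE a b t))"

(* The entry y_{i,j} of Y, where i = 0, ..., n - 1 and j = -N, ..., N. *)
definition Y_entry :: "nat \<Rightarrow> complex Matrix.vec \<Rightarrow> nat \<Rightarrow> int \<Rightarrow> complex" where
  "Y_entry N Y i j = vec_index Y (i * (2*N+1) + nat (j + int N))"

definition y_SE ::
  "real \<Rightarrow> real \<Rightarrow> real \<Rightarrow> nat \<Rightarrow> complex Matrix.vec \<Rightarrow> nat \<Rightarrow> real \<Rightarrow> complex" where
  "y_SE a b h N Y i t =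
     (let y = Y_entry N Y i; ya = y (- int N); yb = y (int N) in
      ya * of_real (w_a a b t) + yb * of_real (w_b a b t)
      + (\<Sum>j\<in>{- int N..int N}.
           (y j - ya * of_real (w_a a b (t_SE a b h j)) - yb * of_real (w_b a b (t_SE a b h j)))
           * of_real (S_phi a b h j t)))"

end

theory Submission
  imports
    Defs
    "HOL-Real_Asymp.Real_Asymp"
    "Jordan_Normal_Form.Determinant"
begin

text \<open>
  Under \<open>t = \<psi>(x)\<close> the system becomes \<open>u' = A u + G\<close> on the real line, where \<open>A\<close> and \<open>G\<close> are
  holomorphic on the strip and bounded by a multiple of \<open>exp (- \<alpha> \<bar>Re z\<bar>)\<close>. Picard iteration along rays from
  the origin shows that \<open>u\<close> extends to a bounded holomorphic function on the strip, so that \<open>A u + G\<close>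
  has the same decay. The error of the cardinal series of a function on the strip is a contour
  integral over a rectangle whose vertical sides pass half-way between two nodes. Estimating it bounds the
  interpolation error, and integrating it in \<open>x\<close> (with one integration by parts) bounds the error of
  indefinite integration by \<open>exp (- \<pi> d / h) = exp (- \<alpha> N h)\<close>, up to a constant. The exact nodal values
  therefore solve the linear system up to this residual.

  For stability write \<open>\<sigma>\<^bsub>k\<^esub>\<close> as the Heaviside sequence plus \<open>O(1 / (1 + \<bar>k\<bar>))\<close>. The Heaviside part is a
  discrete Volterra operator, bounded by a discrete Gronwall inequality; the remainder has norm \<open>O(h log N)\<close>,
  which tends to 0. Finally the nodal errors enter the interpolant with the Lebesgue constant of the cardinal
  series, which is \<open>O(sqrt N)\<close>.
\<close>

section \<open>Linear systems on the strip\<close>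

text \<open>The coefficients are controlled on the open strip only, without boundary values, so the
  contours run at height d - h instead of d. This multiplies the bound by exp pi, whatever h is, and
  explains the factor \<open>exp pi\<close> in the constants. Integrating the pointwise
  interpolation error would lose a factor 1 / h and the length of the range. Exchanging the
  integrals puts the real one innermost, where the oscillation of sin (pi s / h) gains a factor h
  and the length no longer matters. The nodal errors therefore carry no power of N; sqrt N arises
  only between the nodal values and the interpolant. The kernel 1 / (z - s) is singular where the
  range crosses a vertical side of the frame, so a stretch of length h is cut out there and
  estimated pointwise. The map suits the hypotheses because its derivative is Q(\<psi>) / (b - a):
  singular coefficients k become k Q / (b - a), which decays. The bound d < pi keeps cosh (z / 2)
  away from 0 on the strip. The weights of the interpolant decay at rate 1, and \<alpha> \<le> 1
  makes this good enough.\<close>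

lemma convex_strip: "convex (strip d)"
proof -
  have "strip d = {z. Im z < d} \<inter> {z. Im z > -d}"
    by (auto simp: strip_def)
  then show ?thesis
    by (simp add: convex_Int convex_halfspace_Im_lt convex_halfspace_Im_gt)
qed

lemma open_strip: "open (strip d)"
proof -
  have "strip d = {z. Im z < d} \<inter> {z. Im z > -d}"
    by (auto simp: strip_def)
  then show ?thesis
    by (simp add: open_Int open_halfspace_Im_lt open_halfspace_Im_gt)
qed

lemma of_real_in_strip [simp]: "of_real x \<in> strip d \<longleftrightarrow> d > 0"
  by (simp add: strip_def)

lemma ray_in_strip: "z \<in> strip d \<Longrightarrow> 0 \<le> t \<Longrightarrow> t \<le> 1 \<Longrightarrow> of_real t * z \<in> strip d"
proof -
  assume z: "z \<in> strip d" and t: "0 \<le> t" "t \<le> 1"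
  have "\<bar>t\<bar> * \<bar>Im z\<bar> \<le> 1 * \<bar>Im z\<bar>"
    using t by (intro mult_right_mono) auto
  with z show ?thesis
    by (auto simp: strip_def abs_mult)
qed

lemma holomorphic_strip_primitive:
  assumes "F holomorphic_on strip d" "d > 0"
  obtains B where "B 0 = c" "\<And>z. z \<in> strip d \<Longrightarrow> (B has_field_derivative F z) (at z)"
proof -
  obtain P where P: "\<And>z. z \<in> strip d \<Longrightarrow> (P has_field_derivative F z) (at z within strip d)"
    using holomorphic_convex_primitive'[OF convex_strip open_strip assms(1)] by blast
  have "((\<lambda>z. P z - P 0 + c) has_field_derivative F z) (at z)" if "z \<in> strip d" for z
    using P[OF that] that by (auto intro!: derivative_eq_intros simp: at_within_open[OF that open_strip])
  then show thesis
    by (intro that[of "\<lambda>z. P z - P 0 + c"]) auto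
qed

text \<open>Along the ray from the origin to a point of the strip, this function is an antiderivative of
  a majorant of \<open>t \<mapsto> \<bar>z\<bar> C exp (- \<alpha> \<bar>Re (t z)\<bar>)\<close>.\<close>
definition ray_weight :: "real \<Rightarrow> real \<Rightarrow> complex \<Rightarrow> real" where
  "ray_weight \<alpha> C z = C * ((1 - exp (-\<alpha> * \<bar>Re z\<bar>)) / \<alpha> + \<bar>Im z\<bar>)"

lemma ray_weight_nonneg: "\<alpha> > 0 \<Longrightarrow> C \<ge> 0 \<Longrightarrow> ray_weight \<alpha> C z \<ge> 0"
  by (simp add: ray_weight_def)

lemma ray_weight_zero [simp]: "ray_weight \<alpha> C 0 = 0"
  by (simp add: ray_weight_def)

text \<open>The majorant is integrable along every ray, so the weight stays bounded on the whole
  unbounded strip. This is what makes the Picard series uniformly convergent and its sum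
  bounded.\<close>

lemma ray_weight_le:
  assumes "\<alpha> > 0" "C \<ge> 0" "z \<in> strip d"
  shows "ray_weight \<alpha> C z \<le> C * (1 / \<alpha> + d)"
  unfolding ray_weight_def using assms
  by (intro mult_left_mono add_mono divide_right_mono) (auto simp: strip_def)

text \<open>One Picard step. Along t -> t z the derivative of the weight w dominates the speed times
  the bound for the coefficients, so a majorant w^m / m! integrates to w^(m+1) / (m+1)!.\<close>

lemma ray_growth:
  assumes B: "\<And>z. z \<in> strip d \<Longrightarrow> (B has_field_derivative F z) (at z)" and "B 0 = 0"
    and F: "\<And>z. z \<in> strip d \<Longrightarrow>
      cmod (F z) \<le> C * exp (-\<alpha> * \<bar>Re z\<bar>) * (c * ray_weight \<alpha> C z ^ m / fact m)"
    and "\<alpha> > 0" "C \<ge> 0" "c \<ge> 0" and z: "z \<in> strip d"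
  shows "cmod (B z) \<le> c * ray_weight \<alpha> C z ^ Suc m / fact (Suc m)"
proof -
  define w where "w t = C * ((1 - exp (-\<alpha> * \<bar>Re z\<bar> * t)) / \<alpha> + \<bar>Im z\<bar> * t)" for t
  define \<phi> where "\<phi> t = c / fact (Suc m) * w t ^ Suc m" for t
  define \<phi>' where "\<phi>' t = c * w t ^ m / fact m * (C * (\<bar>Re z\<bar> * exp (-\<alpha> * \<bar>Re z\<bar> * t) + \<bar>Im z\<bar>))" for t
  have w_eq: "w t = ray_weight \<alpha> C (of_real t * z)" if "t \<ge> 0" for t
    using that by (simp add: w_def ray_weight_def abs_mult mult_ac)
  have dw: "(w has_real_derivative C * (\<bar>Re z\<bar> * exp (-\<alpha> * \<bar>Re z\<bar> * t) + \<bar>Im z\<bar>)) (at t)" for t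
    unfolding w_def using \<open>\<alpha> > 0\<close> by (auto intro!: derivative_eq_intros simp: field_simps)
  have d\<phi>: "(\<phi> has_real_derivative \<phi>' t) (at t)" for t
    unfolding \<phi>_def \<phi>'_def
    by (rule derivative_eq_intros dw refl)+ (simp add: divide_simps del: of_nat_Suc)
  have dB: "((\<lambda>t. B (of_real t * z)) has_vector_derivative z * F (of_real t * z)) (at t)"
    if "0 \<le> t" "t \<le> 1" for t
  proof -
    have "((\<lambda>t. of_real t * z) has_vector_derivative z) (at t)"
      by (auto intro!: derivative_eq_intros)
    from field_vector_diff_chain_at[OF this B[OF ray_in_strip[OF z that]]] show ?thesis
      by (simp add: o_def)
  qed
  have "cmod (B (of_real 1 * z) - B (of_real 0 * z)) \<le> \<phi> 1 - \<phi> 0"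
  proof (rule differentiable_bound_general[where \<phi>' = \<phi>'])
    show "continuous_on {0..1} (\<lambda>t. B (of_real t * z))"
      using dB by (intro continuous_at_imp_continuous_on ballI)
        (auto dest!: has_vector_derivative_continuous)
    show "continuous_on {0..1} \<phi>"
      using d\<phi> DERIV_continuous by (intro continuous_at_imp_continuous_on ballI) blast
  next
    fix t :: real assume t: "0 < t" "t < 1"
    show "((\<lambda>t. B (of_real t * z)) has_vector_derivative z * F (of_real t * z)) (at t)"
      using dB t by auto
    show "(\<phi> has_vector_derivative \<phi>' t) (at t)"
      using d\<phi> by (simp add: has_real_derivative_iff_has_vector_derivative)
    have e1: "exp (-\<alpha> * \<bar>Re z\<bar> * t) \<le> 1"
      using \<open>\<alpha> > 0\<close> t by simp
    \<comment> \<open>The exponential is dropped in the imaginary part only: there the displacement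
      is below d, whereas the real part needs the decay to remain integrable.\<close>
    have "cmod z * exp (-\<alpha> * \<bar>Re z\<bar> * t) \<le> (\<bar>Re z\<bar> + \<bar>Im z\<bar>) * exp (-\<alpha> * \<bar>Re z\<bar> * t)"
      by (intro mult_right_mono cmod_le) auto
    also have "\<dots> \<le> \<bar>Re z\<bar> * exp (-\<alpha> * \<bar>Re z\<bar> * t) + \<bar>Im z\<bar>"
      using e1 by (simp add: distrib_right mult_left_le)
    finally have e2: "cmod z * exp (-\<alpha> * \<bar>Re z\<bar> * t) \<le> \<bar>Re z\<bar> * exp (-\<alpha> * \<bar>Re z\<bar> * t) + \<bar>Im z\<bar>" .
    have "cmod (F (of_real t * z)) \<le> C * exp (-\<alpha> * \<bar>Re z\<bar> * t) * (c * w t ^ m / fact m)"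
      using F[OF ray_in_strip[OF z, of t]] t by (simp add: w_eq abs_mult mult_ac)
    then have "cmod (z * F (of_real t * z)) \<le> cmod z * (C * exp (-\<alpha> * \<bar>Re z\<bar> * t) * (c * w t ^ m / fact m))"
      unfolding norm_mult by (rule mult_left_mono) simp
    also have "\<dots> = (c * w t ^ m / fact m) * (C * (cmod z * exp (-\<alpha> * \<bar>Re z\<bar> * t)))"
      by (simp add: mult_ac)
    also have "\<dots> \<le> \<phi>' t"
      unfolding \<phi>'_def using \<open>C \<ge> 0\<close> \<open>c \<ge> 0\<close> e2 t ray_weight_nonneg[OF \<open>\<alpha> > 0\<close> \<open>C \<ge> 0\<close>]
      by (intro mult_left_mono) (auto simp: w_eq)
    finally show "cmod (z * F (of_real t * z)) \<le> \<phi>' t" .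
  qed simp
  moreover have "\<phi> 0 = 0" "\<phi> 1 = c * ray_weight \<alpha> C z ^ Suc m / fact (Suc m)"
    unfolding \<phi>_def using w_eq[of 0] w_eq[of 1] by auto
  ultimately show ?thesis
    using \<open>B 0 = 0\<close> by simp
qed

text \<open>The solution is the sum of the Picard increments \<open>T m\<close>; the initial value
  is \<open>T 0\<close>, and \<open>G\<close> enters in the first step only. The increments are
  bounded by a multiple of \<Lambda>^m / m! on the whole strip, which allows termwise
  differentiation and bounds the sum.\<close>

lemma linear_ode_strip:
  fixes A :: "nat \<Rightarrow> nat \<Rightarrow> complex \<Rightarrow> complex" and G :: "nat \<Rightarrow> complex \<Rightarrow> complex"
    and c :: "nat \<Rightarrow> complex"
  assumes d: "d > 0" and \<alpha>: "\<alpha> > 0" and C: "C \<ge> 0"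
    and A: "\<And>i j. i < n \<Longrightarrow> j < n \<Longrightarrow> A i j holomorphic_on strip d"
    and G: "\<And>i. i < n \<Longrightarrow> G i holomorphic_on strip d"
    and bound: "\<And>i z. i < n \<Longrightarrow> z \<in> strip d \<Longrightarrow>
      (\<Sum>j<n. cmod (A i j z)) + cmod (G i z) \<le> C * exp (-\<alpha> * \<bar>Re z\<bar>)"
  obtains u B where "\<And>i. i < n \<Longrightarrow> u i 0 = c i"
    and "\<And>i z. i < n \<Longrightarrow> z \<in> strip d \<Longrightarrow>
      (u i has_field_derivative (\<Sum>j<n. A i j z * u j z) + G i z) (at z)"
    and "\<And>i z. i < n \<Longrightarrow> z \<in> strip d \<Longrightarrow> cmod (u i z) \<le> B"
proof -
  \<comment> \<open>The summand 1 makes \<open>c0\<close> at least 1, so that the single occurrence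
    of \<open>G\<close> is absorbed into the bound \<open>b 0\<close>.\<close>
  define c0 where "c0 = 1 + (\<Sum>i<n. cmod (c i))"
  have c0: "c0 \<ge> 1"
    by (simp add: c0_def sum_nonneg)
  have ci: "cmod (c i) \<le> c0" if "i < n" for i
    using that member_le_sum[of i "{..<n}" "\<lambda>i. cmod (c i)"] by (simp add: c0_def)
  define P where "P F = (SOME B. B 0 = 0 \<and> (\<forall>z\<in>strip d. (B has_field_derivative F z) (at z)))"
    for F :: "complex \<Rightarrow> complex"
  have P: "P F 0 = 0" "\<And>z. z \<in> strip d \<Longrightarrow> (P F has_field_derivative F z) (at z)"
    if F: "F holomorphic_on strip d" for F
  proof -
    have "\<exists>B. B 0 = 0 \<and> (\<forall>z\<in>strip d. (B has_field_derivative F z) (at z))"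
      using holomorphic_strip_primitive[OF F d] by metis
    from someI_ex[OF this] show "P F 0 = 0" "\<And>z. z \<in> strip d \<Longrightarrow> (P F has_field_derivative F z) (at z)"
      unfolding P_def by auto
  qed
  define T where "T = rec_nat (\<lambda>i z. c i)
    (\<lambda>m T i. P (\<lambda>z. (\<Sum>j<n. A i j z * T j z) + (if m = 0 then G i z else 0)))"
  have T0: "T 0 i z = c i" for i z
    by (simp add: T_def)
  define F where "F m i z = (\<Sum>j<n. A i j z * T m j z) + (if m = 0 then G i z else 0)" for m i z
  have TS: "T (Suc m) i = P (F m i)" for m i
    by (simp add: T_def F_def[abs_def])
  have Thol: "\<forall>i<n. T m i holomorphic_on strip d" for m
  proof (induction m)
    case 0
    then show ?case by (simp add: T0[abs_def])
  next
    case (Suc m)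
    have "F m i holomorphic_on strip d" if "i < n" for i
      unfolding F_def using Suc A G that by (cases "m = 0") (auto intro!: holomorphic_intros)
    from P(2)[OF this] show ?case
      using open_strip by (auto simp: TS holomorphic_on_open)
  qed
  have Fhol: "F m i holomorphic_on strip d" if "i < n" for i m
    unfolding F_def using Thol A G that by (cases "m = 0") (auto intro!: holomorphic_intros)
  have rw0: "ray_weight \<alpha> C z \<ge> 0" for z
    using \<alpha> C by (rule ray_weight_nonneg)
  define b where "b m z = c0 * ray_weight \<alpha> C z ^ m / fact m" for m z
  have b0: "b m z \<ge> 0" for m z
    using rw0 c0 by (simp add: b_def)
  have Fb: "cmod (F m i z) \<le> C * exp (-\<alpha> * \<bar>Re z\<bar>) * b m z"
    if T: "\<And>i. i < n \<Longrightarrow> cmod (T m i z) \<le> b m z" and "i < n" "z \<in> strip d" for m i z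
  proof -
    have "cmod (F m i z) \<le> (\<Sum>j<n. cmod (A i j z) * b m z) + cmod (if m = 0 then G i z else 0)"
      unfolding F_def by (rule order_trans[OF norm_triangle_ineq add_right_mono], rule sum_norm_le)
        (auto simp: norm_mult intro!: mult_left_mono T)
    also have "\<dots> \<le> (\<Sum>j<n. cmod (A i j z) * b m z) + cmod (G i z) * b m z"
      using c0 b0[of m z] mult_left_mono[of 1 c0 "cmod (G i z)"]
      by (cases "m = 0") (auto simp: b_def[of 0])
    also have "\<dots> = ((\<Sum>j<n. cmod (A i j z)) + cmod (G i z)) * b m z"
      by (simp add: sum_distrib_right distrib_right)
    also have "\<dots> \<le> C * exp (-\<alpha> * \<bar>Re z\<bar>) * b m z"
      using bound that b0 by (intro mult_right_mono) auto
    finally show ?thesis .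
  qed
  have Tb: "\<forall>i<n. \<forall>z\<in>strip d. cmod (T m i z) \<le> b m z" for m
  proof (induction m)
    case 0
    then show ?case using ci by (simp add: T0 b_def)
  next
    case (Suc m)
    show ?case
    proof (intro allI impI ballI)
      fix i z assume i: "i < n" and z: "z \<in> strip d"
      show "cmod (T (Suc m) i z) \<le> b (Suc m) z"
        unfolding TS b_def
      proof (rule ray_growth[where F = "F m i"])
        show "cmod (F m i z) \<le> C * exp (-\<alpha> * \<bar>Re z\<bar>) * (c0 * ray_weight \<alpha> C z ^ m / fact m)"
          if "z \<in> strip d" for z
          using Fb[of m z i] Suc i that by (auto simp: b_def)
      qed (use P[OF Fhol[OF i]] \<alpha> C c0 z in auto)
    qed
  qed
  define \<Lambda> where "\<Lambda> = C * (1 / \<alpha> + d)"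
  define bb where "bb m = c0 * (\<Lambda> ^ m / fact m)" for m
  have bb: "b m z \<le> bb m" if "z \<in> strip d" for m z
  proof -
    have "ray_weight \<alpha> C z ^ m \<le> \<Lambda> ^ m"
      unfolding \<Lambda>_def using ray_weight_le[OF \<alpha> C that] rw0 by (intro power_mono)
    then show ?thesis
      unfolding b_def bb_def using c0 by (simp add: field_simps)
  qed
  have sum_bb: "summable bb"
    unfolding bb_def using summable_exp[of \<Lambda>] by (intro summable_mult) (simp add: divide_inverse mult.commute)
  have sumT: "summable (\<lambda>m. T m i z)" if "i < n" "z \<in> strip d" for i z
    using Tb[of _] bb[OF that(2)] that
    by (intro summable_comparison_test'[OF sum_bb, of 0]) (meson order_trans)
  define u where "u i z = (\<Sum>m. T m i z)" for i z
  define T' where "T' m i = (case m of 0 \<Rightarrow> (\<lambda>_. 0) | Suc m \<Rightarrow> F m i)" for m i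
  show thesis
  proof (rule that)
    show "u i 0 = c i" if "i < n" for i
    proof -
      have "T m i 0 = 0" if "m \<noteq> 0" for m
        using that P(1)[OF Fhol[OF \<open>i < n\<close>]] by (cases m) (auto simp: TS)
      then show ?thesis
        using suminf_finite[of "{0}" "\<lambda>m. T m i 0"] by (auto simp: u_def T0)
    qed
  next
    fix i z assume i: "i < n" and z: "z \<in> strip d"
    show "cmod (u i z) \<le> suminf bb"
      unfolding u_def using Tb[of _] bb[OF z] i z
      by (intro norm_suminf_le[OF _ sum_bb]) (meson order_trans)
    have "((\<lambda>z. \<Sum>m. T m i z) has_field_derivative (\<Sum>m. T' m i z)) (at z)"
    proof (rule has_field_derivative_series'(2)[where S = "strip d" and x0 = z and f = "\<lambda>m. T m i"])
      show "(T m i has_field_derivative T' m i z) (at z within strip d)" if "z \<in> strip d" for m z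
        using P(2)[OF Fhol[OF i] that]
        by (cases m) (auto simp: T'_def TS T0[abs_def] intro: has_field_derivative_at_within)
      have "cmod (T' m i z) \<le> (case m of 0 \<Rightarrow> 0 | Suc m \<Rightarrow> C * bb m)" if z: "z \<in> strip d" for m z
      proof (cases m)
        case (Suc k)
        have "cmod (F k i z) \<le> C * exp (-\<alpha> * \<bar>Re z\<bar>) * b k z"
          using Fb Tb i z by blast
        also have "\<dots> \<le> C * 1 * bb k"
          using C \<alpha> b0 bb[OF z] by (intro mult_mono) auto
        finally show ?thesis by (simp add: Suc T'_def)
      qed (simp add: T'_def)
      moreover have "summable (\<lambda>m. case m of 0 \<Rightarrow> 0 | Suc m \<Rightarrow> C * bb m)"
        by (subst summable_Suc_iff[symmetric]) (simp add: sum_bb summable_mult)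
      ultimately show "uniformly_convergent_on (strip d) (\<lambda>k z. \<Sum>m<k. T' m i z)"
        by (rule Weierstrass_m_test')
      show "z \<in> interior (strip d)"
        using z open_strip by (simp add: interior_open)
    qed (use z i sumT convex_strip in auto)
    moreover have "(\<lambda>m. T' m i z) sums ((\<Sum>j<n. A i j z * u j z) + G i z)"
    proof -
      have "(\<lambda>m. F m i z) sums ((\<Sum>j<n. A i j z * u j z) + G i z)"
        unfolding F_def u_def using sumT z
        by (intro sums_add sums_sum sums_mult summable_sums) (auto simp: sums_If_finite[of "\<lambda>m. m = 0", simplified] intro: sums_single[of 0 "\<lambda>_. G i z"])
      then show ?thesis
        using sums_Suc[of "\<lambda>m. T' m i z"] by (simp add: T'_def)
    qed
    ultimately show "(u i has_field_derivative (\<Sum>j<n. A i j z * u j z) + G i z) (at z)"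
      unfolding u_def[abs_def] by (simp add: sums_iff)
  qed
qed

section \<open>Uniqueness for linear systems on the real line\<close>

lemma linear_ode_unique_nonneg:
  fixes e :: "nat \<Rightarrow> real \<Rightarrow> complex"
  assumes e0: "\<And>i. i < n \<Longrightarrow> e i 0 = 0"
    and de: "\<And>i x. i < n \<Longrightarrow> (e i has_vector_derivative (\<Sum>j<n. M i j x * e j x)) (at x)"
    and K: "\<And>i x. i < n \<Longrightarrow> (\<Sum>j<n. cmod (M i j x)) \<le> K"
    and x: "x \<ge> 0" and i: "i < n"
  shows "e i x = 0"
proof -
  have cont: "continuous_on S (e i)" if "i < n" for i S
    using de[OF that] by (intro continuous_at_imp_continuous_on ballI)
      (auto dest!: has_vector_derivative_continuous)
  have K0: "K \<ge> 0"
    using order_trans[OF sum_nonneg K[OF i]] by auto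
  have "\<exists>B. \<forall>t\<in>{0..x}. cmod (e i t) \<le> B" if "i < n" for i
    using compact_imp_bounded[OF compact_continuous_image[OF cont[OF that] compact_Icc]]
    by (auto simp: bounded_iff)
  then obtain B where B: "\<And>i t. i < n \<Longrightarrow> t \<in> {0..x} \<Longrightarrow> cmod (e i t) \<le> B i"
    by metis
  define b where "b = (\<Sum>i<n. \<bar>B i\<bar>)"
  have b: "cmod (e i t) \<le> b" if "i < n" "t \<in> {0..x}" for i t
    using B[OF that] member_le_sum[of i "{..<n}" "\<lambda>i. \<bar>B i\<bar>"] that by (auto simp: b_def)
  have b0: "b \<ge> 0"
    by (simp add: b_def sum_nonneg)
  \<comment> \<open>Starting from the bound of a continuous function on a compact interval, each
    pass through the equation adds one power of K t and one factor of the factorial; letting m grow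
    forces the value 0.\<close>
  have iter: "\<forall>i<n. \<forall>t\<in>{0..x}. cmod (e i t) \<le> b * (K * t) ^ m / fact m" for m
  proof (induction m)
    case 0
    then show ?case using b by simp
  next
    case (Suc m)
    show ?case
    proof (intro allI impI ballI)
      fix i t assume i: "i < n" and t: "t \<in> {0..x}"
      show "cmod (e i t) \<le> b * (K * t) ^ Suc m / fact (Suc m)"
      proof (cases "t = 0")
        case True
        then show ?thesis using e0 i by simp
      next
        case False
        define \<phi> where "\<phi> s = b / fact (Suc m) * (K * s) ^ Suc m" for s
        define \<phi>' where "\<phi>' s = K * (b * (K * s) ^ m / fact m)" for s
        have d\<phi>: "(\<phi> has_real_derivative \<phi>' s) (at s)" for s
          unfolding \<phi>_def \<phi>'_def
          by (rule derivative_eq_intros refl)+ (simp add: divide_simps del: of_nat_Suc)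
        have "cmod (e i t - e i 0) \<le> \<phi> t - \<phi> 0"
        proof (rule differentiable_bound_general[where \<phi>' = \<phi>'])
          show "0 < t" using False t by simp
          show "continuous_on {0..t} \<phi>"
            using d\<phi> DERIV_continuous by (intro continuous_at_imp_continuous_on ballI) blast
          fix s assume s: "0 < s" "s < t"
          show "(\<phi> has_vector_derivative \<phi>' s) (at s)"
            using d\<phi> by (simp add: has_real_derivative_iff_has_vector_derivative)
          show "(e i has_vector_derivative (\<Sum>j<n. M i j s * e j s)) (at s)"
            using de i by blast
          have "cmod (\<Sum>j<n. M i j s * e j s) \<le> (\<Sum>j<n. cmod (M i j s) * (b * (K * s) ^ m / fact m))"
            unfolding norm_mult using Suc s t by (intro sum_norm_le) (simp add: norm_mult mult_left_mono del: times_divide_eq_right)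
          also have "\<dots> = (\<Sum>j<n. cmod (M i j s)) * (b * (K * s) ^ m / fact m)"
            by (simp only: sum_distrib_right)
          also have "\<dots> \<le> \<phi>' s"
            unfolding \<phi>'_def using K[OF i] b0 K0 s by (intro mult_right_mono) auto
          finally show "cmod (\<Sum>j<n. M i j s * e j s) \<le> \<phi>' s" .
        qed (use cont i in auto)
        then show ?thesis
          using e0[OF i] by (simp add: \<phi>_def)
      qed
    qed
  qed
  have "(\<lambda>m. b * (inverse (fact m) * (K * x) ^ m)) \<longlonglongrightarrow> b * 0"
    by (intro tendsto_mult tendsto_const summable_LIMSEQ_zero summable_exp)
  moreover have "cmod (e i x) \<le> b * (inverse (fact m) * (K * x) ^ m)" for m
    using iter[rule_format, of i x m] i x by (simp add: divide_inverse mult_ac)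
  ultimately have "cmod (e i x) \<le> 0"
    by (intro LIMSEQ_le_const[where a = "cmod (e i x)"]) auto
  then show ?thesis by simp
qed

text \<open>The reflection x -> - x changes the sign of the matrix and reduces the negative
  half-line to the positive one.\<close>

lemma linear_ode_unique:
  fixes e :: "nat \<Rightarrow> real \<Rightarrow> complex"
  assumes e0: "\<And>i. i < n \<Longrightarrow> e i 0 = 0"
    and de: "\<And>i x. i < n \<Longrightarrow> (e i has_vector_derivative (\<Sum>j<n. M i j x * e j x)) (at x)"
    and K: "\<And>i x. i < n \<Longrightarrow> (\<Sum>j<n. cmod (M i j x)) \<le> K"
    and i: "i < n"
  shows "e i x = 0"
proof (cases "x \<ge> 0")
  case True
  then show ?thesis using linear_ode_unique_nonneg[of n e M K] assms by blast
next
  case False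
  have "(\<lambda>x. e i (- x)) (- x) = 0"
  proof (rule linear_ode_unique_nonneg[of n "\<lambda>i x. e i (- x)" "\<lambda>i j x. - M i j (- x)" K])
    fix i x assume "i < n"
    have "((\<lambda>x. - x :: real) has_vector_derivative -1) (at x)"
      by (auto intro!: derivative_eq_intros)
    from vector_diff_chain_at[OF this de[OF \<open>i < n\<close>]]
    show "((\<lambda>x. e i (- x)) has_vector_derivative (\<Sum>j<n. - M i j (- x) * e j (- x))) (at x)"
      by (simp add: o_def sum_negf)
  qed (use assms False in auto)
  then show ?thesis by simp
qed

text \<open>The path from z goes left to real part - T, where integrating the decay gives the bound,
  and then vertically to the real axis, where the limit is known. The vertical piece is shorter than
  d and the derivative on it is of order exp (-\<alpha> T), so it vanishes as T grows: the limit
  along the real axis governs the whole strip.\<close>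

lemma strip_tail_bound:
  assumes u: "\<And>z. z \<in> strip d \<Longrightarrow> (u has_field_derivative F z) (at z)"
    and F: "\<And>z. z \<in> strip d \<Longrightarrow> cmod (F z) \<le> C * exp (-\<alpha> * \<bar>Re z\<bar>)"
    and \<alpha>: "\<alpha> > 0" and C: "C \<ge> 0"
    and lim: "((\<lambda>x. u (of_real x)) \<longlongrightarrow> r) at_bot"
    and z: "z \<in> strip d" "Re z \<le> 0"
  shows "cmod (u z - r) \<le> C / \<alpha> * exp (\<alpha> * Re z)"
proof -
  have d: "\<bar>Im z\<bar> < d" using z by (simp add: strip_def)
  have in_strip: "Complex x (Im z) \<in> strip d" for x
    using d by (simp add: strip_def)
  have 1: "cmod (u z - u (Complex (-T) (Im z))) \<le> C / \<alpha> * exp (\<alpha> * Re z)" if T: "-T < Re z" for T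
  proof -
    define \<phi> where "\<phi> x = C / \<alpha> * exp (\<alpha> * x)" for x
    have d\<phi>: "(\<phi> has_real_derivative C * exp (\<alpha> * x)) (at x)" for x
      unfolding \<phi>_def using \<alpha> by (auto intro!: derivative_eq_intros)
    have du: "((\<lambda>x. u (Complex x (Im z))) has_vector_derivative F (Complex x (Im z))) (at x)" for x
    proof -
      have "((\<lambda>x. Complex x (Im z)) has_vector_derivative 1) (at x)"
        unfolding Complex_eq by (auto intro!: derivative_eq_intros)
      from field_vector_diff_chain_at[OF this u[OF in_strip]] show ?thesis
        by (simp add: o_def)
    qed
    have "cmod (u (Complex (Re z) (Im z)) - u (Complex (-T) (Im z))) \<le> \<phi> (Re z) - \<phi> (-T)"
    proof (rule differentiable_bound_general[OF T])
      show "continuous_on {- T..Re z} (\<lambda>x. u (Complex x (Im z)))"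
        using du by (intro continuous_at_imp_continuous_on ballI)
          (auto dest!: has_vector_derivative_continuous)
      show "continuous_on {- T..Re z} \<phi>"
        using d\<phi> DERIV_continuous by (intro continuous_at_imp_continuous_on ballI) blast
      show "(\<phi> has_vector_derivative C * exp (\<alpha> * x)) (at x)" for x
        using d\<phi> by (simp add: has_real_derivative_iff_has_vector_derivative)
      show "cmod (F (Complex x (Im z))) \<le> C * exp (\<alpha> * x)" if "x < Re z" for x
        using F[OF in_strip, of x] that z by simp
    qed (rule du)
    also have "\<dots> \<le> C / \<alpha> * exp (\<alpha> * Re z)"
      using C \<alpha> by (simp add: \<phi>_def)
    finally show ?thesis by simp
  qed
  have 2: "cmod (u (Complex (-T) (Im z)) - u (of_real (-T))) \<le> C * exp (-\<alpha> * T) * d" if T: "T > 0" for T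
  proof -
    have "convex (strip d \<inter> {z. Re z \<le> - T})"
      by (intro convex_Int convex_strip convex_halfspace_Re_le)
    then have "cmod (u (Complex (-T) (Im z)) - u (of_real (-T)))
        \<le> C * exp (-\<alpha> * T) * cmod (Complex (-T) (Im z) - of_real (-T))"
    proof (rule field_differentiable_bound[where f' = F])
      fix w assume w: "w \<in> strip d \<inter> {z. Re z \<le> - T}"
      show "(u has_field_derivative F w) (at w within strip d \<inter> {z. Re z \<le> - T})"
        using u w has_field_derivative_at_within by blast
      have "cmod (F w) \<le> C * exp (-\<alpha> * \<bar>Re w\<bar>)"
        using F w by blast
      also have "\<dots> \<le> C * exp (-\<alpha> * T)"
        using w T C mult_left_mono[of T "\<bar>Re w\<bar>" \<alpha>] \<alpha> by (intro mult_left_mono) auto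
      finally show "cmod (F w) \<le> C * exp (-\<alpha> * T)" .
    qed (use in_strip d in \<open>auto simp: strip_def\<close>)
    also have "\<dots> \<le> C * exp (-\<alpha> * T) * d"
      using d C by (intro mult_left_mono) (auto simp: cmod_def)
    finally show ?thesis .
  qed
  have lim': "((\<lambda>T. C / \<alpha> * exp (\<alpha> * Re z) + C * exp (-\<alpha> * T) * d + cmod (u (of_real (-T)) - r))
      \<longlongrightarrow> C / \<alpha> * exp (\<alpha> * Re z) + C * 0 * d + cmod (r - r)) at_top"
  proof (intro tendsto_intros)
    show "((\<lambda>T. exp (-\<alpha> * T)) \<longlongrightarrow> 0) at_top"
      using \<alpha> by (intro filterlim_compose[OF exp_at_bot]
        filterlim_tendsto_neg_mult_at_bot[OF tendsto_const _ filterlim_ident]) auto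
    show "((\<lambda>T. u (of_real (- T))) \<longlongrightarrow> r) at_top"
      using filterlim_compose[OF lim filterlim_uminus_at_bot_at_top] by simp
  qed
  have "\<forall>\<^sub>F T in at_top. cmod (u z - r) \<le>
      C / \<alpha> * exp (\<alpha> * Re z) + C * exp (-\<alpha> * T) * d + cmod (u (of_real (-T)) - r)"
    using eventually_gt_at_top[of "max 0 (- Re z)"]
  proof eventually_elim
    case (elim T)
    have "cmod (u z - r) \<le> cmod (u z - u (Complex (-T) (Im z)))
        + cmod (u (Complex (-T) (Im z)) - u (of_real (-T))) + cmod (u (of_real (-T)) - r)"
      by norm
    with 1[of T] 2[of T] elim show ?case by simp
  qed
  from tendsto_lowerbound[OF lim' this] show ?thesis by simp
qed

section \<open>The cardinal series and its contour integral\<close>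

text \<open>The square of |sin z| is sin^2 (Re z) + sinh^2 (Im z). On the horizontal sides of a
  frame this makes the kernel exponentially small.\<close>

lemma norm_sin_ge_sinh: "cmod (sin z) \<ge> sinh \<bar>Im z\<bar>"
proof (rule power2_le_imp_le)
  have "(sinh \<bar>Im z\<bar>)\<^sup>2 = (sinh (Im z))\<^sup>2"
    by (cases "Im z \<ge> 0") auto
  also have "\<dots> = (exp (2 * Im z) + inverse (exp (2 * Im z)) - 2) / 4"
    by (simp add: sinh_def power2_eq_square algebra_simps flip: exp_add exp_minus)
  also have "\<dots> \<le> (cmod (sin z))\<^sup>2"
    using cos_le_one[of "2 * Re z"] by (simp add: norm_sin_squared)
  finally show "(sinh \<bar>Im z\<bar>)\<^sup>2 \<le> (cmod (sin z))\<^sup>2" .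
qed simp

text \<open>The hypothesis says that Re z is an odd multiple of pi / 2; there |sin z| = cosh (Im z),
  a lower bound that holds at every height, in particular next to the real axis.\<close>

lemma norm_sin_half_integer_ge_1:
  assumes "cos (2 * Re z) = -1"
  shows "cmod (sin z) \<ge> 1"
proof (rule power2_le_imp_le)
  have "exp (2 * Im z) + inverse (exp (2 * Im z)) \<ge> 2"
    using sum_squares_bound[of "exp (Im z)" "exp (- Im z)"]
    by (simp add: power2_eq_square mult.assoc flip: exp_add exp_minus)
  then show "1\<^sup>2 \<le> (cmod (sin z))\<^sup>2"
    using assms by (simp add: norm_sin_squared)
qed simp

section \<open>Contour integrals over rectangles\<close>

lemma
  assumes "continuous_on (path_image (rectpath z w)) f"
  shows contour_integrable_rectpath: "f contour_integrable_on rectpath z w"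
    and contour_integral_rectpath: "contour_integral (rectpath z w) f =
    contour_integral (linepath z (Complex (Re w) (Im z))) f
    + contour_integral (linepath (Complex (Re w) (Im z)) w) f
    + contour_integral (linepath w (Complex (Re z) (Im w))) f
    + contour_integral (linepath (Complex (Re z) (Im w)) z) f"
proof -
  define p where "p = Complex (Re w) (Im z)"
  define q where "q = Complex (Re z) (Im w)"
  have path: "path_image (rectpath z w) =
      closed_segment z p \<union> closed_segment p w \<union> closed_segment w q \<union> closed_segment q z"
    by (simp add: rectpath_def Let_def path_image_join p_def q_def Un_assoc)
  have "f contour_integrable_on linepath z p" "f contour_integrable_on linepath p w"
    "f contour_integrable_on linepath w q" "f contour_integrable_on linepath q z"
    using assms unfolding path
    by (auto intro!: contour_integrable_continuous_linepath intro: continuous_on_subset)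
  then show "f contour_integrable_on rectpath z w" "contour_integral (rectpath z w) f =
      contour_integral (linepath z (Complex (Re w) (Im z))) f
      + contour_integral (linepath (Complex (Re w) (Im z)) w) f
      + contour_integral (linepath w (Complex (Re z) (Im w))) f
      + contour_integral (linepath (Complex (Re z) (Im w)) z) f"
    unfolding rectpath_def Let_def p_def[symmetric] q_def[symmetric]
    by (simp_all add: contour_integral_join)
qed

definition frame :: "real \<Rightarrow> real \<Rightarrow> real \<Rightarrow> complex" where
  "frame R e = rectpath (Complex (-R) (-e)) (Complex R e)"

lemma path_image_frame:
  assumes "R > 0" "e > 0"
  shows "path_image (frame R e) =
    {z. \<bar>Re z\<bar> = R \<and> \<bar>Im z\<bar> \<le> e \<or> \<bar>Im z\<bar> = e \<and> \<bar>Re z\<bar> \<le> R}"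
  unfolding frame_def using assms by (subst path_image_rectpath) (auto split: abs_split)

lemma contour_integral_frame_bound:
  assumes R: "R > 0" "e > 0" and f: "continuous_on (path_image (frame R e)) f"
    and B1: "\<And>z. \<bar>Im z\<bar> = e \<Longrightarrow> \<bar>Re z\<bar> \<le> R \<Longrightarrow> cmod (f z) \<le> B1"
    and B2: "\<And>z. \<bar>Re z\<bar> = R \<Longrightarrow> \<bar>Im z\<bar> \<le> e \<Longrightarrow> cmod (f z) \<le> B2"
  shows "cmod (contour_integral (frame R e) f) \<le> 4 * R * B1 + 4 * e * B2"
proof -
  have B0: "B1 \<ge> 0" "B2 \<ge> 0"
    using order_trans[OF norm_ge_zero B1[of "Complex R e"]] order_trans[OF norm_ge_zero B2[of "Complex R e"]] R
    by auto
  have *: "cmod (contour_integral (linepath z w) f) \<le> B * cmod (w - z)"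
    if "closed_segment z w \<subseteq> path_image (frame R e)" "B \<ge> 0"
      "\<And>x. x \<in> closed_segment z w \<Longrightarrow> cmod (f x) \<le> B" for z w B
    using that f by (intro contour_integral_bound_linepath)
      (auto intro!: contour_integrable_continuous_linepath intro: continuous_on_subset)
  have eq: "contour_integral (frame R e) f =
    contour_integral (linepath (Complex (-R) (-e)) (Complex R (-e))) f
    + contour_integral (linepath (Complex R (-e)) (Complex R e)) f
    + contour_integral (linepath (Complex R e) (Complex (-R) e)) f
    + contour_integral (linepath (Complex (-R) e) (Complex (-R) (-e))) f"
    using contour_integral_rectpath[OF f[unfolded frame_def]] by (simp add: frame_def)
  have horiz: "x \<in> closed_segment (Complex p t) (Complex q t) \<Longrightarrow> Im x = t \<and> \<bar>Re x\<bar> \<le> R"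
    if "\<bar>p\<bar> = R" "\<bar>q\<bar> = R" for p q t x
    using that by (auto simp: closed_segment_same_Im closed_segment_eq_real_ivl split: if_splits)
  have vert: "x \<in> closed_segment (Complex t p) (Complex t q) \<Longrightarrow> Re x = t \<and> \<bar>Im x\<bar> \<le> e"
    if "\<bar>p\<bar> = e" "\<bar>q\<bar> = e" for p q t x
    using that by (auto simp: closed_segment_same_Re closed_segment_eq_real_ivl split: if_splits)
  have h: "cmod (contour_integral (linepath (Complex p t) (Complex q t)) f) \<le> B1 * (2 * R)"
    if "\<bar>p\<bar> = R" "q = - p" "\<bar>t\<bar> = e" for p q t
  proof -
    have "cmod (contour_integral (linepath (Complex p t) (Complex q t)) f)
        \<le> B1 * cmod (Complex q t - Complex p t)"
      using horiz[of p q] that B0 B1 R by (intro *) (auto simp: path_image_frame)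
    also have "cmod (Complex q t - Complex p t) = 2 * R"
      using that by (auto simp: cmod_def real_sqrt_mult)
    finally show ?thesis .
  qed
  have v: "cmod (contour_integral (linepath (Complex t p) (Complex t q)) f) \<le> B2 * (2 * e)"
    if "\<bar>p\<bar> = e" "q = - p" "\<bar>t\<bar> = R" for p q t
  proof -
    have "cmod (contour_integral (linepath (Complex t p) (Complex t q)) f)
        \<le> B2 * cmod (Complex t q - Complex t p)"
      using vert[of p q] that B0 B2 R by (intro *) (auto simp: path_image_frame)
    also have "cmod (Complex t q - Complex t p) = 2 * e"
      using that by (auto simp: cmod_def real_sqrt_mult)
    finally show ?thesis .
  qed
  show ?thesis
    unfolding eq using R
    by (intro order_trans[OF norm_triangle_mono[OF norm_triangle_mono[OF norm_triangle_mono[OF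
      h[of "-R" R "-e"] v[of "-e" e R]] h[of R "-R" e]] v[of e "-e" "-R"]]]) auto
qed


section \<open>The residue formula for the truncated cardinal series\<close>

lemma int_multiple_less:
  fixes h :: real
  assumes "h > 0" "\<bar>real_of_int k * h\<bar> < (real M + 1) * h"
  shows "k \<in> {- int M..int M}"
proof -
  have "\<bar>real_of_int k\<bar> < real M + 1"
    using assms by (simp add: abs_mult)
  then show ?thesis by auto
qed

text \<open>The integrand has residue F(s) / sin (pi s / h) at s and (-1)^j h F(jh) / (pi (jh - s))
  at the node jh. Multiplying by sin (pi s / h) turns the latter into - F(jh) S(j,h)(s), and the
  identity then survives when s is itself a node: the left side is 0, and the series reproduces F at
  a node inside the frame and vanishes at one outside.\<close>

lemma cardinal_residue_formula:
  fixes F :: "complex \<Rightarrow> complex" and h s :: real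
  assumes F: "F holomorphic_on strip d" and e: "0 < e" "e < d" and h: "h > 0"
    and R: "R = (real M + 1/2) * h" and s: "\<bar>s\<bar> \<noteq> R"
  shows "contour_integral (frame R e) (\<lambda>z. F z / ((z - of_real s) * sin (of_real (pi / h) * z)))
      * sin (of_real (pi * s / h))
    = 2 * pi * \<i> * ((if \<bar>s\<bar> < R then F (of_real s) else 0)
        - (\<Sum>j\<in>{- int M..int M}. F (of_real (j * h)) * of_real (S_sinc j h s)))"
proof (cases "sin (pi * s / h) = 0")
  case True
  then obtain k :: int where "pi * s / h = k * pi"
    using sin_zero_iff_int2 by blast
  then have k: "s = k * h"
    using h by (simp add: field_simps)
  have S: "S_sinc j h s = (if j = k then 1 else 0)" for j
  proof (cases "j = k")
    case False
    have "sin (of_int (k - j) * pi) = 0"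
      using sin_zero_iff_int2 by blast
    then have "sin (pi * (of_int k - of_int j)) = 0"
      by (simp add: mult.commute)
    then show ?thesis
      using False h by (simp add: S_sinc_def k)
  qed (use h in \<open>simp add: S_sinc_def k\<close>)
  have "\<bar>s\<bar> < R \<longleftrightarrow> k \<in> {- int M..int M}"
  proof
    assume "\<bar>s\<bar> < R"
    then have "\<bar>k * h\<bar> < (real M + 1) * h"
      using h by (auto simp: R k algebra_simps)
    then show "k \<in> {- int M..int M}"
      using int_multiple_less[OF h] by blast
  next
    assume "k \<in> {- int M..int M}"
    then have "\<bar>real_of_int k\<bar> \<le> real M" by auto
    then have "\<bar>real_of_int k\<bar> < real M + 1/2" by simp
    then show "\<bar>s\<bar> < R"
      unfolding R k abs_mult using h by (simp del: of_int_abs)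
  qed
  then have "(\<Sum>j\<in>{- int M..int M}. F (of_real (j * h)) * of_real (S_sinc j h s))
      = (if \<bar>s\<bar> < R then F (of_real s) else 0)"
    by (simp add: S if_distrib[of of_real] if_distrib[of "(*) _"] sum.delta' cong: if_cong) (simp add: k)
  moreover have "sin (complex_of_real (pi * s / h)) = 0"
    using True by (simp only: sin_of_real of_real_0)
  ultimately show ?thesis by simp
next
  case False
  define sn where "sn z = sin (of_real (pi / h) * z)" for z :: complex
  have sn0: "sn z = 0 \<longleftrightarrow> (\<exists>k::int. z = of_real (k * h))" for z
  proof -
    have "of_real (pi / h) * z = of_real (k * pi) \<longleftrightarrow> z = of_real (k * h)" for k :: int
      using h by (simp add: field_simps)
    then show ?thesis
      unfolding sn_def sin_eq_0 by simp
  qed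
  have sns: "sn (of_real s) = of_real (sin (pi * s / h))"
    by (simp add: sn_def flip: sin_of_real)
  then have sns0: "sn (of_real s) \<noteq> 0"
    using False by simp
  have hol_sn: "sn holomorphic_on S" for S
    unfolding sn_def by (intro holomorphic_intros)
  define f where "f z = F z / ((z - of_real s) * sn z)" for z
  \<comment> \<open>Half the width of an open rectangle that contains the frame but no pole outside
    it: it stops at the next node, and at \<bar>s\<bar> if s lies beyond the frame.\<close>
  define R' where "R' = (if \<bar>s\<bar> < R then (real M + 1) * h else min ((real M + 1) * h) \<bar>s\<bar>)"
  have RR': "0 < R" "R < R'"
    using h s by (auto simp: R R'_def)
  have R'le: "R' \<le> (real M + 1) * h"
    by (simp add: R'_def)
  define S where "S = strip d \<inter> {z. -R' < Re z} \<inter> {z. Re z < R'}"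
  define G where "G = (\<lambda>j::int. complex_of_real (j * h)) ` {- int M..int M}"
  define P where "P = (if \<bar>s\<bar> < R then {complex_of_real s} else {})"
  have G: "z \<in> G \<longleftrightarrow> z \<in> S \<and> sn z = 0" if "z \<in> S" for z
  proof
    assume "z \<in> S \<and> sn z = 0"
    then obtain k :: int where k: "z = of_real (k * h)" and "z \<in> S"
      using sn0 by auto
    then have "\<bar>k * h\<bar> < (real M + 1) * h"
      using R'le by (auto simp: S_def)
    then show "z \<in> G"
      unfolding G_def using int_multiple_less[OF h] k by blast
  qed (use that sn0 in \<open>auto simp: G_def\<close>)
  have GS: "\<bar>Re z\<bar> < R \<and> Im z = 0" if "z \<in> G" for z
  proof -
    from that obtain j :: int where j: "z = of_real (j * h)" "\<bar>real_of_int j\<bar> \<le> real M"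
      unfolding G_def by (force simp: abs_le_iff)
    then have "\<bar>real_of_int j\<bar> < real M + 1/2" by simp
    then show ?thesis
      using h by (simp add: R j(1) abs_mult del: of_int_abs)
  qed
  have PS: "\<bar>Re z\<bar> < R \<and> Im z = 0" if "z \<in> P" for z
    using that by (auto simp: P_def split: if_splits)
  have in_box: "z \<in> box (Complex (-R) (-e)) (Complex R e)" if "z \<in> G \<union> P" for z
    using GS[of z] PS[of z] that e by (auto simp: in_box_complex_iff)
  have PI: "path_image (frame R e) = {z. \<bar>Re z\<bar> = R \<and> \<bar>Im z\<bar> \<le> e \<or> \<bar>Im z\<bar> = e \<and> \<bar>Re z\<bar> \<le> R}"
    using path_image_frame RR' e by blast
  have "open S" "convex S"
    unfolding S_def by (intro open_Int open_strip open_halfspace_Re_lt open_halfspace_Re_gt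
      convex_Int convex_strip convex_halfspace_Re_lt convex_halfspace_Re_gt)+
  have s_S: "of_real s \<in> S \<longleftrightarrow> \<bar>s\<bar> < R"
    using e h by (auto simp: S_def R'_def R strip_def algebra_simps)
  have f_hol: "f holomorphic_on S - (G \<union> P)"
    unfolding f_def using G s_S
    by (intro holomorphic_intros hol_sn holomorphic_on_subset[OF F]) (auto simp: S_def P_def)
  have "contour_integral (frame R e) f
      = 2 * pi * \<i> * (\<Sum>p\<in>G \<union> P. winding_number (frame R e) p * residue f p)"
  proof (rule Residue_theorem[OF \<open>open S\<close> convex_connected[OF \<open>convex S\<close>] _ f_hol])
    show "finite (G \<union> P)" by (simp add: G_def P_def)
    show "valid_path (frame R e)" "pathfinish (frame R e) = pathstart (frame R e)"
      by (simp_all add: frame_def)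
    show "path_image (frame R e) \<subseteq> S - (G \<union> P)"
      unfolding PI using GS PS RR' e by (fastforce simp: S_def strip_def)
    show "\<forall>z. z \<notin> S \<longrightarrow> winding_number (frame R e) z = 0"
      unfolding frame_def using RR' e
      by (intro allI impI winding_number_rectpath_outside) (auto simp: S_def strip_def in_cbox_complex_iff)
  qed
  also have "(\<Sum>p\<in>G \<union> P. winding_number (frame R e) p * residue f p) = (\<Sum>p\<in>G \<union> P. residue f p)"
    using in_box by (intro sum.cong refl) (simp add: frame_def winding_number_rectpath)
  also have "\<dots> = (\<Sum>p\<in>G. residue f p) + (\<Sum>p\<in>P. residue f p)"
    using sn0 sns0 by (intro sum.union_disjoint) (auto simp: G_def P_def)
  also have "(\<Sum>p\<in>P. residue f p) = (if \<bar>s\<bar> < R then F (of_real s) / sn (of_real s) else 0)"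
  proof (cases "\<bar>s\<bar> < R")
    case True
    have "open (S - G)"
      using \<open>open S\<close> by (simp add: G_def finite_imp_closed open_Diff)
    moreover have "of_real s \<in> S - G"
      using True s_S G sns0 by auto
    moreover have "(\<lambda>z. F z / sn z) holomorphic_on S - G"
      using G by (intro holomorphic_intros hol_sn holomorphic_on_subset[OF F]) (auto simp: S_def)
    ultimately have "residue (\<lambda>z. F z / sn z / (z - of_real s)) (of_real s) = F (of_real s) / sn (of_real s)"
      by (rule residue_simple)
    then show ?thesis
      using True by (simp add: P_def f_def[abs_def] mult.commute)
  qed (simp add: P_def)
  also have "(\<Sum>p\<in>G. residue f p) = (\<Sum>j\<in>{- int M..int M}. residue f (of_real (j * h)))"
    unfolding G_def by (subst sum.reindex) (use h in \<open>auto simp: inj_on_def\<close>)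
  also have "\<dots> = (\<Sum>j\<in>{- int M..int M}. - (F (of_real (j * h)) * of_real (S_sinc j h s) / sn (of_real s)))"
  proof (intro sum.cong refl)
    fix j assume j: "j \<in> {- int M..int M}"
    define p where "p = complex_of_real (j * h)"
    have pG: "p \<in> G" unfolding p_def G_def using j by (rule imageI)
    have ps: "p \<noteq> of_real s" using sn0 sns0 unfolding p_def by metis
    have dsn: "(sn has_field_derivative cos (of_real (pi / h) * p) * of_real (pi / h)) (at p)"
      unfolding sn_def[abs_def] using h by (auto intro!: derivative_eq_intros)
    have snp: "sn p = 0" using sn0 unfolding p_def by blast
    have arg: "of_real (pi / h) * p = of_real (j * pi)"
      using h by (simp add: p_def)
    have cosj: "cos (of_real (pi / h) * p) = of_real (cos (j * pi))"
      unfolding arg by (simp only: cos_of_real)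
    have sin0: "sin (j * pi) = 0"
      using sin_zero_iff_int2 by blast
    \<comment> \<open>The sign (-1)^j is its own inverse, which moves it from the denominator of the
      residue into the numerator.\<close>
    have cos2: "cos (j * pi) * cos (j * pi) = 1"
      using sin_cos_squared_add3[of "j * pi"] sin0 by simp
    then have cos0: "cos (j * pi) \<noteq> 0" by auto
    have "residue f p = F p / (p - of_real s) / (cos (of_real (pi / h) * p) * of_real (pi / h))"
    proof (rule residue_simple')
      define S' where "S' = S - ((G - {p}) \<union> P)"
      have "finite ((G - {p}) \<union> P)" by (simp add: G_def P_def)
      then show "open S'"
        using \<open>open S\<close> by (simp add: S'_def finite_imp_closed open_Diff)
      show "p \<in> S'"
        using GS[OF pG] RR' ps e by (auto simp: S'_def S_def strip_def P_def split: if_splits)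
      show "f holomorphic_on S' - {p}"
        by (rule holomorphic_on_subset[OF f_hol]) (auto simp: S'_def)
      have "((\<lambda>w. (sn w - sn p) / (w - p)) \<longlongrightarrow> cos (of_real (pi / h) * p) * of_real (pi / h)) (at p)"
        using dsn by (simp add: has_field_derivative_iff)
      moreover have "isCont F p"
        using e by (intro field_differentiable_imp_continuous_at
          holomorphic_on_imp_differentiable_at[OF F open_strip]) (simp add: p_def strip_def)
      then have "(F \<longlongrightarrow> F p) (at p)"
        by (simp add: isCont_def)
      ultimately have "((\<lambda>w. F w / (w - of_real s) / ((sn w - sn p) / (w - p))) \<longlongrightarrow>
          F p / (p - of_real s) / (cos (of_real (pi / h) * p) * of_real (pi / h))) (at p)"
        using ps h cosj cos0 by (intro tendsto_intros) auto
      then show "((\<lambda>w. f w * (w - p)) \<longlongrightarrow>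
          F p / (p - of_real s) / (cos (of_real (pi / h) * p) * of_real (pi / h))) (at p)"
        by (simp add: f_def snp)
    qed
    also have "\<dots> = F p * (of_real (cos (j * pi) * h) / (of_real pi * (p - of_real s)))"
    proof -
      have "x / q / (c * (p / h)) = x * (c * h / (p * q))"
        if "c * c = 1" "p \<noteq> 0" "q \<noteq> 0" "h \<noteq> 0" for x q c p h :: complex
      proof -
        have "1 / c = c"
          using that by (metis div_by_1 mult_zero_left nonzero_mult_div_cancel_left times_divide_eq_right)
        then have "x / q / (c * (p / h)) = x / q * c / (p / h)"
          by (metis divide_divide_eq_left mult.right_neutral times_divide_eq_right)
        then show ?thesis by (simp add: mult_ac)
      qed
      moreover have "complex_of_real (cos (j * pi)) * of_real (cos (j * pi)) = 1"
        using cos2 by (simp only: flip: of_real_mult) simp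
      ultimately show ?thesis
        unfolding cosj using h ps by simp
    qed
    also have "of_real (cos (j * pi) * h) / (of_real pi * (p - of_real s)) = - of_real (S_sinc j h s) / sn (of_real s)"
    proof -
      have "s \<noteq> j * h" using ps by (auto simp: p_def)
      then have ne: "s - j * h \<noteq> 0" by simp
      have "sin (pi * (s / h - j)) = sin (pi * s / h) * cos (j * pi)"
        using sin_diff[of "pi * s / h" "j * pi"] sin0 by (simp add: algebra_simps)
      then have "S_sinc j h s = sin (pi * s / h) * cos (j * pi) * h / (pi * (s - j * h))"
        using ne h by (simp add: S_sinc_def field_simps)
      then have "cos (j * pi) * h / (pi * (j * h - s)) = - S_sinc j h s / sin (pi * s / h)"
        using False ne by (simp add: field_simps)
      then have "complex_of_real (cos (j * pi) * h / (pi * (j * h - s))) = of_real (- S_sinc j h s / sin (pi * s / h))"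
        by (rule arg_cong)
      then show ?thesis
        by (simp add: p_def sns)
    qed
    finally show "residue f (of_real (j * h)) = - (F (of_real (j * h)) * of_real (S_sinc j h s) / sn (of_real s))"
      by (simp add: p_def)
  qed
  finally have *: "contour_integral (frame R e) f = 2 * pi * \<i> *
      ((\<Sum>j\<in>{- int M..int M}. - (F (of_real (j * h)) * of_real (S_sinc j h s) / sn (of_real s)))
       + (if \<bar>s\<bar> < R then F (of_real s) / sn (of_real s) else 0))" .
  have "contour_integral (frame R e) f * sn (of_real s) = 2 * pi * \<i> *
      ((\<Sum>j\<in>{- int M..int M}. - (F (of_real (j * h)) * of_real (S_sinc j h s)))
       + (if \<bar>s\<bar> < R then F (of_real s) else 0))"
    unfolding * mult.assoc distrib_right sum_distrib_right using sns0 by (simp cong: if_cong)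
  moreover have "sn (of_real s) = sin (of_real (pi * s / h))"
    by (simp add: sn_def)
  ultimately show ?thesis
    by (simp add: f_def[abs_def] sn_def sum_negf)
qed

section \<open>Exchanging an integral over a segment with one over a frame\<close>

lemma continuous_on_contour_integral_linepath:
  fixes f :: "'a::topological_space \<Rightarrow> complex \<Rightarrow> complex"
  assumes "continuous_on (U \<times> closed_segment a b) (\<lambda>(x, z). f x z)"
  shows "continuous_on U (\<lambda>x. contour_integral (linepath a b) (f x))"
proof -
  have "continuous_on U (\<lambda>x. integral (cbox 0 1) (\<lambda>t. f x (linepath a b t) * (b - a)))"
  proof (rule integral_continuous_on_param)
    have "continuous_on (U \<times> cbox 0 1) (\<lambda>y. (\<lambda>(x, z). f x z) (fst y, linepath a b (snd y)))"
      by (intro continuous_on_compose2[OF assms] continuous_intros)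
        (auto simp: linepath_def intro!: continuous_intros simp flip: path_image_linepath simp: path_image_def)
    then show "continuous_on (U \<times> cbox 0 1) (\<lambda>(x, t). f x (linepath a b t) * (b - a))"
      by (auto simp: case_prod_beta intro!: continuous_intros)
  qed
  then show ?thesis
    by (simp add: contour_integral_integral)
qed

text \<open>Fubini is applied to the four sides separately; joint continuity provides the
  integrability needed to split the frame and to put it together again.\<close>

lemma contour_integral_swap_frame:
  assumes cont: "continuous_on (closed_segment p q \<times> path_image (frame R e)) (\<lambda>(s, z). \<Phi> s z)"
    and R: "R > 0" "e > 0"
  shows "contour_integral (linepath p q) (\<lambda>s. contour_integral (frame R e) (\<Phi> s)) =
    contour_integral (frame R e) (\<lambda>z. contour_integral (linepath p q) (\<lambda>s. \<Phi> s z))"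
proof -
  have cont': "continuous_on (path_image (frame R e) \<times> closed_segment p q) (\<lambda>(z, s). \<Phi> s z)"
    using continuous_on_swap_args[OF cont] by simp
  define z1 z2 z3 z4 where z: "z1 = Complex (-R) (-e)" "z2 = Complex R (-e)" "z3 = Complex R e" "z4 = Complex (-R) e"
  have path: "path_image (frame R e) =
      closed_segment z1 z2 \<union> closed_segment z2 z3 \<union> closed_segment z3 z4 \<union> closed_segment z4 z1"
    by (simp add: frame_def rectpath_def Let_def path_image_join Un_assoc z)
  have seg: "closed_segment z1 z2 \<subseteq> path_image (frame R e)" "closed_segment z2 z3 \<subseteq> path_image (frame R e)"
    "closed_segment z3 z4 \<subseteq> path_image (frame R e)" "closed_segment z4 z1 \<subseteq> path_image (frame R e)"
    by (auto simp: path)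
  have decomp: "contour_integral (frame R e) f = contour_integral (linepath z1 z2) f
    + contour_integral (linepath z2 z3) f + contour_integral (linepath z3 z4) f
    + contour_integral (linepath z4 z1) f" if "continuous_on (path_image (frame R e)) f" for f
    using contour_integral_rectpath[OF that[unfolded frame_def]] by (simp add: frame_def z)
  have 1: "continuous_on (path_image (frame R e)) (\<Phi> s)" if "s \<in> closed_segment p q" for s
  proof -
    have "continuous_on (path_image (frame R e)) (\<lambda>z. (\<lambda>(s, z). \<Phi> s z) (s, z))"
      by (rule continuous_on_compose2[OF cont])
        (use that in \<open>auto intro: continuous_on_Pair continuous_on_const continuous_on_id\<close>)
    then show ?thesis by simp
  qed
  have 2: "(\<lambda>s. contour_integral (linepath a b) (\<Phi> s)) contour_integrable_on (linepath p q)"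
    and 3: "contour_integral (linepath p q) (\<lambda>s. contour_integral (linepath a b) (\<Phi> s)) =
      contour_integral (linepath a b) (\<lambda>z. contour_integral (linepath p q) (\<lambda>s. \<Phi> s z))"
    if "closed_segment a b \<subseteq> path_image (frame R e)" for a b
  proof -
    have *: "continuous_on (closed_segment p q \<times> closed_segment a b) (\<lambda>(s, z). \<Phi> s z)"
      using that by (intro continuous_on_subset[OF cont]) auto
    show "(\<lambda>s. contour_integral (linepath a b) (\<Phi> s)) contour_integrable_on (linepath p q)"
      by (intro contour_integrable_continuous_linepath continuous_on_contour_integral_linepath *)
    show "contour_integral (linepath p q) (\<lambda>s. contour_integral (linepath a b) (\<Phi> s)) =
      contour_integral (linepath a b) (\<lambda>z. contour_integral (linepath p q) (\<lambda>s. \<Phi> s z))"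
      using * by (intro contour_integral_swap) auto
  qed
  have "contour_integral (linepath p q) (\<lambda>s. contour_integral (frame R e) (\<Phi> s)) =
     contour_integral (linepath p q) (\<lambda>s. contour_integral (linepath z1 z2) (\<Phi> s)
      + contour_integral (linepath z2 z3) (\<Phi> s) + contour_integral (linepath z3 z4) (\<Phi> s)
      + contour_integral (linepath z4 z1) (\<Phi> s))"
    using 1 by (intro contour_integral_cong) (auto simp: decomp)
  also have "\<dots> = contour_integral (frame R e) (\<lambda>z. contour_integral (linepath p q) (\<lambda>s. \<Phi> s z))"
    by (subst decomp[OF continuous_on_contour_integral_linepath[OF cont']]) (simp add: contour_integral_add contour_integrable_add 2 3 seg)
  finally show ?thesis .
qed

text \<open>Integration by parts; the remaining integral is dominated by that of
  \<open>2 / ((s - Re z)\<^sup>2 + \<delta>\<^sup>2)\<close>, an arctangent.\<close>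
lemma oscillatory_kernel_bound:
  fixes h \<delta> p q :: real
  assumes pq: "p < q" and h: "h > 0" and \<delta>: "\<delta> > 0"
    and far: "\<And>s. p \<le> s \<Longrightarrow> s \<le> q \<Longrightarrow> (cmod (z - of_real s))\<^sup>2 \<ge> ((s - Re z)\<^sup>2 + \<delta>\<^sup>2) / 2"
  shows "cmod (contour_integral (linepath (of_real p) (of_real q))
    (\<lambda>s. sin (of_real (pi / h) * s) / (z - s))) \<le> 4 * h / \<delta>"
proof -
  define \<kappa> where "\<kappa> = pi / h"
  have \<kappa>: "\<kappa> > 0" using h by (simp add: \<kappa>_def)
  define b where "b x = of_real (cos (\<kappa> * x)) / (z - of_real x)" for x :: real
  define J where "J x = of_real (cos (\<kappa> * x)) / (z - of_real x)\<^sup>2" for x :: real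
  define I where "I x = sin (of_real \<kappa> * of_real x) / (z - of_real x)" for x :: real
  have pos: "(s - Re z)\<^sup>2 + \<delta>\<^sup>2 > 0" for s
    using \<delta> by (simp add: add_nonneg_pos)
  have ne: "z - of_real s \<noteq> 0" if "s \<in> {p..q}" for s
    using far[of s] pos[of s] that by auto
  have J_int: "J integrable_on {p..q}"
    unfolding J_def using ne by (intro integrable_continuous_real continuous_intros) auto
  \<comment> \<open>This is the integration by parts: \<open>I\<close> is the wanted integrand,
    \<open>b\<close> the boundary term and \<open>J\<close> the new integrand. Solving for the
    integral of \<open>I\<close> produces the factor 1 / \<kappa> = h / pi, which is the
    gain.\<close>
  have "((\<lambda>x. J x - of_real \<kappa> * I x) has_integral (b q - b p)) {p..q}"
  proof (rule fundamental_theorem_of_calculus)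
    fix x assume x: "x \<in> {p..q}"
    have eq: "b = (\<lambda>x. (\<lambda>w. cos (of_real \<kappa> * w) / (z - w)) (of_real x))"
      by (simp add: b_def fun_eq_iff flip: of_real_mult cos_of_real)
    have "((\<lambda>w. cos (of_real \<kappa> * w) / (z - w)) has_field_derivative J x - of_real \<kappa> * I x) (at (of_real x))"
    proof -
      have alg: "(- (k * S) * D + c) / (D * D) = c / D\<^sup>2 - k * (S / D)" if "D \<noteq> 0" for k S D c :: complex
        using that by (simp add: field_simps power2_eq_square)
      have "((\<lambda>w. cos (of_real \<kappa> * w) / (z - w)) has_field_derivative
          (- (of_real \<kappa> * sin (of_real \<kappa> * of_real x)) * (z - of_real x) + cos (of_real \<kappa> * of_real x))
          / ((z - of_real x) * (z - of_real x))) (at (of_real x))"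
        using ne[OF x] by (auto intro!: derivative_eq_intros)
      then show ?thesis
        unfolding alg[OF ne[OF x]] J_def I_def by (simp flip: cos_of_real)
    qed
    from field_vector_diff_chain_at[OF has_vector_derivative_of_real[OF DERIV_ident[THEN DERIV_cong]], OF refl this]
    show "(b has_vector_derivative J x - of_real \<kappa> * I x) (at x within {p..q})"
      unfolding eq o_def by (auto intro: has_vector_derivative_at_within)
  qed (use pq in auto)
  from has_integral_diff[OF integrable_integral[OF J_int] this]
  have "((\<lambda>x. of_real \<kappa> * I x) has_integral (integral {p..q} J - (b q - b p))) {p..q}"
    by simp
  from has_integral_mult_right[OF this, of "inverse (of_real \<kappa>)"]
  have "(I has_integral (integral {p..q} J - (b q - b p)) / of_real \<kappa>) {p..q}"
    using \<kappa> by (simp add: divide_inverse mult.commute[of _ "inverse _"] flip: mult.assoc)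
  then have eq: "contour_integral (linepath (of_real p) (of_real q)) (\<lambda>s. sin (of_real (pi / h) * s) / (z - s))
      = (integral {p..q} J - (b q - b p)) / of_real \<kappa>"
    using pq by (subst contour_integral_linepath_Reals_eq) (auto simp: I_def[abs_def] \<kappa>_def intro!: integral_unique)
  define A where "A x = 2 / \<delta> * arctan ((x - Re z) / \<delta>)" for x
  have A: "((\<lambda>x. 2 / ((x - Re z)\<^sup>2 + \<delta>\<^sup>2)) has_integral (A q - A p)) {p..q}"
  proof (rule fundamental_theorem_of_calculus)
    fix x
    have "(A has_real_derivative 2 / \<delta> * (inverse (1 + ((x - Re z) / \<delta>)\<^sup>2) * (1 / \<delta>))) (at x)"
      unfolding A_def using \<delta> by (auto intro!: derivative_eq_intros)
    also have "2 / \<delta> * (inverse (1 + ((x - Re z) / \<delta>)\<^sup>2) * (1 / \<delta>)) = 2 / ((x - Re z)\<^sup>2 + \<delta>\<^sup>2)"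
    proof -
      have "1 + ((x - Re z) / \<delta>)\<^sup>2 = ((x - Re z)\<^sup>2 + \<delta>\<^sup>2) / \<delta>\<^sup>2"
        using \<delta> by (simp add: field_simps power2_eq_square)
      then show ?thesis
        using \<delta> by (simp add: power2_eq_square)
    qed
    finally show "(A has_vector_derivative 2 / ((x - Re z)\<^sup>2 + \<delta>\<^sup>2)) (at x within {p..q})"
      by (simp add: has_real_derivative_iff_has_vector_derivative has_vector_derivative_at_within)
  qed (use pq in auto)
  have "cmod (integral {p..q} J) \<le> integral {p..q} (\<lambda>x. 2 / ((x - Re z)\<^sup>2 + \<delta>\<^sup>2))"
  proof (rule integral_norm_bound_integral[OF J_int])
    show "(\<lambda>x. 2 / ((x - Re z)\<^sup>2 + \<delta>\<^sup>2)) integrable_on {p..q}"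
      using A by blast
    fix x assume x: "x \<in> {p..q}"
    have "cmod (J x) \<le> 1 / (cmod (z - of_real x))\<^sup>2"
      unfolding J_def norm_divide norm_power norm_of_real by (intro divide_right_mono) auto
    also have "\<dots> \<le> 1 / (((x - Re z)\<^sup>2 + \<delta>\<^sup>2) / 2)"
      using far[of x] pos[of x] x by (intro divide_left_mono) (auto intro!: mult_pos_pos ne)
    finally show "cmod (J x) \<le> 2 / ((x - Re z)\<^sup>2 + \<delta>\<^sup>2)" by simp
  qed
  also have "\<dots> = A q - A p"
    using A by (rule integral_unique)
  also have "\<dots> \<le> 2 / \<delta> * pi"
  proof -
    have "arctan ((q - Re z) / \<delta>) - arctan ((p - Re z) / \<delta>) \<le> pi"
      using arctan_ubound[of "(q - Re z) / \<delta>"] arctan_lbound[of "(p - Re z) / \<delta>"] by linarith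
    then have "2 / \<delta> * (arctan ((q - Re z) / \<delta>) - arctan ((p - Re z) / \<delta>)) \<le> 2 / \<delta> * pi"
      using \<delta> by (intro mult_left_mono) auto
    then show ?thesis by (simp only: A_def right_diff_distrib)
  qed
  finally have 1: "cmod (integral {p..q} J) \<le> 2 * pi / \<delta>" by simp
  have 2: "cmod (b x) \<le> 2 / \<delta>" if "x \<in> {p..q}" for x
  proof -
    have "(\<delta> / 2)\<^sup>2 \<le> ((x - Re z)\<^sup>2 + \<delta>\<^sup>2) / 2"
      using zero_le_power2[of "x - Re z"] zero_le_power2[of \<delta>] by (simp add: power_divide)
    also have "\<dots> \<le> (cmod (z - of_real x))\<^sup>2"
      using far that by simp
    finally have *: "\<delta> / 2 \<le> cmod (z - of_real x)"
      by (rule power2_le_imp_le) simp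
    have "cmod (b x) \<le> 1 / cmod (z - of_real x)"
      unfolding b_def norm_divide norm_of_real by (intro divide_right_mono) auto
    also have "\<dots> \<le> 1 / (\<delta> / 2)"
      using * \<delta> by (intro divide_left_mono mult_pos_pos) auto
    finally show ?thesis by simp
  qed
  have "cmod (integral {p..q} J - (b q - b p)) \<le> 2 * pi / \<delta> + (2 / \<delta> + 2 / \<delta>)"
    using 1 2[of p] 2[of q] pq by (intro norm_triangle_le_diff add_mono order_trans[OF norm_triangle_ineq4]) auto
  \<comment> \<open>2 pi + 4 is at most 4 pi because pi is at least 2; dividing by \<kappa> = pi / h
    then cancels pi.\<close>
  also have "\<dots> \<le> 4 * pi / \<delta>"
    using \<delta> pi_ge_two by (simp add: field_simps)
  finally show ?thesis
    unfolding eq norm_divide norm_of_real using h \<delta> by (simp add: \<kappa>_def field_simps)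
qed

section \<open>Interpolation and quadrature errors\<close>

definition sinc_interp :: "real \<Rightarrow> nat \<Rightarrow> (complex \<Rightarrow> complex) \<Rightarrow> real \<Rightarrow> complex" where
  "sinc_interp h M F s = (\<Sum>j\<in>{- int M..int M}. F (of_real (of_int j * h)) * of_real (S_sinc j h s))"

lemma abs_S_sinc_le_1: "\<bar>S_sinc j h x\<bar> \<le> 1"
  using abs_sin_x_le_abs_x[of "pi * (x / h - j)"] by (simp add: S_sinc_def divide_le_eq_1 abs_mult)

lemma sin_frame_horizontal:
  assumes "h > 0" "\<bar>Im z\<bar> = e" "e > 0"
  shows "cmod (sin (of_real (pi / h) * z)) \<ge> sinh (pi * e / h)" "sinh (pi * e / h) > 0"
  using norm_sin_ge_sinh[of "of_real (pi / h) * z"] assms by (simp_all add: abs_mult)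

lemma sin_frame_vertical:
  assumes "h > 0" "\<bar>Re z\<bar> = (real M + 1/2) * h"
  shows "cmod (sin (of_real (pi / h) * z)) \<ge> 1"
proof (rule norm_sin_half_integer_ge_1)
  have "cos (2 * Re (of_real (pi / h) * z)) = cos (2 * (pi / h) * \<bar>Re z\<bar>)"
    by (cases "Re z \<ge> 0") (auto simp: mult.assoc)
  also have "2 * (pi / h) * \<bar>Re z\<bar> = pi + of_int (int M) * (2 * pi)"
    using assms by (simp add: field_simps)
  also have "cos \<dots> = -1"
    using cos_int_2pin[of "int M"] by (simp add: cos_add mult_ac)
  finally show "cos (2 * Re (of_real (pi / h) * z)) = -1" .
qed

section \<open>Errors measured on a single frame\<close>

locale strip_decay =
  fixes F :: "complex \<Rightarrow> complex" and d \<alpha> C :: real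
  assumes hol: "F holomorphic_on strip d"
    and decay: "\<And>z. z \<in> strip d \<Longrightarrow> cmod (F z) \<le> C * exp (-\<alpha> * \<bar>Re z\<bar>)"
    and d_pos: "d > 0" and \<alpha>_pos: "\<alpha> > 0" and C_nonneg: "C \<ge> 0"
begin

lemma bounded_by_C: "z \<in> strip d \<Longrightarrow> cmod (F z) \<le> C"
  using decay[of z] mult_left_mono[of "exp (-\<alpha> * \<bar>Re z\<bar>)" 1 C] \<alpha>_pos C_nonneg by auto

context
  fixes e h R :: real and M :: nat
  assumes e: "0 < e" "e < d" and h: "h > 0" and R: "R = (real M + 1/2) * h"
begin

lemma R_pos: "R > 0"
  using h R by (simp add: add_nonneg_pos)

lemma frame_in_strip: "z \<in> path_image (frame R e) \<Longrightarrow> z \<in> strip d"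
  using e R_pos by (auto simp: path_image_frame strip_def)

lemma sin_frame_nonzero: "z \<in> path_image (frame R e) \<Longrightarrow> sin (of_real (pi / h) * z) \<noteq> 0"
  using sin_frame_horizontal[OF h, of z e] sin_frame_vertical[OF h, of z M] e R R_pos
  by (auto simp: path_image_frame)

lemma continuous_on_frame: "continuous_on (path_image (frame R e)) F"
  using frame_in_strip by (intro continuous_on_subset[OF holomorphic_on_imp_continuous_on[OF hol]]) auto

text \<open>The horizontal sides profit from the large sine, the vertical ones from the decay of
  \<open>F\<close> at real part R. On the latter 1 / (z - s) must be kept bounded, hence the
  distance h / 2 required of s. For s beyond the frame the residue at s is absent and only the
  series remains.\<close>

lemma sinc_interp_frame_error:
  assumes s: "\<bar>\<bar>s\<bar> - R\<bar> \<ge> h / 2"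
  shows "cmod ((if \<bar>s\<bar> < R then F (of_real s) else 0) - sinc_interp h M F s)
    \<le> 4 * R * (C / (e * sinh (pi * e / h))) + 4 * e * (C * exp (-\<alpha> * R) * (2 / h))"
proof -
  define f where "f z = F z / ((z - of_real s) * sin (of_real (pi / h) * z))" for z
  define B where "B = 4 * R * (C / (e * sinh (pi * e / h))) + 4 * e * (C * exp (-\<alpha> * R) * (2 / h))"
  have sR: "\<bar>s\<bar> \<noteq> R" using s h by auto
  have dist: "cmod (z - of_real s) \<ge> e" if "\<bar>Im z\<bar> = e" for z
    using abs_Im_le_cmod[of "z - of_real s"] that by simp
  have dist': "cmod (z - of_real s) \<ge> h / 2" if "\<bar>Re z\<bar> = R" for z
    using abs_Re_le_cmod[of "z - of_real s"] that s by (simp; linarith)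
  have ne: "z \<noteq> of_real s" if "z \<in> path_image (frame R e)" for z
    using dist[of z] dist'[of z] that e h R_pos by (auto simp: path_image_frame)
  have "cmod (contour_integral (frame R e) f) \<le> B"
    unfolding B_def
  proof (rule contour_integral_frame_bound[OF R_pos e(1)])
    show "continuous_on (path_image (frame R e)) f"
      unfolding f_def using ne sin_frame_nonzero
      by (intro continuous_intros continuous_on_frame) auto
  next
    fix z assume z: "\<bar>Im z\<bar> = e" "\<bar>Re z\<bar> \<le> R"
    then have "z \<in> strip d" using e by (simp add: strip_def)
    then show "cmod (f z) \<le> C / (e * sinh (pi * e / h))"
      unfolding f_def norm_divide norm_mult
      using bounded_by_C dist[OF z(1)] sin_frame_horizontal[OF h z(1) e(1)] e C_nonneg
      by (intro frac_le mult_mono) auto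
  next
    fix z assume z: "\<bar>Re z\<bar> = R" "\<bar>Im z\<bar> \<le> e"
    then have "z \<in> strip d" using e by (simp add: strip_def)
    then have "cmod (f z) \<le> (C * exp (-\<alpha> * R)) / (h / 2 * 1)"
      unfolding f_def norm_divide norm_mult
      using decay[of z] dist'[OF z(1)] sin_frame_vertical[OF h, of z M] z h C_nonneg R
      by (intro frac_le mult_mono) auto
    then show "cmod (f z) \<le> C * exp (-\<alpha> * R) * (2 / h)" by simp
  qed
  moreover have "cmod (sin (of_real (pi * s / h))) \<le> 1"
    unfolding sin_of_real norm_of_real by (rule abs_sin_le_one)
  ultimately have "cmod (contour_integral (frame R e) f * sin (of_real (pi * s / h))) \<le> B"
    using mult_mono[of "cmod (contour_integral (frame R e) f)" B "cmod (sin (of_real (pi * s / h)))" 1]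
      order_trans[OF norm_ge_zero] by (force simp: norm_mult)
  moreover have "contour_integral (frame R e) f * sin (of_real (pi * s / h)) =
      2 * pi * \<i> * ((if \<bar>s\<bar> < R then F (of_real s) else 0) - sinc_interp h M F s)"
    unfolding f_def sinc_interp_def by (rule cardinal_residue_formula[OF hol e h R sR])
  ultimately have "cmod (2 * pi * \<i> * ((if \<bar>s\<bar> < R then F (of_real s) else 0) - sinc_interp h M F s)) \<le> B"
    by (simp only:)
  then have "2 * pi * cmod ((if \<bar>s\<bar> < R then F (of_real s) else 0) - sinc_interp h M F s) \<le> B"
    by (simp add: norm_mult split del: if_split)
  moreover have "x \<le> 2 * pi * x" if "x \<ge> 0" for x
    using that pi_ge_two mult_right_mono[of 1 "2 * pi" x] by simp
  ultimately show ?thesis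
    unfolding B_def by (meson norm_ge_zero order_trans)
qed

text \<open>After the exchange of integrals the part depending on s is sin (pi s / h) / (z - s),
  whose integral is at most 4 h / e for z on the horizontal sides and 8 on the vertical ones,
  however long the interval is. The flag \<open>b\<close> says whether the interval lies inside or
  outside the frame.\<close>

lemma sinc_interp_frame_integral:
  assumes pq: "p < q"
    and gap: "\<And>s. p \<le> s \<Longrightarrow> s \<le> q \<Longrightarrow> \<bar>\<bar>s\<bar> - R\<bar> \<ge> h / 2"
    and inside: "\<And>s. p \<le> s \<Longrightarrow> s \<le> q \<Longrightarrow> \<bar>s\<bar> < R \<longleftrightarrow> b"
  shows "cmod (integral {p..q} (\<lambda>s. (if b then F (of_real s) else 0) - sinc_interp h M F s))
    \<le> 4 * R * (C * (4 * h / e) / sinh (pi * e / h)) + 4 * e * (C * exp (-\<alpha> * R) * 8)"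
proof -
  define B where "B = 4 * R * (C * (4 * h / e) / sinh (pi * e / h)) + 4 * e * (C * exp (-\<alpha> * R) * 8)"
  define sn where "sn z = sin (of_real (pi / h) * z)" for z :: complex
  define \<Phi> where "\<Phi> s z = F z / sn z * (sn s / (z - s))" for s z
  define W where "W z = contour_integral (linepath (of_real p) (of_real q)) (\<lambda>s. sn s / (z - s))" for z
  have seg: "s \<in> closed_segment (complex_of_real p) (of_real q) \<longleftrightarrow> s \<in> of_real ` {p..q}" for s
    using pq by (simp add: closed_segment_of_real closed_segment_eq_real_ivl)
  have real_gap: "\<bar>x - s\<bar> \<ge> h / 2" if "\<bar>x\<bar> = R" "p \<le> s" "s \<le> q" for x s
    using gap[OF that(2,3)] that(1) by linarith
  have ne: "z \<noteq> of_real s" if "z \<in> path_image (frame R e)" "p \<le> s" "s \<le> q" for z s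
    using real_gap[of "Re z" s] that e h R_pos by (auto simp: path_image_frame)
  have ne': "of_real s \<notin> path_image (frame R e)" if "p \<le> s" "s \<le> q" for s
    using ne that by blast
  have cont: "continuous_on (closed_segment (of_real p) (of_real q) \<times> path_image (frame R e)) (\<lambda>(s, z). \<Phi> s z)"
    unfolding \<Phi>_def case_prod_beta sn_def using ne' sin_frame_nonzero
    by (intro continuous_intros continuous_on_compose2[OF continuous_on_frame]) (auto simp: seg simp del: of_real_divide)
  have "continuous_on (path_image (frame R e))
      (\<lambda>z. contour_integral (linepath (of_real p) (of_real q)) (\<lambda>s. \<Phi> s z))"
    using continuous_on_swap_args[OF cont] by (intro continuous_on_contour_integral_linepath) simp
  moreover have \<Phi>W: "contour_integral (linepath (of_real p) (of_real q)) (\<lambda>s. \<Phi> s z) = F z / sn z * W z"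
    if z: "z \<in> path_image (frame R e)" for z
    unfolding \<Phi>_def W_def sn_def
    by (intro contour_integral_lmul contour_integrable_continuous_linepath continuous_intros)
      (use ne' z in \<open>auto simp: seg\<close>)
  ultimately have contW: "continuous_on (path_image (frame R e)) (\<lambda>z. F z / sn z * W z)"
    by (simp cong: continuous_on_cong)
  have "cmod (contour_integral (frame R e) (\<lambda>z. F z / sn z * W z)) \<le> B"
    unfolding B_def
  proof (rule contour_integral_frame_bound[OF R_pos e(1) contW])
    fix z assume z: "\<bar>Im z\<bar> = e" "\<bar>Re z\<bar> \<le> R"
    have strip: "z \<in> strip d" using z e by (simp add: strip_def)
    have "cmod (W z) \<le> 4 * h / e"
      unfolding W_def sn_def
    proof (rule oscillatory_kernel_bound[OF pq h e(1)])
      fix s :: real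
      have "(cmod (z - of_real s))\<^sup>2 = (s - Re z)\<^sup>2 + e\<^sup>2"
        using z by (simp add: cmod_power2 power2_commute flip: power2_abs[of "Im z"])
      then show "((s - Re z)\<^sup>2 + e\<^sup>2) / 2 \<le> (cmod (z - of_real s))\<^sup>2" by simp
    qed
    then have "cmod (F z / sn z * W z) \<le> C / sinh (pi * e / h) * (4 * h / e)"
      unfolding sn_def norm_divide norm_mult
      using bounded_by_C[OF strip] sin_frame_horizontal[OF h z(1) e(1)] C_nonneg
      by (intro mult_mono frac_le) auto
    then show "cmod (F z / sn z * W z) \<le> C * (4 * h / e) / sinh (pi * e / h)"
      by (simp add: mult.commute)
  next
    fix z assume z: "\<bar>Re z\<bar> = R" "\<bar>Im z\<bar> \<le> e"
    have strip: "z \<in> strip d" using z e by (simp add: strip_def)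
    have "cmod (W z) \<le> 4 * h / (h / 2)"
      unfolding W_def sn_def
    proof (rule oscillatory_kernel_bound[OF pq h])
      fix s assume s: "p \<le> s" "s \<le> q"
      have "(h / 2)\<^sup>2 \<le> \<bar>s - Re z\<bar>\<^sup>2"
        using real_gap[OF z(1) s] h by (intro power_mono) (auto simp: abs_minus_commute)
      also have "\<bar>s - Re z\<bar>\<^sup>2 \<le> (cmod (z - of_real s))\<^sup>2"
        using abs_Re_le_cmod[of "z - of_real s"] by (intro power_mono) (auto simp: abs_minus_commute)
      finally have 1: "(h / 2)\<^sup>2 \<le> (cmod (z - of_real s))\<^sup>2" .
      have "(s - Re z)\<^sup>2 \<le> (cmod (z - of_real s))\<^sup>2"
        by (simp add: cmod_power2 power2_commute)
      \<comment> \<open>The two lower bounds are averaged; for this reason the kernel estimate asks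
        only for half of the sum of squares.\<close>
      with 1 show "((s - Re z)\<^sup>2 + (h / 2)\<^sup>2) / 2 \<le> (cmod (z - of_real s))\<^sup>2" by simp
    qed (use h in auto)
    then have "cmod (W z) \<le> 8" using h by simp
    then have "cmod (F z / sn z * W z) \<le> C * exp (-\<alpha> * R) / 1 * 8"
      unfolding sn_def norm_divide norm_mult
      using decay[OF strip] sin_frame_vertical[OF h, of z M] z R C_nonneg
      by (intro mult_mono frac_le) auto
    then show "cmod (F z / sn z * W z) \<le> C * exp (-\<alpha> * R) * 8" by simp
  qed
  also have "contour_integral (frame R e) (\<lambda>z. F z / sn z * W z) =
      contour_integral (frame R e) (\<lambda>z. contour_integral (linepath (of_real p) (of_real q)) (\<lambda>s. \<Phi> s z))"
    using \<Phi>W by (intro contour_integral_cong) auto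
  also have "\<dots> = contour_integral (linepath (of_real p) (of_real q)) (\<lambda>s. contour_integral (frame R e) (\<Phi> s))"
    using contour_integral_swap_frame[OF cont R_pos e(1)] by simp
  also have "\<dots> = integral {p..q} (\<lambda>s. contour_integral (frame R e) (\<Phi> (of_real s)))"
    using pq by (subst contour_integral_linepath_Reals_eq) auto
  also have "\<dots> = integral {p..q} (\<lambda>s. 2 * pi * \<i> * ((if b then F (of_real s) else 0) - sinc_interp h M F s))"
  proof (rule integral_cong)
    fix s assume s: "s \<in> {p..q}"
    define f where "f z = F z / ((z - of_real s) * sin (of_real (pi / h) * z))" for z
    have sR: "\<bar>s\<bar> \<noteq> R" using gap[of s] s h by auto
    have "continuous_on (path_image (frame R e)) f"
      unfolding f_def using ne[of _ s] s sin_frame_nonzero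
      by (intro continuous_intros continuous_on_frame) auto
    then have "f contour_integrable_on frame R e"
      unfolding frame_def by (rule contour_integrable_rectpath)
    then have "contour_integral (frame R e) (\<lambda>z. f z * sn (of_real s)) = contour_integral (frame R e) f * sn (of_real s)"
      by (rule contour_integral_rmul)
    moreover have "\<Phi> (of_real s) = (\<lambda>z. f z * sn (of_real s))"
      by (simp add: \<Phi>_def f_def sn_def fun_eq_iff mult.commute)
    ultimately have "contour_integral (frame R e) (\<Phi> (of_real s)) = contour_integral (frame R e) f * sn (of_real s)"
      by simp
    also have "sn (of_real s) = sin (of_real (pi * s / h))"
      by (simp add: sn_def)
    also have "contour_integral (frame R e) f * \<dots> =
        2 * pi * \<i> * ((if \<bar>s\<bar> < R then F (of_real s) else 0) - sinc_interp h M F s)"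
      unfolding f_def sinc_interp_def by (rule cardinal_residue_formula[OF hol e h R sR])
    finally show "contour_integral (frame R e) (\<Phi> (of_real s)) =
        2 * pi * \<i> * ((if b then F (of_real s) else 0) - sinc_interp h M F s)"
      using inside[of s] s by auto
  qed
  also have "\<dots> = 2 * pi * \<i> * integral {p..q} (\<lambda>s. (if b then F (of_real s) else 0) - sinc_interp h M F s)"
    by (rule integral_mult_right)
  finally have "2 * pi * cmod (integral {p..q} (\<lambda>s. (if b then F (of_real s) else 0) - sinc_interp h M F s)) \<le> B"
    by (simp add: norm_mult split del: if_split)
  moreover have "x \<le> 2 * pi * x" if "x \<ge> 0" for x
    using that pi_ge_two mult_right_mono[of 1 "2 * pi" x] by simp
  ultimately show ?thesis
    unfolding B_def by (meson norm_ge_zero order_trans)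
qed

end

end

section \<open>The balanced grid\<close>

lemma sinh_ge_exp_div_4: "sinh x \<ge> exp x / 4" if "x \<ge> 1" for x :: real
proof -
  have "2 \<le> exp (2 * x)"
    using exp_ge_add_one_self[of "2 * x"] that by linarith
  then have "exp (- x) * 2 \<le> exp (- x) * exp (2 * x)"
    by (intro mult_left_mono) auto
  also have "\<dots> = exp x"
    by (simp flip: exp_add)
  finally have "exp (- x) * 2 \<le> exp x" .
  then show ?thesis by (simp add: sinh_def)
qed

text \<open>The equation \<open>grid\<close> equates the discretisation exponent pi d / h with the
  truncation exponent \<alpha> N h; \<open>2 * h \<le> d\<close> keeps the contour height d - h at
  least d / 2.\<close>

locale sinc_grid = strip_decay +
  fixes h :: real and N :: nat
  assumes h: "h > 0" "2 * h \<le> d" and N: "N \<ge> 1" and grid: "real N * h\<^sup>2 = pi * d / \<alpha>"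
begin

definition err where "err = exp (- (pi * d / h))"

text \<open>A deliberately generous constant serving two estimates: the computation in
  \<open>frame_error_constants\<close> yields the coefficients 80 and 8 for interpolation, and 320
  and 32 for integration, where four times \<open>K_frame\<close> is allowed.\<close>

definition K_frame where "K_frame = 200 * pi * exp pi / \<alpha> + 32 * d"

lemma err_pos: "err > 0" by (simp add: err_def)

lemma err_alt: "err = exp (-\<alpha> * (real N * h))"
proof -
  have "pi * d / h = \<alpha> * (real N * h)"
    using grid h \<alpha>_pos by (simp add: field_simps power2_eq_square)
  then show ?thesis by (simp add: err_def)
qed

lemma exp_le_err: "real N * h \<le> x \<Longrightarrow> exp (-\<alpha> * x) \<le> err"
  unfolding err_alt using \<alpha>_pos by simp

lemma K_frame_pos: "K_frame > 0"
  using \<alpha>_pos d_pos by (simp add: K_frame_def add_pos_pos)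

lemma inverse_sinh_le: "1 / sinh (pi * (d - h) / h) \<le> 4 * exp pi * err"
proof -
  have eq: "pi * (d - h) / h = pi * d / h - pi" and ge: "pi * (d - h) / h \<ge> 1"
    using h pi_ge_two mult_mono[of 1 pi h "d - h"] by (simp_all add: field_simps)
  then have "exp (pi * d / h - pi) / 4 \<le> sinh (pi * (d - h) / h)"
    using sinh_ge_exp_div_4[OF ge] by simp
  then have "1 / sinh (pi * (d - h) / h) \<le> 1 / (exp (pi * d / h - pi) / 4)"
    using ge by (intro divide_left_mono mult_pos_pos) (simp_all only: sinh_real_pos_iff, auto)
  also have "\<dots> = 4 * exp pi * err"
    by (simp add: err_def exp_diff exp_minus field_simps)
  finally show ?thesis .
qed

lemma frame_height: "0 < d - h" "d - h < d" "1 / (d - h) \<le> 2 / d"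
  using h d_pos by (auto simp: field_simps)

text \<open>Handles the frames with M = N and M = N + 1 together: N + 3/2 is at most 5/2 N because N
  is at least 1.\<close>

lemma frame_width:
  assumes "M \<le> N + 1"
  shows "(real M + 1/2) * h \<le> 5 / 2 * (pi * d / (\<alpha> * h))"
proof -
  have "(real M + 1/2) * h \<le> 5 / 2 * (real N * h)"
    unfolding mult.assoc[symmetric] using assms N h by (intro mult_right_mono) auto
  also have "real N * h = pi * d / (\<alpha> * h)"
    using grid h \<alpha>_pos by (simp add: field_simps power2_eq_square)
  finally show ?thesis .
qed

text \<open>The width R is of order 1 / h. In the first bound this remains as the factor 1 / h; in
  the second it is cancelled by the factor h gained from oscillation.\<close>

lemma frame_error_constants:
  assumes M: "N \<le> M" "M \<le> N + 1" and R: "R = (real M + 1/2) * h"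
  shows "4 * R * (C / ((d - h) * sinh (pi * (d - h) / h))) + 4 * (d - h) * (C * exp (-\<alpha> * R) * (2 / h))
      \<le> C * err * K_frame / h"
    and "4 * R * (C * (4 * h / (d - h)) / sinh (pi * (d - h) / h)) + 4 * (d - h) * (C * exp (-\<alpha> * R) * 8)
      \<le> C * err * (4 * K_frame)"
proof -
  have R0: "R \<ge> 0" using R h by simp
  have Rle: "R \<le> 5 / 2 * (pi * d / (\<alpha> * h))"
    using frame_width[OF M(2)] R by simp
  have "real N * h \<le> R"
    unfolding R using M h by (intro mult_right_mono) auto
  then have eR: "exp (-\<alpha> * R) \<le> err" by (rule exp_le_err)
  have s: "1 / sinh (pi * (d - h) / h) \<ge> 0"
    using frame_height h by simp
  have "R * (1 / (d - h)) * (1 / sinh (pi * (d - h) / h))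
      \<le> 5 / 2 * (pi * d / (\<alpha> * h)) * (2 / d) * (4 * exp pi * err)"
    using Rle R0 frame_height s inverse_sinh_le h d_pos \<alpha>_pos by (intro mult_mono) auto
  also have "\<dots> = 20 * pi * exp pi / \<alpha> * err / h"
    using d_pos by (simp add: field_simps)
  finally have A: "R * (1 / (d - h)) * (1 / sinh (pi * (d - h) / h)) \<le> 20 * pi * exp pi / \<alpha> * err / h" .
  have B: "(d - h) * exp (-\<alpha> * R) \<le> d * err"
    using eR frame_height h by (intro mult_mono) auto
  have "4 * R * (C / ((d - h) * sinh (pi * (d - h) / h))) + 4 * (d - h) * (C * exp (-\<alpha> * R) * (2 / h))
      = 4 * C * (R * (1 / (d - h)) * (1 / sinh (pi * (d - h) / h))) + 8 * C / h * ((d - h) * exp (-\<alpha> * R))"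
    by (simp add: mult_ac)
  also have "\<dots> \<le> 4 * C * (20 * pi * exp pi / \<alpha> * err / h) + 8 * C / h * (d * err)"
    using A B C_nonneg h by (intro add_mono mult_left_mono) auto
  also have "\<dots> = C * err * (80 * pi * exp pi / \<alpha> + 8 * d) / h"
    by (simp add: add_divide_distrib distrib_left mult_ac)
  also have "\<dots> \<le> C * err * K_frame / h"
    unfolding K_frame_def using h C_nonneg err_pos d_pos \<alpha>_pos
    by (intro divide_right_mono mult_left_mono add_mono) auto
  finally show "4 * R * (C / ((d - h) * sinh (pi * (d - h) / h))) + 4 * (d - h) * (C * exp (-\<alpha> * R) * (2 / h))
      \<le> C * err * K_frame / h" .
  have "4 * R * (C * (4 * h / (d - h)) / sinh (pi * (d - h) / h)) + 4 * (d - h) * (C * exp (-\<alpha> * R) * 8)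
      = 16 * h * C * (R * (1 / (d - h)) * (1 / sinh (pi * (d - h) / h))) + 32 * C * ((d - h) * exp (-\<alpha> * R))"
    by (simp add: mult_ac)
  also have "\<dots> \<le> 16 * h * C * (20 * pi * exp pi / \<alpha> * err / h) + 32 * C * (d * err)"
    using A B C_nonneg h by (intro add_mono mult_left_mono) auto
  also have "\<dots> = C * err * (320 * pi * exp pi / \<alpha> + 32 * d)"
    using h by (simp add: field_simps)
  also have "\<dots> \<le> C * err * (4 * K_frame)"
  proof -
    define X where "X = pi * exp pi / \<alpha>"
    have "0 \<le> X" using \<alpha>_pos by (simp add: X_def)
    then have "320 * X + 32 * d \<le> 4 * (200 * X + 32 * d)"
      using d_pos by argo
    then have "320 * pi * exp pi / \<alpha> + 32 * d \<le> 4 * (200 * pi * exp pi / \<alpha> + 32 * d)"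
      by (simp add: X_def mult.assoc)
    then show ?thesis
      unfolding K_frame_def using C_nonneg err_pos by (intro mult_left_mono) auto
  qed
  finally show "4 * R * (C * (4 * h / (d - h)) / sinh (pi * (d - h) / h)) + 4 * (d - h) * (C * exp (-\<alpha> * R) * 8)
      \<le> C * err * (4 * K_frame)" .
qed

lemma decay_real: "real N * h \<le> \<bar>x\<bar> \<Longrightarrow> cmod (F (of_real x)) \<le> C * err"
  using decay[of "of_real x"] exp_le_err[of "\<bar>x\<bar>"] C_nonneg d_pos
  by (auto intro: order_trans mult_left_mono)

lemma sinc_interp_Suc:
  "sinc_interp h (Suc N) F x = sinc_interp h N F x
    + F (of_real (of_int (int N + 1) * h)) * of_real (S_sinc (int N + 1) h x)
    + F (of_real (of_int (- int N - 1) * h)) * of_real (S_sinc (- int N - 1) h x)"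
proof -
  have "{- int (Suc N)..int (Suc N)} = insert (int N + 1) (insert (- int N - 1) {- int N..int N})"
    by auto
  then show ?thesis
    unfolding sinc_interp_def by (simp add: add_ac)
qed

text \<open>The frame through the half-integer node nearest to \<open>x\<close> is avoided by switching to the next one,
  at the cost of two more terms of the series.\<close>
lemma sinc_interp_error:
  "cmod (F (of_real x) - sinc_interp h N F x) \<le> C * err * (K_frame / h + 2)"
proof -
  define R where "R = (real N + 1/2) * h"
  have Ce: "C * err \<ge> 0" using C_nonneg err_pos by simp
  show ?thesis
  proof (cases "\<bar>\<bar>x\<bar> - R\<bar> \<ge> h / 2")
    case True
    have "cmod ((if \<bar>x\<bar> < R then F (of_real x) else 0) - sinc_interp h N F x) \<le> C * err * K_frame / h"
      using order_trans[OF sinc_interp_frame_error[OF frame_height(1,2) h(1) R_def True]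
        frame_error_constants(1)[OF _ _ R_def]] by simp
    moreover have "cmod (F (of_real x)) \<le> C * err" if "\<not> \<bar>x\<bar> < R"
      using that h by (intro decay_real) (auto simp: R_def field_simps)
    ultimately show ?thesis
      using Ce norm_triangle_ineq[of "F (of_real x)" "- sinc_interp h N F x"]
      by (auto simp: distrib_left split: if_splits)
  next
    case False
    define R' where "R' = (real (Suc N) + 1/2) * h"
    have R': "R' = R + h" by (simp add: R_def R'_def algebra_simps)
    have "\<bar>\<bar>x\<bar> - R'\<bar> \<ge> h / 2" "\<bar>x\<bar> < R'"
      using False h unfolding R' by linarith+
    then have "cmod (F (of_real x) - sinc_interp h (Suc N) F x) \<le> C * err * K_frame / h"
      using order_trans[OF sinc_interp_frame_error[OF frame_height(1,2) h(1) R'_def, of x]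
        frame_error_constants(1)[OF _ _ R'_def]] by simp
    moreover have "cmod (F (of_real (of_int j * h)) * of_real (S_sinc j h x)) \<le> C * err"
      if "\<bar>j\<bar> = int N + 1" for j
    proof -
      have "real N \<le> \<bar>real_of_int j\<bar>" using that by linarith
      then have "real N * h \<le> \<bar>of_int j * h\<bar>"
        using h by (simp add: abs_mult)
      then have "cmod (F (of_real (of_int j * h))) * \<bar>S_sinc j h x\<bar> \<le> C * err * 1"
        by (intro mult_mono decay_real abs_S_sinc_le_1 Ce) auto
      then show ?thesis by (simp add: norm_mult)
    qed
    from norm_triangle_mono[OF this[of "int N + 1"] this[of "- int N - 1"]]
    have "cmod (sinc_interp h (Suc N) F x - sinc_interp h N F x) \<le> C * err + C * err"
      unfolding sinc_interp_Suc by (simp add: algebra_simps)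
    ultimately have "cmod (F (of_real x) - sinc_interp h N F x) \<le> C * err * K_frame / h + (C * err + C * err)"
      using norm_triangle_mono by fastforce
    then show ?thesis by (simp add: algebra_simps)
  qed
qed

text \<open>Since \<open>Si\<close> tends to - pi / 2 at minus infinity, h times
  \<open>sigma (m - j)\<close> is the integral of S(j,h) from there up to mh. The rule thus
  integrates the truncated series exactly, and its error is an integral of the interpolation error.
  The range is cut at - N h and - (N + 1) h: both outer pieces keep distance h / 2 from the vertical
  sides and cost four \<open>K_frame\<close> each, while the middle one, of length h, meets a side
  and is estimated pointwise at the cost of one.\<close>

lemma quadrature_error:
  assumes u: "\<And>z. z \<in> strip d \<Longrightarrow> (u has_field_derivative F z) (at z)"
    and lim: "((\<lambda>x. u (of_real x)) \<longlongrightarrow> r) at_bot"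
    and m: "m \<in> {- int N..int N}"
  shows "cmod (u (of_real (of_int m * h)) - r
      - of_real h * (\<Sum>j\<in>{- int N..int N}. of_real (sigma (m - j)) * F (of_real (of_int j * h))))
    \<le> C * err * (9 * K_frame + 2 * h + 1 / \<alpha>)"
proof -
  define R where "R = (real N + 1/2) * h"
  define Sg where "Sg x = (\<Sum>j\<in>{- int N..int N}. F (of_real (of_int j * h)) * of_real (h / pi * Si (pi * (x / h - of_int j))))" for x
  \<comment> \<open>An antiderivative of the error \<open>D b\<close>. Left of the frame the residue
    formula does not contain \<open>F\<close>, so \<open>u\<close> is omitted there, and the missing
    u(x1) - r is supplied by the tail estimate.\<close>
  define H where "H b x = (if b then u (of_real x) else 0) - Sg x" for b x
  define D where "D b x = (if b then F (of_real x) else 0) - sinc_interp h N F x" for b x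
  have Ce: "C * err \<ge> 0" using C_nonneg err_pos by simp
  have dSi: "((\<lambda>x. h / pi * Si (pi * (x / h - of_int j))) has_real_derivative S_sinc j h x) (at x)" for j x
    unfolding S_sinc_def using h
    by (auto intro!: derivative_eq_intros DERIV_chain2[OF DERIV_Si])
  have dSg: "(Sg has_vector_derivative sinc_interp h N F x) (at x)" for x
    unfolding Sg_def sinc_interp_def
    by (intro has_vector_derivative_sum has_vector_derivative_mult_right has_vector_derivative_of_real dSi)
  have du: "((\<lambda>x. u (of_real x)) has_vector_derivative F (of_real x)) (at x)" for x
    using field_vector_diff_chain_at[OF has_vector_derivative_of_real[OF DERIV_ident] u[of "of_real x"]] d_pos
    by (simp add: o_def)
  have dH: "(H b has_vector_derivative D b x) (at x)" for b x
    unfolding H_def D_def using dSg du by (cases b) (auto intro!: derivative_eq_intros)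
  have H_diff: "cmod (H b q - H b p) \<le> C * err * (4 * K_frame)"
    if pq: "p < q" and gap: "\<And>s. p \<le> s \<Longrightarrow> s \<le> q \<Longrightarrow> \<bar>\<bar>s\<bar> - R\<bar> \<ge> h / 2"
      and inside: "\<And>s. p \<le> s \<Longrightarrow> s \<le> q \<Longrightarrow> \<bar>s\<bar> < R \<longleftrightarrow> b" for p q b
  proof -
    have "(D b has_integral (H b q - H b p)) {p..q}"
      using dH pq by (intro fundamental_theorem_of_calculus) (auto intro: has_vector_derivative_at_within)
    then have "integral {p..q} (D b) = H b q - H b p"
      by (rule integral_unique)
    then show ?thesis
      using order_trans[OF sinc_interp_frame_integral[OF frame_height(1,2) h(1) R_def pq gap inside]
        frame_error_constants(2)[OF _ _ R_def]] by (simp add: D_def[abs_def])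
  qed
  define x0 where "x0 = - (real N * h)"
  define x1 where "x1 = - ((real N + 1) * h)"
  have x10: "x1 = x0 - h" by (simp add: x0_def x1_def algebra_simps)
  have R0: "R = - x0 + h / 2" by (simp add: x0_def R_def algebra_simps)
  have x0: "x0 \<le> 0" using h by (simp add: x0_def)
  have mh: "x0 \<le> of_int m * h" "of_int m * h \<le> - x0"
  proof -
    have "real_of_int m \<le> real N" "- real N \<le> real_of_int m" using m by auto
    then show "x0 \<le> of_int m * h" "of_int m * h \<le> - x0"
      using h mult_right_mono[of "real_of_int m" "real N" h] mult_right_mono[of "- real N" "real_of_int m" h]
      by (auto simp: x0_def)
  qed
  have 1: "cmod (H True (of_int m * h) - H True x0) \<le> C * err * (4 * K_frame)"
  proof (cases "x0 = of_int m * h")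
    case True
    then show ?thesis using Ce K_frame_pos by simp
  next
    case False
    then show ?thesis
      using mh h x0 by (intro H_diff) (auto simp: R0)
  qed
  have 2: "cmod (H True x0 - H True x1) \<le> C * err * (K_frame + 2 * h)"
  proof -
    define \<phi> where "\<phi> x = C * err * (K_frame / h + 2) * x" for x
    have "cmod (H True x0 - H True x1) \<le> \<phi> x0 - \<phi> x1"
    proof (rule differentiable_bound_general[where f' = "D True"])
      show "continuous_on {x1..x0} (H True)"
        using dH by (intro continuous_at_imp_continuous_on ballI) (auto dest!: has_vector_derivative_continuous)
      show "continuous_on {x1..x0} \<phi>"
        unfolding \<phi>_def by (intro continuous_intros)
      show "(\<phi> has_vector_derivative C * err * (K_frame / h + 2)) (at x)" for x
        unfolding \<phi>_def has_real_derivative_iff_has_vector_derivative[symmetric]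
        by (auto intro!: derivative_eq_intros)
      show "cmod (D True x) \<le> C * err * (K_frame / h + 2)" for x
        unfolding D_def using sinc_interp_error[of x] by simp
    qed (use h x10 dH in auto)
    also have "\<dots> = C * err * (K_frame + 2 * h)"
      using h by (simp add: \<phi>_def x10 field_simps)
    finally show ?thesis .
  qed
  \<comment> \<open>The subtracted term is the limit of \<open>H False\<close> at minus infinity;
    the frame estimate on [T, x1] does not depend on T and passes to the limit.\<close>
  have 3: "cmod (H False x1 - of_real h / 2 * (\<Sum>j\<in>{- int N..int N}. F (of_real (of_int j * h)))) \<le> C * err * (4 * K_frame)"
  proof (rule tendsto_upperbound)
    have "((\<lambda>T. Si (pi * (T / h - of_int j))) \<longlongrightarrow> - (pi / 2)) at_bot" for j
    proof -
      have "((\<lambda>T. Si (- T)) \<longlongrightarrow> - (pi / 2)) at_top"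
        using tendsto_minus[OF Si_at_top]
        by (rule Lim_transform_eventually)
          (use eventually_ge_at_top[of 0] in \<open>eventually_elim, simp add: Si_neg\<close>)
      then have "(Si \<longlongrightarrow> - (pi / 2)) at_bot"
        by (simp add: filterlim_at_bot_mirror)
      moreover have "filterlim (\<lambda>T. pi * (T / h - of_int j)) at_bot at_bot"
        using h by real_asymp
      ultimately show ?thesis by (rule filterlim_compose)
    qed
    then have "(Sg \<longlongrightarrow> (\<Sum>j\<in>{- int N..int N}. F (of_real (of_int j * h)) * of_real (h / pi * (- (pi / 2))))) at_bot"
      unfolding Sg_def by (intro tendsto_intros)
    also have "(\<Sum>j\<in>{- int N..int N}. F (of_real (of_int j * h)) * of_real (h / pi * (- (pi / 2))))
        = - (of_real h / 2 * (\<Sum>j\<in>{- int N..int N}. F (of_real (of_int j * h))))"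
      by (simp add: sum_distrib_left sum_negf mult.commute)
    finally have "(H False \<longlongrightarrow> - (- (of_real h / 2 * (\<Sum>j\<in>{- int N..int N}. F (of_real (of_int j * h)))))) at_bot"
      unfolding H_def using tendsto_minus by fastforce
    then show "((\<lambda>T. cmod (H False x1 - H False T)) \<longlongrightarrow>
        cmod (H False x1 - of_real h / 2 * (\<Sum>j\<in>{- int N..int N}. F (of_real (of_int j * h))))) at_bot"
      by (intro tendsto_intros) simp
    show "\<forall>\<^sub>F T in at_bot. cmod (H False x1 - H False T) \<le> C * err * (4 * K_frame)"
      using eventually_le_at_bot[of "x1 - 1"]
    proof eventually_elim
      case (elim T)
      then show ?case
        using h x0 by (intro H_diff) (auto simp: R0 x10)
    qed
  qed simp
  have 4: "cmod (u (of_real x1) - r) \<le> C * err * (1 / \<alpha>)"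
  proof -
    have "cmod (u (of_real x1) - r) \<le> C / \<alpha> * exp (\<alpha> * x1)"
      using strip_tail_bound[OF u decay \<alpha>_pos C_nonneg lim, where z = "of_real x1" and d = d] d_pos h
      by (simp add: x1_def del: of_real_minus of_real_mult)
    also have "exp (\<alpha> * x1) \<le> err"
      using exp_le_err[of "- x1"] h by (simp add: x1_def algebra_simps)
    then have "C / \<alpha> * exp (\<alpha> * x1) \<le> C / \<alpha> * err"
      using C_nonneg \<alpha>_pos by (intro mult_left_mono) auto
    finally show ?thesis
      by (simp add: mult.commute)
  qed
  have sg: "of_real h * (\<Sum>j\<in>{- int N..int N}. of_real (sigma (m - j)) * F (of_real (of_int j * h)))
      = of_real h / 2 * (\<Sum>j\<in>{- int N..int N}. F (of_real (of_int j * h))) + Sg (of_int m * h)"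
    unfolding Sg_def sum_distrib_left sum.distrib[symmetric] using h
    by (intro sum.cong refl) (simp add: sigma_def field_simps)
  have "u (of_real (of_int m * h)) - r
      - of_real h * (\<Sum>j\<in>{- int N..int N}. of_real (sigma (m - j)) * F (of_real (of_int j * h)))
    = (H True (of_int m * h) - H True x0) + (H True x0 - H True x1)
      + (H False x1 - of_real h / 2 * (\<Sum>j\<in>{- int N..int N}. F (of_real (of_int j * h))))
      + (u (of_real x1) - r)"
    unfolding sg by (simp add: H_def)
  also have "cmod \<dots> \<le> C * err * (4 * K_frame) + C * err * (K_frame + 2 * h)
      + C * err * (4 * K_frame) + C * err * (1 / \<alpha>)"
    by (intro norm_triangle_mono 1 2 3 4)
  finally show ?thesis by (simp add: algebra_simps)
qed

end

section \<open>Stability of the discrete system\<close>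

text \<open>The derivative of \<open>Si x + cos x / x\<close> is \<open>- cos x / x\<^sup>2\<close>, which is absolutely integrable at infinity.\<close>
lemma Si_asymptotic:
  assumes t: "t > 0"
  shows "\<bar>pi / 2 - Si t\<bar> \<le> 2 / t"
proof -
  define G where "G x = Si x + cos x / x" for x
  have "\<bar>pi / 2 + 0 - G t\<bar> \<le> 1 / t"
  proof (rule tendsto_upperbound)
    have "((\<lambda>x::real. cos x / x) \<longlongrightarrow> 0) at_top"
      by (rule tendsto_0_le[where f = "\<lambda>x. 1 / x" and K = 1])
        (real_asymp, auto simp: divide_right_mono intro!: always_eventually)
    then show "((\<lambda>T. \<bar>G T - G t\<bar>) \<longlongrightarrow> \<bar>pi / 2 + 0 - G t\<bar>) at_top"
      unfolding G_def by (intro tendsto_intros Si_at_top)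
    show "\<forall>\<^sub>F T in at_top. \<bar>G T - G t\<bar> \<le> 1 / t"
      using eventually_gt_at_top[of t]
    proof eventually_elim
      case (elim T)
      define \<phi> where "\<phi> x = - 1 / x" for x :: real
      have dG: "(G has_vector_derivative - cos x / x\<^sup>2) (at x)" if "x > 0" for x
        unfolding G_def has_real_derivative_iff_has_vector_derivative[symmetric] using that
        by (auto intro!: derivative_eq_intros DERIV_Si simp: field_simps power2_eq_square)
      have d\<phi>: "(\<phi> has_vector_derivative 1 / x\<^sup>2) (at x)" if "x > 0" for x
        unfolding \<phi>_def has_real_derivative_iff_has_vector_derivative[symmetric] using that
        by (auto intro!: derivative_eq_intros simp: power2_eq_square)
      have "norm (G T - G t) \<le> \<phi> T - \<phi> t"
      proof (rule differentiable_bound_general[OF elim])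
        show "continuous_on {t..T} G" "continuous_on {t..T} \<phi>"
          using has_vector_derivative_continuous[OF dG] has_vector_derivative_continuous[OF d\<phi>] t
          by (auto intro!: continuous_at_imp_continuous_on)
        show "(G has_vector_derivative - cos x / x\<^sup>2) (at x)" "(\<phi> has_vector_derivative 1 / x\<^sup>2) (at x)"
          if "t < x" for x
          using dG[of x] d\<phi>[of x] that t by auto
        show "norm (- cos x / x\<^sup>2) \<le> 1 / x\<^sup>2" for x
          by (simp add: divide_right_mono)
      qed
      also have "\<dots> \<le> 1 / t"
        using elim t by (simp add: \<phi>_def)
      finally show ?case by simp
    qed
  qed simp
  moreover have "\<bar>cos t / t\<bar> \<le> 1 / t"
    using t by (simp add: divide_right_mono)
  moreover have "2 / t = 1 / t + 1 / t" by simp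
  ultimately show ?thesis
    unfolding G_def by linarith
qed

text \<open>For k > 0 the tail of \<open>Si\<close> leaves at most 2 / (pi^2 k); negative k follow
  by oddness. The step function takes the value 0 at k = 0, so that the triangular part is strict
  and each row refers only to earlier entries; the diagonal value 1/2 belongs to the
  remainder.\<close>

lemma sigma_approx: "\<bar>sigma k - (if k > 0 then 1 else 0)\<bar> \<le> 1 / (1 + real_of_int \<bar>k\<bar>)"
proof -
  have pos: "\<bar>Si (pi * real_of_int l) / pi - 1 / 2\<bar> \<le> 1 / (1 + real_of_int l)" if "l > 0" for l
  proof -
    have "\<bar>Si (pi * real_of_int l) / pi - 1 / 2\<bar> = \<bar>pi / 2 - Si (pi * real_of_int l)\<bar> / pi"
      by (subst abs_minus_commute) (simp add: diff_divide_distrib abs_div_pos)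
    also have "\<dots> \<le> 2 / (pi * real_of_int l) / pi"
      using Si_asymptotic[of "pi * real_of_int l"] that by (intro divide_right_mono) simp_all
    also have "\<dots> \<le> 1 / (1 + real_of_int l)"
    proof -
      have "1 + real_of_int l \<le> 2 * real_of_int l" using that by simp
      also have "\<dots> \<le> pi * real_of_int l"
        using that by (intro mult_right_mono pi_ge_two) auto
      finally have "1 + real_of_int l \<le> pi * real_of_int l" .
      then have "2 * (1 + real_of_int l) \<le> pi * (pi * real_of_int l)"
        using that pi_ge_two by (intro mult_mono) auto
      then show ?thesis using that by (simp add: field_simps)
    qed
    finally show ?thesis .
  qed
  consider "k > 0" | "k = 0" | "k < 0" by linarith
  then show ?thesis
  proof cases
    case 1
    then show ?thesis using pos[of k] by (simp add: sigma_def algebra_simps)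
  next
    case 2
    then show ?thesis by (simp add: sigma_def Si_def flip: zero_ereal_def)
  next
    case 3
    then have "Si (pi * of_int k) = - Si (pi * of_int (- k))"
      using Si_neg[of "pi * of_int (- k)"] by (simp add: mult_nonneg_nonpos)
    then show ?thesis
      using pos[of "- k"] 3 by (simp add: sigma_def algebra_simps)
  qed
qed

section \<open>Harmonic row sums and the discrete Gronwall inequality\<close>

lemma sum_inverse_distance_le:
  "p < m \<Longrightarrow> (\<Sum>q<m. 1 / (1 + real_of_int \<bar>int p - int q\<bar>)) \<le> 2 * harm m"
proof -
  assume p: "p < m"
  have 1: "(\<Sum>q<Suc p. 1 / (1 + real_of_int \<bar>int p - int q\<bar>)) \<le> harm m"
  proof -
    have "(\<Sum>q<Suc p. 1 / (1 + real_of_int \<bar>int p - int q\<bar>)) = (\<Sum>k\<in>{1..Suc p}. inverse (real k))"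
      by (rule sum.reindex_bij_witness[of _ "\<lambda>k. Suc p - k" "\<lambda>q. Suc p - q"])
        (auto simp: of_nat_diff inverse_eq_divide add_ac)
    also have "\<dots> \<le> harm m"
      unfolding harm_def using p by (intro sum_mono2) auto
    finally show ?thesis .
  qed
  have 2: "(\<Sum>q\<in>{Suc p..<m}. 1 / (1 + real_of_int \<bar>int p - int q\<bar>)) \<le> harm m"
  proof -
    have "(\<Sum>q\<in>{Suc p..<m}. 1 / (1 + real_of_int \<bar>int p - int q\<bar>)) = (\<Sum>k\<in>{2..m - p}. inverse (real k))"
      by (rule sum.reindex_bij_witness[of _ "\<lambda>k. k + p - 1" "\<lambda>q. Suc q - p"])
        (auto simp: of_nat_diff inverse_eq_divide add_ac)
    also have "\<dots> \<le> harm m"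
      unfolding harm_def by (intro sum_mono2) auto
    finally show ?thesis .
  qed
  have "{..<m} = {..<Suc p} \<union> {Suc p..<m}" "{..<Suc p} \<inter> {Suc p..<m} = {}"
    using p by auto
  then have "(\<Sum>q<m. 1 / (1 + real_of_int \<bar>int p - int q\<bar>)) =
      (\<Sum>q<Suc p. 1 / (1 + real_of_int \<bar>int p - int q\<bar>)) + (\<Sum>q\<in>{Suc p..<m}. 1 / (1 + real_of_int \<bar>int p - int q\<bar>))"
    by (simp only: sum.union_disjoint finite_lessThan finite_atLeastLessThan)
  then show ?thesis using 1 2 by linarith
qed

lemma harm_le_ln: "m \<ge> 1 \<Longrightarrow> harm m \<le> 1 + ln (real m)"
  using decseqD[OF decseq_harm_diff_ln, of 0 "m - 1"] by (simp add: harm_def)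

text \<open>Induction with the bound \<beta> times the product of 1 + w q over q < p: the increments
  w q times the product over r < q telescope to that product, which the exponential of the sum
  dominates.\<close>

lemma discrete_Gronwall:
  fixes Y :: "nat \<Rightarrow> nat \<Rightarrow> complex" and M :: "nat \<Rightarrow> nat \<Rightarrow> nat \<Rightarrow> complex"
  assumes Y: "\<And>i p. i < n \<Longrightarrow> p < m \<Longrightarrow> cmod (Y i p) \<le> \<beta> + (\<Sum>q<p. \<Sum>j<n. cmod (M i j q) * cmod (Y j q))"
    and M: "\<And>i q. i < n \<Longrightarrow> q < m \<Longrightarrow> (\<Sum>j<n. cmod (M i j q)) \<le> w q"
    and \<beta>: "\<beta> \<ge> 0" and i: "i < n" and p: "p < m"
  shows "cmod (Y i p) \<le> \<beta> * exp (\<Sum>q<m. w q)"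
proof -
  have w: "w q \<ge> 0" if "q < m" for q
    using order_trans[OF sum_nonneg M[OF i that]] by auto
  have "\<forall>i<n. cmod (Y i p) \<le> \<beta> * (\<Prod>q<p. 1 + w q)"
    using p
  proof (induction p rule: less_induct)
    case (less p)
    show ?case
    proof (intro allI impI)
      fix i assume i: "i < n"
      have "cmod (Y i p) \<le> \<beta> + (\<Sum>q<p. \<Sum>j<n. cmod (M i j q) * cmod (Y j q))"
        using Y i less.prems by blast
      also have "\<dots> \<le> \<beta> + (\<Sum>q<p. w q * (\<beta> * (\<Prod>r<q. 1 + w r)))"
      proof (intro add_left_mono sum_mono)
        fix q assume q: "q \<in> {..<p}"
        have "(\<Sum>j<n. cmod (M i j q) * cmod (Y j q)) \<le> (\<Sum>j<n. cmod (M i j q) * (\<beta> * (\<Prod>r<q. 1 + w r)))"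
          using less.IH[of q] less.prems q by (intro sum_mono mult_left_mono) auto
        also have "\<dots> \<le> w q * (\<beta> * (\<Prod>r<q. 1 + w r))"
          unfolding sum_distrib_right[symmetric] using M[OF i, of q] less.prems q \<beta> w
          by (intro mult_right_mono mult_nonneg_nonneg prod_nonneg) (auto intro!: add_nonneg_nonneg)
        finally show "(\<Sum>j<n. cmod (M i j q) * cmod (Y j q)) \<le> w q * (\<beta> * (\<Prod>r<q. 1 + w r))" .
      qed
      also have "\<dots> = \<beta> * (\<Prod>q<p. 1 + w q)"
        by (induction p) (auto simp: algebra_simps)
      finally show "cmod (Y i p) \<le> \<beta> * (\<Prod>q<p. 1 + w q)" .
    qed
  qed
  with i have "cmod (Y i p) \<le> \<beta> * (\<Prod>q<p. 1 + w q)" by blast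
  also have "(\<Prod>q<p. 1 + w q) \<le> (\<Prod>q<p. exp (w q))"
    using w p by (intro prod_mono) (auto intro: exp_ge_add_one_self add_nonneg_nonneg)
  also have "\<dots> = exp (\<Sum>q<p. w q)"
    by (simp add: exp_sum)
  also have "\<dots> \<le> exp (\<Sum>q<m. w q)"
    using w p by (simp, intro sum_mono2) auto
  finally show ?thesis using \<beta> by (simp add: mult_left_mono)
qed

text \<open>The matrix \<open>\<sigma>\<^bsub>p-q\<^esub>\<close> is a strictly lower triangular matrix of ones, which the discrete
  Gronwall inequality controls, up to a perturbation whose rows have logarithmic sums.\<close>
lemma volterra_stability:
  fixes Y b :: "nat \<Rightarrow> nat \<Rightarrow> complex" and M :: "nat \<Rightarrow> nat \<Rightarrow> nat \<Rightarrow> complex"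
  assumes Y: "\<And>i p. i < n \<Longrightarrow> p < m \<Longrightarrow>
      Y i p = (\<Sum>q<m. of_real (sigma (int p - int q)) * (\<Sum>j<n. M i j q * Y j q)) + b i p"
    and M: "\<And>i q. i < n \<Longrightarrow> q < m \<Longrightarrow> (\<Sum>j<n. cmod (M i j q)) \<le> w q"
    and W: "\<And>q. q < m \<Longrightarrow> w q \<le> W" and S: "(\<Sum>q<m. w q) \<le> S"
    and small: "exp S * (2 * W * harm m) \<le> 1 / 2"
    and b: "\<And>i p. i < n \<Longrightarrow> p < m \<Longrightarrow> cmod (b i p) \<le> \<beta>" and i: "i < n" and p: "p < m"
  shows "cmod (Y i p) \<le> 2 * exp S * \<beta>"
proof -
  \<comment> \<open>The perturbation is treated as an extra inhomogeneity of size \<epsilon> V.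
    Applying Gronwall at the entry where the maximum is attained, \<open>small\<close> lets half of
    V be absorbed on the left, which produces the factor 2.\<close>
  define V where "V = Max ((\<lambda>(i, p). cmod (Y i p)) ` ({..<n} \<times> {..<m}))"
  have V: "cmod (Y i p) \<le> V" if "i < n" "p < m" for i p
    unfolding V_def using that by (intro Max_ge) (auto intro!: image_eqI[of _ _ "(i, p)"])
  have "V \<in> (\<lambda>(i, p). cmod (Y i p)) ` ({..<n} \<times> {..<m})"
    unfolding V_def using i p by (intro Max_in) auto
  then obtain i0 p0 where V_eq: "V = cmod (Y i0 p0)" and i0: "i0 < n" and p0: "p0 < m"
    by auto
  have V0: "V \<ge> 0" by (simp add: V_eq)
  have w: "w q \<ge> 0" if "q < m" for q
    using order_trans[OF sum_nonneg M[OF i that]] by auto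
  have W0: "W \<ge> 0" using order_trans[OF w W] p by blast
  have \<beta>0: "\<beta> \<ge> 0" using order_trans[OF norm_ge_zero b[OF i p]] .
  define \<epsilon> where "\<epsilon> = 2 * W * harm m"
  have \<epsilon>0: "\<epsilon> \<ge> 0" using W0 by (simp add: \<epsilon>_def harm_nonneg)
  have row: "cmod (Y i p) \<le> (\<beta> + \<epsilon> * V) + (\<Sum>q<p. \<Sum>j<n. cmod (M i j q) * cmod (Y j q))"
    if i: "i < n" and p: "p < m" for i p
  proof -
    define T where "T q = (\<Sum>j<n. M i j q * Y j q)" for q
    define \<tau> where "\<tau> q = (if q < p then 1 else 0 :: real)" for q
    have T: "cmod (T q) \<le> W * V" if "q < m" for q
    proof -
      have "cmod (T q) \<le> (\<Sum>j<n. cmod (M i j q) * V)"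
        unfolding T_def using V that by (intro sum_norm_le) (auto simp: norm_mult intro!: mult_left_mono)
      also have "\<dots> \<le> W * V"
        unfolding sum_distrib_right[symmetric] using order_trans[OF M[OF i that] W[OF that]] V0
        by (intro mult_right_mono) auto
      finally show ?thesis .
    qed
    have "Y i p = (\<Sum>q<m. of_real (\<tau> q) * T q) + (\<Sum>q<m. of_real (sigma (int p - int q) - \<tau> q) * T q) + b i p"
      unfolding Y[OF i p] T_def[symmetric] sum.distrib[symmetric] by (simp add: algebra_simps)
    also have "cmod \<dots> \<le> (\<Sum>q<p. \<Sum>j<n. cmod (M i j q) * cmod (Y j q)) + \<epsilon> * V + \<beta>"
    proof (intro norm_triangle_mono b i p)
      have "(\<Sum>q<m. of_real (\<tau> q) * T q) = (\<Sum>q<p. T q)"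
        using p by (intro sum.mono_neutral_cong_right) (auto simp: \<tau>_def)
      then show "cmod (\<Sum>q<m. of_real (\<tau> q) * T q) \<le> (\<Sum>q<p. \<Sum>j<n. cmod (M i j q) * cmod (Y j q))"
        unfolding T_def by (auto intro!: sum_norm_le simp flip: norm_mult)
      have "cmod (\<Sum>q<m. of_real (sigma (int p - int q) - \<tau> q) * T q)
          \<le> (\<Sum>q<m. 1 / (1 + real_of_int \<bar>int p - int q\<bar>) * (W * V))"
      proof (rule sum_norm_le)
        fix q assume q: "q \<in> {..<m}"
        have "\<tau> q = (if int p - int q > 0 then 1 else 0)" by (simp add: \<tau>_def)
        then show "cmod (of_real (sigma (int p - int q) - \<tau> q) * T q) \<le> 1 / (1 + real_of_int \<bar>int p - int q\<bar>) * (W * V)"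
          using sigma_approx[of "int p - int q"] T[of q] q unfolding norm_mult norm_of_real
          by (intro mult_mono) auto
      qed
      also have "\<dots> \<le> 2 * harm m * (W * V)"
        unfolding sum_distrib_right[symmetric] using W0 V0 sum_inverse_distance_le[OF p]
        by (intro mult_right_mono) auto
      finally show "cmod (\<Sum>q<m. of_real (sigma (int p - int q) - \<tau> q) * T q) \<le> \<epsilon> * V"
        by (simp add: \<epsilon>_def mult_ac)
    qed
    finally show ?thesis by simp
  qed
  have "V \<le> (\<beta> + \<epsilon> * V) * exp (\<Sum>q<m. w q)"
    unfolding V_eq[THEN trans, OF refl] using discrete_Gronwall[OF row M _ i0 p0] \<beta>0 \<epsilon>0 V0 V_eq by simp
  also have "\<dots> \<le> (\<beta> + \<epsilon> * V) * exp S"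
    using S \<beta>0 \<epsilon>0 V0 by (intro mult_left_mono) auto
  also have "\<dots> = \<beta> * exp S + (exp S * \<epsilon>) * V"
    by (simp add: algebra_simps)
  also have "\<dots> \<le> \<beta> * exp S + 1 / 2 * V"
    using small V0 by (intro add_left_mono mult_right_mono) (auto simp: \<epsilon>_def)
  finally have "V \<le> \<beta> * exp S + 1 / 2 * V" .
  then have "V \<le> 2 * exp S * \<beta>" by (simp add: field_simps)
  then show ?thesis using V[OF i p] by linarith
qed

section \<open>Sums over the grid and the Lebesgue constant\<close>

lemma sum_idx: "(\<Sum>p<2 * N + 1. f (idx N p)) = (\<Sum>j\<in>{- int N..int N}. f j)"
  by (rule sum.reindex_bij_witness[of _ "\<lambda>j. nat (j + int N)" "idx N"]) (auto simp: idx_def)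

text \<open>Two geometric series; (1 + y) exp (- y) \<le> 1 bounds each by 1 + 1 / y. With y =
  \<alpha> h the sum multiplied by h remains bounded as h tends to 0.\<close>

lemma sum_exp_distance_le:
  assumes "y > 0"
  shows "(\<Sum>j\<in>{- int N..int N}. exp (- y * real_of_int \<bar>j\<bar>)) \<le> 2 * (1 + 1 / y)"
proof -
  define x where "x = exp (- y)"
  have x: "0 < x" "x < 1" using assms by (auto simp: x_def)
  have geo: "(\<Sum>k\<le>N. x ^ k) \<le> 1 + 1 / y"
  proof -
    have "(\<Sum>k\<le>N. x ^ k) \<le> (\<Sum>k. x ^ k)"
      using x by (intro sum_le_suminf summable_geometric) auto
    also have "\<dots> = 1 / (1 - x)"
      using x by (intro suminf_geometric) auto
    also have "\<dots> \<le> 1 + 1 / y"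
    proof -
      have "(1 + y) * x \<le> exp y * x"
        using x by (intro mult_right_mono exp_ge_add_one_self) auto
      then have "(1 + y) * x \<le> 1" by (simp add: x_def flip: exp_add)
      then show ?thesis using x assms by (simp add: field_simps)
    qed
    finally show ?thesis .
  qed
  have x_pow: "exp (- y * real k) = x ^ k" for k
    by (simp add: x_def mult.commute flip: exp_of_nat_mult)
  have "(\<Sum>j\<in>{- int N..int N}. exp (- y * real_of_int \<bar>j\<bar>)) =
      (\<Sum>j\<in>{- int N..-1}. exp (- y * real_of_int \<bar>j\<bar>)) + (\<Sum>j\<in>{0..int N}. exp (- y * real_of_int \<bar>j\<bar>))"
    by (subst sum.union_disjoint[symmetric]) (auto intro!: sum.cong)
  also have "(\<Sum>j\<in>{0..int N}. exp (- y * real_of_int \<bar>j\<bar>)) = (\<Sum>k\<le>N. x ^ k)"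
    by (rule sum.reindex_bij_witness[of _ int nat]) (auto simp flip: x_pow)
  also have "(\<Sum>j\<in>{- int N..-1}. exp (- y * real_of_int \<bar>j\<bar>)) = (\<Sum>k\<in>{1..N}. x ^ k)"
    by (rule sum.reindex_bij_witness[of _ "\<lambda>k. - int k" "\<lambda>j. nat (- j)"]) (auto simp flip: x_pow)
  also have "\<dots> \<le> (\<Sum>k\<le>N. x ^ k)"
    using x by (intro sum_mono2) auto
  finally have "(\<Sum>j\<in>{- int N..int N}. exp (- y * real_of_int \<bar>j\<bar>)) \<le> (\<Sum>k\<le>N. x ^ k) + (\<Sum>k\<le>N. x ^ k)"
    by simp
  with geo show ?thesis by (simp add: distrib_left)
qed

text \<open>The terms are compared with 1 / (1 + distance), which gives a logarithm; ln x \<le> 2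
  sqrt x - 2 then replaces it by a square root. The cruder bound costs nothing in the final rate,
  since the interpolation error already contains 1 / h, of order sqrt N.\<close>

lemma sum_abs_S_sinc_le:
  assumes h: "h > 0" and N: "N \<ge> 1"
  shows "(\<Sum>j\<in>{- int N..int N}. \<bar>S_sinc j h x\<bar>) \<le> 20 * sqrt (real N)"
proof -
  \<comment> \<open>x may lie beyond the grid; clamping the index to the range does not increase its
    distance from any index of the range.\<close>
  define m where "m = max (- int N) (min (int N) \<lfloor>x / h\<rfloor>)"
  have m: "m \<in> {- int N..int N}" by (auto simp: m_def)
  have dist: "real_of_int \<bar>m - j\<bar> \<le> \<bar>x / h - j\<bar> + 1" if "j \<in> {- int N..int N}" for j
  proof -
    have "\<bar>m - j\<bar> \<le> \<bar>\<lfloor>x / h\<rfloor> - j\<bar>" using that by (auto simp: m_def)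
    then have "real_of_int \<bar>m - j\<bar> \<le> \<bar>real_of_int \<lfloor>x / h\<rfloor> - j\<bar>" by linarith
    also have "\<dots> \<le> \<bar>x / h - j\<bar> + 1" by linarith
    finally show ?thesis .
  qed
  have S: "\<bar>S_sinc j h x\<bar> \<le> 2 * (1 / (1 + real_of_int \<bar>m - j\<bar>))" if j: "j \<in> {- int N..int N}" for j
  proof (cases "\<bar>m - j\<bar> \<le> 1")
    case True
    then have "1 \<le> 2 * (1 / (1 + real_of_int \<bar>m - j\<bar>))" by simp
    then show ?thesis using abs_S_sinc_le_1[of j h x] by linarith
  next
    case False
    define v where "v = \<bar>x / h - j\<bar>"
    define k where "k = real_of_int \<bar>m - j\<bar>"
    have k: "k \<ge> 2" "v \<ge> k - 1" using False dist[OF j] by (auto simp: k_def v_def)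
    then have v: "v > 0" by linarith
    have "\<bar>S_sinc j h x\<bar> \<le> 1 / (pi * v)"
      using v by (auto simp: S_sinc_def v_def abs_mult intro!: divide_right_mono)
    also have "\<dots> \<le> 1 / (2 * (k - 1))"
      using k v pi_ge_two by (intro divide_left_mono mult_mono mult_pos_pos) auto
    also have "\<dots> \<le> 2 * (1 / (1 + k))"
      using k by (simp add: field_simps)
    finally show ?thesis by (simp add: k_def)
  qed
  define p where "p = nat (m + int N)"
  have p: "p < 2 * N + 1" "m = idx N p" using m by (auto simp: p_def idx_def)
  have "(\<Sum>j\<in>{- int N..int N}. \<bar>S_sinc j h x\<bar>) \<le> (\<Sum>j\<in>{- int N..int N}. 2 * (1 / (1 + real_of_int \<bar>m - j\<bar>)))"
    by (intro sum_mono S)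
  also have "\<dots> = 2 * (\<Sum>q<2 * N + 1. 1 / (1 + real_of_int \<bar>int p - int q\<bar>))"
    unfolding sum_distrib_left p(2) by (subst sum_idx[symmetric]) (simp add: idx_def)
  also have "\<dots> \<le> 2 * (2 * harm (2 * N + 1))"
    by (intro mult_left_mono sum_inverse_distance_le p) auto
  also have "harm (2 * N + 1) \<le> 1 + ln (real (2 * N + 1))"
    by (rule harm_le_ln) simp
  also have "ln (real (2 * N + 1)) \<le> 2 * sqrt (real (2 * N + 1)) - 2"
    using ln_le_minus_one[of "sqrt (real (2 * N + 1))"] by (simp add: ln_sqrt)
  also have "sqrt (real (2 * N + 1)) \<le> 2 * sqrt (real N)"
    using N real_sqrt_le_mono[of "real (2 * N + 1)" "4 * real N"] by (simp add: real_sqrt_mult)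
  finally have "(\<Sum>j\<in>{- int N..int N}. \<bar>S_sinc j h x\<bar>) \<le> 16 * sqrt (real N) - 4" by simp
  moreover have "sqrt (real N) \<ge> 0" by simp
  ultimately show ?thesis by linarith
qed

section \<open>The linear system in components\<close>

lemma sum_blocks: "(\<Sum>P<n * m. f P) = (\<Sum>i<n. \<Sum>p<m. f (i * m + p))" for m n :: nat
proof -
  have "sum f {i * m..<i * m + m} = (\<Sum>p<m. f (i * m + p))" for i
    using sum.shift_bounds_nat_ivl[of f 0 "i * m" m] by (simp add: add.commute lessThan_atLeast0)
  then show ?thesis
    by (simp flip: sum.nat_group)
qed

lemma block_index:
  fixes i n p m :: nat
  assumes "i < n" "p < m"
  shows "i * m + p < n * m" "(i * m + p) div m = i" "(i * m + p) mod m = p"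
proof -
  have "i * m + p < (i + 1) * m" using assms by simp
  also have "\<dots> \<le> n * m" using assms by (intro mult_right_mono) auto
  finally show "i * m + p < n * m" .
qed (use assms in auto)

lemma all_blocks: "(\<forall>P<n * m. Q P) \<longleftrightarrow> (\<forall>i<n. \<forall>p<m. Q (i * m + p))" for n m :: nat
proof (intro iffI allI impI)
  fix P assume Q: "\<forall>i<n. \<forall>p<m. Q (i * m + p)" and P: "P < n * m"
  then have "P div m < n" "P mod m < m"
    by (auto simp: less_mult_imp_div_less intro!: mod_less_divisor gr0I)
  with Q have "Q (P div m * m + P mod m)" by blast
  then show "Q P" by simp
qed (use block_index in blast)

lemma kronecker_one: "1\<^sub>m n \<otimes>\<^sub>K 1\<^sub>m m = (1\<^sub>m (n * m) :: 'a::semiring_1 mat)"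
proof (rule eq_matI)
  fix P Q assume "P < dim_row (1\<^sub>m (n * m) :: 'a mat)" "Q < dim_col (1\<^sub>m (n * m) :: 'a mat)"
  then have PQ: "P < n * m" "Q < n * m" by auto
  then have "P div m < n" "Q div m < n" "P mod m < m" "Q mod m < m"
    by (auto simp: less_mult_imp_div_less intro!: mod_less_divisor gr0I)
  moreover have "P = Q \<longleftrightarrow> P div m = Q div m \<and> P mod m = Q mod m"
    by (metis div_mult_mod_eq)
  ultimately show "(1\<^sub>m n \<otimes>\<^sub>K 1\<^sub>m m) $$ (P, Q) = (1\<^sub>m (n * m) :: 'a mat) $$ (P, Q)"
    using PQ by (simp add: kronecker_def)
qed (auto simp: kronecker_def)

section \<open>Entries of the system matrix and of the right-hand side\<close>

definition sinc_mat where
  "sinc_mat a b h n N k = 1\<^sub>m n \<otimes>\<^sub>K 1\<^sub>m (2 * N + 1)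
    - int_mat_SE a b h n N * block_mat n (2 * N + 1) (\<lambda>i j. K_SE a b h N (k i j))"

definition sinc_rhs where
  "sinc_rhs a b h n N g r = int_mat_SE a b h n N *\<^sub>v G_SE a b h n N g + R_vec n N r"

lemma block_mat_carrier [simp]: "block_mat n m B \<in> carrier_mat (n * m) (n * m)"
  by (simp add: block_mat_def)

context
  fixes N m :: nat
  assumes m: "m = 2 * N + 1"
begin

lemma int_mat_SE_carrier: "int_mat_SE a b h n N \<in> carrier_mat (n * m) (n * m)"
  unfolding int_mat_SE_def kronecker_def I_int_def D_SE_def m[symmetric]
  by (simp add: mat_diag_def)

lemma int_mat_SE_index:
  assumes "i < n" "p < m" "j < n" "q < m"
  shows "int_mat_SE a b h n N $$ (i * m + p, j * m + q) =
    (if i = j then of_real (h * sigma (idx N p - idx N q) * deriv (psi_SE a b :: real \<Rightarrow> real) (of_int (idx N q) * h)) else 0)"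
proof -
  have D: "I_int N * D_SE a b h N = Matrix.mat m m
      (\<lambda>(p, q). I_int N $$ (p, q) * of_real (deriv (psi_SE a b :: real \<Rightarrow> real) (of_int (idx N q) * h)))"
    unfolding D_SE_def m[symmetric] by (rule mat_diag_mult_right) (simp add: I_int_def m)
  show ?thesis
    using block_index[OF assms(1,2)] block_index[OF assms(3,4)] assms
    unfolding int_mat_SE_def D unfolding kronecker_def I_int_def m[symmetric] by simp
qed

lemma block_mat_K_SE_index:
  assumes "i < n" "p < m" "j < n" "q < m"
  shows "block_mat n m (\<lambda>i j. K_SE a b h N (k i j)) $$ (i * m + p, j * m + q) =
    (if p = q then k i j (of_real (t_SE a b h (idx N q))) else 0)"
  using block_index[OF assms(1,2)] block_index[OF assms(3,4)] assms
  unfolding block_mat_def K_SE_def mat_diag_def m[symmetric] by simp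

lemma int_mat_SE_mult_vec_index:
  assumes v: "v \<in> carrier_vec (n * m)" and "i < n" "p < m"
  shows "vec_index (int_mat_SE a b h n N *\<^sub>v v) (i * m + p) =
    (\<Sum>q<m. of_real (sigma (idx N p - idx N q)) *
      (of_real (h * deriv (psi_SE a b :: real \<Rightarrow> real) (of_int (idx N q) * h)) * vec_index v (i * m + q)))"
proof -
  have "vec_index (int_mat_SE a b h n N *\<^sub>v v) (i * m + p) =
      (\<Sum>Q<n * m. int_mat_SE a b h n N $$ (i * m + p, Q) * vec_index v Q)"
    using block_index(1)[OF assms(2,3)] v int_mat_SE_carrier[of a b h n]
    by (auto simp: scalar_prod_def lessThan_atLeast0 intro!: sum.cong)
  also have "\<dots> = (\<Sum>j<n. if j = i then (\<Sum>q<m. of_real (sigma (idx N p - idx N q)) *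
      (of_real (h * deriv (psi_SE a b :: real \<Rightarrow> real) (of_int (idx N q) * h)) * vec_index v (i * m + q))) else 0)"
    unfolding sum_blocks
    by (intro sum.cong refl) (use assms in \<open>auto simp: int_mat_SE_index mult_ac intro!: sum.cong\<close>)
  finally show ?thesis using assms by simp
qed

lemma sinc_mat_carrier: "sinc_mat a b h n N k \<in> carrier_mat (n * m) (n * m)"
  unfolding sinc_mat_def m[symmetric]
  by (intro minus_carrier_mat mult_carrier_mat[OF int_mat_SE_carrier block_mat_carrier])

lemma sinc_mat_mult_vec_index:
  assumes v: "v \<in> carrier_vec (n * m)" and i: "i < n" and p: "p < m"
  shows "vec_index (sinc_mat a b h n N k *\<^sub>v v) (i * m + p) =
    vec_index v (i * m + p) - (\<Sum>q<m. of_real (sigma (idx N p - idx N q)) *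
      (\<Sum>j<n. of_real (h * deriv (psi_SE a b :: real \<Rightarrow> real) (of_int (idx N q) * h))
        * k i j (of_real (t_SE a b h (idx N q))) * vec_index v (j * m + q)))"
proof -
  let ?B = "block_mat n m (\<lambda>i j. K_SE a b h N (k i j))"
  have Bv: "?B *\<^sub>v v \<in> carrier_vec (n * m)"
    using v by (intro mult_mat_vec_carrier[OF block_mat_carrier])
  have "sinc_mat a b h n N k *\<^sub>v v = 1\<^sub>m (n * m) *\<^sub>v v - int_mat_SE a b h n N * ?B *\<^sub>v v"
    unfolding sinc_mat_def m[symmetric] kronecker_one
    by (rule minus_mult_distrib_mat_vec[OF _ mult_carrier_mat[OF int_mat_SE_carrier block_mat_carrier] v]) simp
  also have "\<dots> = v - int_mat_SE a b h n N *\<^sub>v (?B *\<^sub>v v)"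
    using v by (simp add: assoc_mult_mat_vec[OF int_mat_SE_carrier block_mat_carrier v])
  finally have eq: "sinc_mat a b h n N k *\<^sub>v v = v - int_mat_SE a b h n N *\<^sub>v (?B *\<^sub>v v)" .
  have Bi: "vec_index (?B *\<^sub>v v) (i * m + q) =
      (\<Sum>j<n. k i j (of_real (t_SE a b h (idx N q))) * vec_index v (j * m + q))"
    if q: "q < m" for q
  proof -
    have "vec_index (?B *\<^sub>v v) (i * m + q) =
        (\<Sum>Q<n * m. ?B $$ (i * m + q, Q) * vec_index v Q)"
      using block_index(1)[OF i q] v
      by (auto simp: carrier_matD[OF block_mat_carrier] scalar_prod_def lessThan_atLeast0 intro!: sum.cong)
    also have "\<dots> = (\<Sum>j<n. \<Sum>q'<m. if q' = q then k i j (of_real (t_SE a b h (idx N q))) * vec_index v (j * m + q) else 0)"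
      unfolding sum_blocks
      by (intro sum.cong refl) (use i q in \<open>auto simp: block_mat_K_SE_index\<close>)
    finally show ?thesis using q by simp
  qed
  show ?thesis
    unfolding eq using block_index(1)[OF i p] v int_mat_SE_carrier[of a b h n]
    by (simp add: int_mat_SE_mult_vec_index[OF Bv i p] Bi sum_distrib_left mult.assoc
      del: of_real_mult)
qed

lemma sinc_rhs_carrier: "sinc_rhs a b h n N g r \<in> carrier_vec (n * m)"
  unfolding sinc_rhs_def R_vec_def G_SE_def m[symmetric]
  by (intro add_carrier_vec mult_mat_vec_carrier[OF int_mat_SE_carrier]) simp_all

lemma sinc_rhs_index:
  assumes i: "i < n" and p: "p < m"
  shows "vec_index (sinc_rhs a b h n N g r) (i * m + p) =
    (\<Sum>q<m. of_real (sigma (idx N p - idx N q)) *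
      (of_real (h * deriv (psi_SE a b :: real \<Rightarrow> real) (of_int (idx N q) * h))
        * g i (of_real (t_SE a b h (idx N q))))) + r i"
proof -
  have G: "G_SE a b h n N g \<in> carrier_vec (n * m)" by (simp add: G_SE_def m)
  have Gi: "vec_index (G_SE a b h n N g) (i * m + q) = g i (of_real (t_SE a b h (idx N q)))"
    if "q < m" for q
    using block_index[OF i that] by (simp add: G_SE_def m)
  show ?thesis
    unfolding sinc_rhs_def R_vec_def m[symmetric] using block_index[OF i p] int_mat_SE_carrier[of a b h n]
    by (simp add: int_mat_SE_mult_vec_index[OF G i p] Gi del: of_real_mult)
qed

end

lemma sinc_system_iff:
  "sinc_system a b h n N k g r Y \<longleftrightarrow> Y \<in> carrier_vec (n * (2 * N + 1)) \<and>
    sinc_mat a b h n N k *\<^sub>v Y = sinc_rhs a b h n N g r"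
  by (simp add: sinc_system_def sinc_mat_def sinc_rhs_def)

text \<open>Stability yields only that the kernel is trivial; for a square matrix this means a
  nonzero determinant, hence an inverse and existence as well.\<close>

lemma unique_solution_of_trivial_kernel:
  fixes A :: "'a::field mat"
  assumes A: "A \<in> carrier_mat m m" and b: "b \<in> carrier_vec m"
    and ker: "\<And>v. v \<in> carrier_vec m \<Longrightarrow> A *\<^sub>v v = 0\<^sub>v m \<Longrightarrow> v = 0\<^sub>v m"
  shows "\<exists>!Y. Y \<in> carrier_vec m \<and> A *\<^sub>v Y = b"
proof -
  have "det A \<noteq> 0"
    using det_0_iff_vec_prod_zero_field[OF A] ker by auto
  then have "A \<in> Units (ring_mat TYPE('a) m ())"
    by (rule det_non_zero_imp_unit[OF A])
  then obtain B where B: "B \<in> carrier_mat m m" "B * A = 1\<^sub>m m" "A * B = 1\<^sub>m m"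
    by (auto simp: Units_def ring_mat_simps)
  show ?thesis
  proof (rule ex1I)
    have "A *\<^sub>v (B *\<^sub>v b) = b"
      using assoc_mult_mat_vec[OF A B(1) b] B b by simp
    then show "B *\<^sub>v b \<in> carrier_vec m \<and> A *\<^sub>v (B *\<^sub>v b) = b"
      using B b by simp
  next
    fix Y assume "Y \<in> carrier_vec m \<and> A *\<^sub>v Y = b"
    then show "Y = B *\<^sub>v b"
      using assoc_mult_mat_vec[OF B(1) A, of Y] B by auto
  qed
qed

section \<open>The tanh transformation\<close>

text \<open>With x = Re z and y = Im z, the square of |cosh (z / 2)| is (cosh x + cos y) / 2, and
  cos y is at least cos d. Splitting the result into cos^2 (d / 2) cosh^2 (x / 2) + sin^2 (d / 2)
  sinh^2 (x / 2), the first term alone suffices; d < pi makes its coefficient positive.\<close>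

lemma norm_cosh_half_ge:
  assumes d: "0 < d" "d < pi" and z: "z \<in> strip d"
  shows "cmod (cosh (z / 2)) \<ge> cos (d / 2) * exp (\<bar>Re z\<bar> / 2) / 2"
proof (rule power2_le_imp_le)
  define w where "w = exp \<bar>Re z\<bar>"
  have w: "w \<ge> 1" by (simp add: w_def)
  have cs: "cos d = (cos (d / 2))\<^sup>2 - (sin (d / 2))\<^sup>2" "(cos (d / 2))\<^sup>2 + (sin (d / 2))\<^sup>2 = 1"
    using cos_double[of "d / 2"] by simp_all
  have "cos d \<le> cos (Im z)"
    using d z cos_monotone_0_pi_le[of "\<bar>Im z\<bar>" d] by (simp add: strip_def)
  have "(cos (d / 2))\<^sup>2 * w \<le> (cos (d / 2))\<^sup>2 * (w + 2 + 1 / w) + (sin (d / 2))\<^sup>2 * (w + 1 / w - 2)"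
  proof -
    have "(w - 1)\<^sup>2 / w \<ge> 0" using w by simp
    also have "(w - 1)\<^sup>2 / w = w + 1 / w - 2" using w by (simp add: power2_eq_square field_simps)
    finally have "(sin (d / 2))\<^sup>2 * (w + 1 / w - 2) \<ge> 0" by simp
    moreover have "(cos (d / 2))\<^sup>2 * w \<le> (cos (d / 2))\<^sup>2 * (w + 2 + 1 / w)"
      using w by (intro mult_left_mono) auto
    ultimately show ?thesis by linarith
  qed
  also have "\<dots> = ((cos (d / 2))\<^sup>2 + (sin (d / 2))\<^sup>2) * (w + 1 / w) + 2 * ((cos (d / 2))\<^sup>2 - (sin (d / 2))\<^sup>2)"
  proof -
    have "C * (W + 2 + V) + S * (W + V - 2) = (C + S) * (W + V) + 2 * (C - S)" for C S V W :: real
      by (simp add: algebra_simps)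
    then show ?thesis .
  qed
  also have "\<dots> = w + 1 / w + 2 * cos d"
    unfolding cs(2) cs(1)[symmetric] by simp
  also have "\<dots> \<le> w + 1 / w + 2 * cos (Im z)"
    using \<open>cos d \<le> cos (Im z)\<close> by simp
  also have "w + 1 / w = exp (Re z) + inverse (exp (Re z))"
    by (cases "Re z \<ge> 0") (auto simp: w_def exp_minus inverse_eq_divide)
  also have "\<dots> + 2 * cos (Im z) = 4 * (cmod (cosh (z / 2)))\<^sup>2"
  proof -
    have "cos (Im z) = 2 * (cos (Im z / 2))\<^sup>2 - 1"
      using cos_double_cos[of "Im z / 2"] by simp
    moreover have "exp (Re z) = (exp (Re z / 2))\<^sup>2"
      using exp_double[of "Re z / 2"] by simp
    ultimately show ?thesis
      by (simp add: cosh_conv_cos norm_cos_squared power2_diff power_inverse)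
  qed
  finally show "(cos (d / 2) * exp (\<bar>Re z\<bar> / 2) / 2)\<^sup>2 \<le> (cmod (cosh (z / 2)))\<^sup>2"
    by (simp add: w_def power_mult_distrib power_divide flip: exp_double)
qed simp

lemma cos_half_pos: "0 < d \<Longrightarrow> d < pi \<Longrightarrow> cos (d / 2) > 0"
  by (rule cos_gt_zero_pi) auto

lemma cosh_half_nonzero:
  assumes "0 < d" "d < pi" "z \<in> strip d"
  shows "cosh (z / 2) \<noteq> 0"
  using norm_cosh_half_ge[OF assms] cos_half_pos[OF assms(1,2)]
  by (metis divide_pos_pos exp_gt_zero mult_pos_pos norm_zero not_less zero_less_numeral)

lemma psi_SE_of_real: "psi_SE a b (of_real x :: complex) = of_real (psi_SE a b x)"
proof -
  have "tanh (complex_of_real x / 2) = of_real (tanh (x / 2))"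
    by (simp add: tanh_def sinh_def cosh_def scaleR_conv_of_real flip: exp_of_real)
  then show ?thesis by (simp add: psi_SE_def)
qed

lemma psi_SE_minus:
  fixes z :: "'a::{real_normed_field, banach}"
  shows "psi_SE a b z - of_real a = of_real ((b - a) / 2) * (1 + tanh (z / 2))"
    and "of_real b - psi_SE a b z = of_real ((b - a) / 2) * (1 - tanh (z / 2))"
  by (simp_all add: psi_SE_def field_simps)

lemma psi_SE_bounds:
  assumes "a < b"
  shows "a < psi_SE a b x" "psi_SE a b x < (b::real)"
proof -
  have "0 < (b - a) / 2 * (1 + tanh (x / 2))" "0 < (b - a) / 2 * (1 - tanh (x / 2))"
    using assms tanh_real_gt_neg1[of "x / 2"] tanh_real_lt_1[of "x / 2"] by auto
  then show "a < psi_SE a b x" "psi_SE a b x < b"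
    using psi_SE_minus(1)[of a b x] psi_SE_minus(2)[of b a x] by auto
qed

lemma one_pm_tanh:
  fixes z :: complex
  assumes "cosh z \<noteq> 0"
  shows "1 + tanh z = exp z / cosh z" "1 - tanh z = exp (- z) / cosh z"
  using assms sinh_plus_cosh[of z] cosh_minus_sinh[of z] by (simp_all add: tanh_def field_simps)

lemma Q_fun_psi_SE:
  assumes "cosh (z / 2) \<noteq> 0"
  shows "Q_fun a b (psi_SE a b z) = of_real (((b - a) / 2)\<^sup>2) / (cosh (z / 2))\<^sup>2"
proof -
  have "Q_fun a b (psi_SE a b z) = of_real (((b - a) / 2)\<^sup>2) * ((1 + tanh (z / 2)) * (1 - tanh (z / 2)))"
    unfolding Q_fun_def psi_SE_minus by (simp add: power2_eq_square)
  also have "(1 + tanh (z / 2)) * (1 - tanh (z / 2)) = 1 / (cosh (z / 2))\<^sup>2"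
    unfolding one_pm_tanh[OF assms] by (simp add: power2_eq_square flip: exp_add)
  finally show ?thesis by simp
qed

lemma psi_SE_has_derivative:
  "(psi_SE a b has_real_derivative (b - a) / 4 * (1 - (tanh (x / 2))\<^sup>2)) (at x)"
  unfolding psi_SE_def[abs_def]
  by (auto intro!: derivative_eq_intros simp: cosh_real_nonzero)

text \<open>Both sides are (b - a) / 4 times 1 - tanh^2 (x / 2). Substitution thus multiplies k and
  g by Q / (b - a), exactly the combination that the growth hypotheses control.\<close>

lemma deriv_psi_SE:
  assumes "a < b"
  shows "of_real (deriv (psi_SE a b) x) = Q_fun a b (of_real (psi_SE a b x)) / of_real (b - a)"
proof -
  have 1: "psi_SE a b x - a = (b - a) / 2 * (1 + tanh (x / 2))"
    and 2: "b - psi_SE a b x = (b - a) / 2 * (1 - tanh (x / 2))"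
    using psi_SE_minus(1)[of a b x] psi_SE_minus(2)[of b a x] by simp_all
  have "(psi_SE a b x - a) * (b - psi_SE a b x) = (b - a) * ((b - a) / 4 * (1 - (tanh (x / 2))\<^sup>2))"
    unfolding 1 2 by (simp add: power2_eq_square algebra_simps)
  also have "\<dots> = (b - a) * deriv (psi_SE a b) x"
    using DERIV_imp_deriv[OF psi_SE_has_derivative, of a b x] by simp
  finally have "(psi_SE a b x - a) * (b - psi_SE a b x) / (b - a) = deriv (psi_SE a b) x"
    using assms by simp
  then have "complex_of_real ((psi_SE a b x - a) * (b - psi_SE a b x) / (b - a)) = of_real (deriv (psi_SE a b) x)"
    by (rule arg_cong)
  then show ?thesis by (simp add: Q_fun_def)
qed

lemma psi_SE_phi_SE:
  assumes "a < t" "t < b"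
  shows "psi_SE a b (phi_SE a b t) = t"
proof -
  define q where "q = (t - a) / (b - t)"
  have q: "q > 0" using assms by (simp add: q_def)
  have "tanh (ln q / 2) = (q - 1) / (q + 1)"
  proof -
    have "tanh (ln (sqrt q)) = ((sqrt q)\<^sup>2 - 1) / ((sqrt q)\<^sup>2 + 1)"
      using q by (intro tanh_ln_real) simp
    then show ?thesis using q by (simp add: ln_sqrt)
  qed
  also have "\<dots> = (2 * t - a - b) / (b - a)"
  proof -
    have "q - 1 = (2 * t - a - b) / (b - t)" "q + 1 = (b - a) / (b - t)"
      using assms by (simp_all add: q_def field_simps)
    then show ?thesis using assms by simp
  qed
  finally have T: "tanh (ln q / 2) = (2 * t - a - b) / (b - a)" .
  have "u / 2 * (X / u) = X / 2" if "u \<noteq> 0" for u X :: real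
    using that by simp
  then have "(b - a) / 2 * tanh (ln q / 2) = (2 * t - a - b) / 2"
    unfolding T using assms by (metis diff_gt_0_iff_gt less_numeral_extra(3) less_trans)
  then show ?thesis
    by (simp add: psi_SE_def phi_SE_def q_def[symmetric] field_simps)
qed

lemma psi_SE_tendsto:
  "((psi_SE a b :: real \<Rightarrow> real) \<longlongrightarrow> a) at_bot" "((psi_SE a b :: real \<Rightarrow> real) \<longlongrightarrow> b) at_top"
proof -
  have "((\<lambda>x::real. tanh (x / 2)) \<longlongrightarrow> -1) at_bot"
    by (rule filterlim_compose[OF tanh_real_at_bot]) real_asymp
  from tendsto_add[OF tendsto_mult[OF tendsto_const this] tendsto_const, of "(b - a) / 2" "(b + a) / 2"]
  show "((psi_SE a b :: real \<Rightarrow> real) \<longlongrightarrow> a) at_bot"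
    by (simp add: psi_SE_def[abs_def] field_simps)
  have "((\<lambda>x::real. tanh (x / 2)) \<longlongrightarrow> 1) at_top"
    by (rule filterlim_compose[OF tanh_real_at_top]) real_asymp
  from tendsto_add[OF tendsto_mult[OF tendsto_const this] tendsto_const, of "(b - a) / 2" "(b + a) / 2"]
  show "((psi_SE a b :: real \<Rightarrow> real) \<longlongrightarrow> b) at_top"
    by (simp add: psi_SE_def[abs_def] field_simps)
qed

text \<open>Q(\<psi>(z)) is a constant over cosh^2 (z / 2), hence of order exp (- \<bar>Re z\<bar>),
  and its power \<alpha> gives the decay rate. The constant uses \<bar>L\<bar> because
  \<open>L_space\<close> puts no sign on the bound.\<close>

lemma L_space_transplant:
  assumes ab: "a < b" and d: "0 < d" "d < pi" and \<alpha>: "0 < \<alpha>"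
    and f: "f \<in> L_space a b \<alpha> (psi_SE a b ` strip d)"
  obtains C where "strip_decay (\<lambda>z. f (psi_SE a b z) / of_real (b - a)) d \<alpha> C"
proof -
  define c where "c = cos (d / 2)"
  have c: "c > 0" using cos_half_pos[OF d] by (simp add: c_def)
  obtain L where L: "\<And>z. z \<in> psi_SE a b ` strip d \<Longrightarrow> cmod (f z) \<le> L * cmod (Q_fun a b z) powr \<alpha>"
    using f by (auto simp: L_space_def)
  define K where "K = ((b - a) / 2)\<^sup>2 * 4 / c\<^sup>2"
  have K: "K \<ge> 0" by (simp add: K_def)
  have "strip_decay (\<lambda>z. f (psi_SE a b z) / of_real (b - a)) d \<alpha> (\<bar>L\<bar> * K powr \<alpha> / (b - a))"
  proof
    have "f holomorphic_on psi_SE a b ` strip d"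
      using f by (simp add: L_space_def analytic_imp_holomorphic)
    moreover have "(psi_SE a b :: complex \<Rightarrow> complex) holomorphic_on strip d"
      unfolding psi_SE_def[abs_def] using cosh_half_nonzero[OF d]
      by (intro analytic_imp_holomorphic analytic_intros) auto
    ultimately have "(f \<circ> psi_SE a b) holomorphic_on strip d"
      by (intro holomorphic_on_compose)
    then show "(\<lambda>z. f (psi_SE a b z) / of_real (b - a)) holomorphic_on strip d"
      using ab by (intro holomorphic_intros) (auto simp: o_def)
  next
    fix z assume z: "z \<in> strip d"
    have cosh: "c * exp (\<bar>Re z\<bar> / 2) / 2 \<le> cmod (cosh (z / 2))"
      using norm_cosh_half_ge[OF d z] by (simp add: c_def)
    have "cmod (Q_fun a b (psi_SE a b z)) = ((b - a) / 2)\<^sup>2 / (cmod (cosh (z / 2)))\<^sup>2"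
      unfolding Q_fun_psi_SE[OF cosh_half_nonzero[OF d z]] norm_divide norm_power norm_of_real by simp
    also have "\<dots> \<le> ((b - a) / 2)\<^sup>2 / (c * exp (\<bar>Re z\<bar> / 2) / 2)\<^sup>2"
      using cosh c by (intro divide_left_mono power_mono mult_pos_pos zero_less_power)
        (use cosh_half_nonzero[OF d z] in auto)
    also have "\<dots> = K * exp (- \<bar>Re z\<bar>)"
      by (simp add: K_def power_divide power_mult_distrib exp_minus field_simps flip: exp_double)
    finally have Q: "cmod (Q_fun a b (psi_SE a b z)) \<le> K * exp (- \<bar>Re z\<bar>)" .
    have "cmod (f (psi_SE a b z)) \<le> L * cmod (Q_fun a b (psi_SE a b z)) powr \<alpha>"
      using L z by blast
    also have "\<dots> \<le> \<bar>L\<bar> * (K * exp (- \<bar>Re z\<bar>)) powr \<alpha>"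
      using Q \<alpha> by (intro mult_mono powr_mono2) auto
    also have "(K * exp (- \<bar>Re z\<bar>)) powr \<alpha> = K powr \<alpha> * exp (-\<alpha> * \<bar>Re z\<bar>)"
      using K by (simp add: powr_mult exp_powr_real)
    finally show "cmod (f (psi_SE a b z) / of_real (b - a)) \<le> \<bar>L\<bar> * K powr \<alpha> / (b - a) * exp (-\<alpha> * \<bar>Re z\<bar>)"
      using ab by (simp add: norm_divide divide_right_mono flip: of_real_diff)
  qed (use d \<alpha> ab in auto)
  then show thesis by (rule that)
qed

text \<open>The hypotheses speak of \<kappa> Q only; inside (a, b) the factor Q does not vanish and
  can be divided out. Continuity is what allows the integral equation to be differentiated.\<close>

lemma L_space_isCont:
  assumes ab: "a < b" and d: "0 < d" and f: "(\<lambda>z. \<kappa> z * Q_fun a b z) \<in> L_space a b \<alpha> (psi_SE a b ` strip d)"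
    and t: "a < t" "t < b"
  shows "isCont (\<lambda>s. \<kappa> (of_real s)) t"
proof -
  have "of_real t \<in> psi_SE a b ` strip d"
    using psi_SE_of_real[of a b "phi_SE a b t"] psi_SE_phi_SE[OF t] d
    by (intro image_eqI[of _ _ "of_real (phi_SE a b t)"]) auto
  then have "(\<lambda>z. \<kappa> z * Q_fun a b z) analytic_on {of_real t}"
    using f by (auto simp: L_space_def intro: analytic_on_subset)
  then have 1: "isCont (\<lambda>s. \<kappa> (of_real s) * Q_fun a b (of_real s)) t"
    using isCont_o2[OF isCont_of_real[OF continuous_ident] analytic_at_imp_isCont] by blast
  have Q: "Q_fun a b (of_real s) \<noteq> 0" if "a < s" "s < b" for s
    using that by (simp add: Q_fun_def)
  have "isCont (\<lambda>s. \<kappa> (of_real s) * Q_fun a b (of_real s) / Q_fun a b (of_real s)) t"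
    using 1 Q[OF t] by (intro continuous_divide) (auto simp: Q_fun_def intro!: continuous_intros)
  moreover have "\<forall>\<^sub>F s in nhds t. \<kappa> (of_real s) * Q_fun a b (of_real s) / Q_fun a b (of_real s) = \<kappa> (of_real s)"
    using eventually_nhds_in_open[of "{a<..<b}" t] t by (auto elim!: eventually_mono simp: Q)
  ultimately show ?thesis
    using isCont_cong by fast
qed

section \<open>Convergence on the real line\<close>

text \<open>The pull-back of \<open>w_b\<close> under \<psi>, continued to the strip; it no longer
  depends on a and b.\<close>

definition W_b :: "complex \<Rightarrow> complex" where
  "W_b z = (1 + tanh (z / 2)) / 2"

lemma W_b_holomorphic: "0 < d \<Longrightarrow> d < pi \<Longrightarrow> W_b holomorphic_on strip d"
  unfolding W_b_def[abs_def] using cosh_half_nonzero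
  by (intro analytic_imp_holomorphic analytic_intros) auto

text \<open>\<open>W_b\<close> is exp (z / 2) / (2 cosh (z / 2)) and \<open>1 - W_b\<close> is exp
  (- z / 2) / (2 cosh (z / 2)): each is bounded on the strip and decays at rate 1 towards one
  end.\<close>

lemma W_b_decay:
  assumes d: "0 < d" "d < pi" and z: "z \<in> strip d"
  shows "cmod (W_b z) \<le> exp ((Re z - \<bar>Re z\<bar>) / 2) / cos (d / 2)"
    and "cmod (1 - W_b z) \<le> exp ((- Re z - \<bar>Re z\<bar>) / 2) / cos (d / 2)"
proof -
  have c: "cos (d / 2) > 0" using cos_half_pos[OF d] .
  have nz: "cosh (z / 2) \<noteq> 0" using cosh_half_nonzero[OF d z] .
  have *: "exp x / cmod (cosh (z / 2)) / 2 \<le> exp (x - \<bar>Re z\<bar> / 2) / cos (d / 2)" for x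
  proof -
    have "exp x / cmod (cosh (z / 2)) \<le> exp x / (cos (d / 2) * exp (\<bar>Re z\<bar> / 2) / 2)"
      using norm_cosh_half_ge[OF d z] c nz by (intro divide_left_mono) auto
    also have "\<dots> = 2 * (exp (x - \<bar>Re z\<bar> / 2) / cos (d / 2))"
      by (simp add: exp_diff mult.commute)
    finally show ?thesis by simp
  qed
  have "cmod (W_b z) = exp (Re z / 2) / cmod (cosh (z / 2)) / 2"
    unfolding W_b_def one_pm_tanh[OF nz] by (simp add: norm_divide)
  then show "cmod (W_b z) \<le> exp ((Re z - \<bar>Re z\<bar>) / 2) / cos (d / 2)"
    using *[of "Re z / 2"] by (simp add: diff_divide_distrib)
  have "1 - W_b z = (1 - tanh (z / 2)) / 2" by (simp add: W_b_def field_simps)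
  then have "cmod (1 - W_b z) = exp (- Re z / 2) / cmod (cosh (z / 2)) / 2"
    unfolding one_pm_tanh[OF nz] by (simp add: norm_divide)
  then show "cmod (1 - W_b z) \<le> exp ((- Re z - \<bar>Re z\<bar>) / 2) / cos (d / 2)"
    using *[of "- Re z / 2"] by (simp add: diff_divide_distrib)
qed

lemma W_b_of_real:
  assumes "a < b"
  shows "W_b (of_real x) = of_real (w_b a b (psi_SE a b x))"
    and "1 - W_b (of_real x) = of_real (w_a a b (psi_SE a b x))"
proof -
  have "tanh (complex_of_real x / 2) = of_real (tanh (x / 2))"
    by (simp add: tanh_def sinh_def cosh_def scaleR_conv_of_real flip: exp_of_real)
  then have 1: "W_b (of_real x) = of_real ((1 + tanh (x / 2)) / 2)"
    by (simp add: W_b_def)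
  have 2: "w_b a b (psi_SE a b x) = (1 + tanh (x / 2)) / 2" "w_a a b (psi_SE a b x) = (1 - tanh (x / 2)) / 2"
    using psi_SE_minus(1)[of a b x] psi_SE_minus(2)[of b a x] assms by (simp_all add: w_a_def w_b_def)
  show "W_b (of_real x) = of_real (w_b a b (psi_SE a b x))"
    "1 - W_b (of_real x) = of_real (w_a a b (psi_SE a b x))"
    unfolding 1 2 by (simp_all add: field_simps)
qed

section \<open>Nodal and interpolation errors for a system on the strip\<close>

locale strip_system =
  fixes n :: nat and d \<alpha> C B :: real
    and A :: "nat \<Rightarrow> nat \<Rightarrow> complex \<Rightarrow> complex" and G u :: "nat \<Rightarrow> complex \<Rightarrow> complex"
    and r s :: "nat \<Rightarrow> complex"
  assumes d: "0 < d" "d < pi" and \<alpha>: "0 < \<alpha>" "\<alpha> \<le> 1" and C: "C \<ge> 0"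
    and A: "\<And>i j. i < n \<Longrightarrow> j < n \<Longrightarrow> A i j holomorphic_on strip d"
    and G: "\<And>i. i < n \<Longrightarrow> G i holomorphic_on strip d"
    and bound: "\<And>i z. i < n \<Longrightarrow> z \<in> strip d \<Longrightarrow>
      (\<Sum>j<n. cmod (A i j z)) + cmod (G i z) \<le> C * exp (-\<alpha> * \<bar>Re z\<bar>)"
    and u_deriv: "\<And>i z. i < n \<Longrightarrow> z \<in> strip d \<Longrightarrow>
      (u i has_field_derivative (\<Sum>j<n. A i j z * u j z) + G i z) (at z)"
    and u_bound: "\<And>i z. i < n \<Longrightarrow> z \<in> strip d \<Longrightarrow> cmod (u i z) \<le> B"
    and B: "B \<ge> 1"
    and lim_r: "\<And>i. i < n \<Longrightarrow> ((\<lambda>x. u i (of_real x)) \<longlongrightarrow> r i) at_bot"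
    and lim_s: "\<And>i. i < n \<Longrightarrow> ((\<lambda>x. u i (of_real x)) \<longlongrightarrow> s i) at_top"
begin

definition F where "F i z = (\<Sum>j<n. A i j z * u j z) + G i z"

lemma u_holomorphic: "i < n \<Longrightarrow> u i holomorphic_on strip d"
  using u_deriv open_strip by (auto simp: holomorphic_on_open)

lemma F_decay: "i < n \<Longrightarrow> strip_decay (F i) d \<alpha> (C * B)"
proof
  assume i: "i < n"
  show "F i holomorphic_on strip d"
    unfolding F_def[abs_def] using i by (intro holomorphic_intros A G u_holomorphic) auto
  fix z assume z: "z \<in> strip d"
  have "cmod (F i z) \<le> (\<Sum>j<n. cmod (A i j z) * B) + cmod (G i z) * 1"
    unfolding F_def using u_bound z
    by (intro norm_triangle_mono sum_norm_le) (auto simp: norm_mult intro!: mult_left_mono)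
  also have "\<dots> \<le> (\<Sum>j<n. cmod (A i j z)) * B + cmod (G i z) * B"
    unfolding sum_distrib_right using B by (intro add_left_mono mult_left_mono) auto
  also have "\<dots> = ((\<Sum>j<n. cmod (A i j z)) + cmod (G i z)) * B"
    by (simp add: distrib_right)
  also have "\<dots> \<le> C * exp (-\<alpha> * \<bar>Re z\<bar>) * B"
    using bound[OF i z] B by (intro mult_right_mono) auto
  finally show "cmod (F i z) \<le> C * B * exp (-\<alpha> * \<bar>Re z\<bar>)"
    by (simp add: mult_ac)
qed (use d \<alpha> C B in auto)

lemma u_left: "i < n \<Longrightarrow> z \<in> strip d \<Longrightarrow> Re z \<le> 0 \<Longrightarrow> cmod (u i z - r i) \<le> C * B / \<alpha> * exp (\<alpha> * Re z)"
proof -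
  assume i: "i < n" and z: "z \<in> strip d" "Re z \<le> 0"
  interpret Fi: strip_decay "F i" d \<alpha> "C * B" using F_decay[OF i] .
  show ?thesis
    using strip_tail_bound[OF u_deriv[OF i] Fi.decay[unfolded F_def] _ _ lim_r[OF i] z] Fi.\<alpha>_pos Fi.C_nonneg
    by simp
qed

lemma u_right: "i < n \<Longrightarrow> z \<in> strip d \<Longrightarrow> Re z \<ge> 0 \<Longrightarrow> cmod (u i z - s i) \<le> C * B / \<alpha> * exp (- \<alpha> * Re z)"
proof -
  assume i: "i < n" and z: "z \<in> strip d" "Re z \<ge> 0"
  interpret Fi: strip_decay "F i" d \<alpha> "C * B" using F_decay[OF i] .
  have "cmod ((\<lambda>z. u i (- z)) (- z) - s i) \<le> C * B / \<alpha> * exp (\<alpha> * Re (- z))"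
  proof (rule strip_tail_bound[where F = "\<lambda>z. - F i (- z)"])
    fix z assume "z \<in> strip d"
    then have z: "- z \<in> strip d" by (simp add: strip_def)
    have "((\<lambda>z. u i (- z)) has_field_derivative F i (- z) * (- 1)) (at z)"
      by (rule DERIV_chain2[where f = "u i" and g = uminus])
        (use u_deriv[OF i z] in \<open>auto simp: F_def intro!: derivative_eq_intros\<close>)
    then show "((\<lambda>z. u i (- z)) has_field_derivative - F i (- z)) (at z)"
      by simp
    show "cmod (- F i (- z)) \<le> C * B * exp (- \<alpha> * \<bar>Re z\<bar>)"
      using Fi.decay[OF z] by simp
  next
    show "((\<lambda>x. u i (- complex_of_real x)) \<longlongrightarrow> s i) at_bot"
      using filterlim_compose[OF lim_s[OF i] filterlim_uminus_at_top_at_bot] by simp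
  qed (use z Fi.\<alpha>_pos Fi.C_nonneg in \<open>auto simp: strip_def\<close>)
  then show ?thesis by simp
qed

text \<open>The cardinal series suits functions that vanish at both ends, so the linear interpolant
  in t between the boundary values r and s is subtracted first.\<close>

definition u_hom where "u_hom i z = u i z - r i * (1 - W_b z) - s i * W_b z"

definition C_f where "C_f = C * B / \<alpha> + (\<Sum>i<n. cmod (r i - s i)) / cos (d / 2)"

lemma C_f_nonneg: "C_f \<ge> 0"
  unfolding C_f_def using C B \<alpha> cos_half_pos[OF d] by (intro add_nonneg_nonneg divide_nonneg_pos sum_nonneg) auto

text \<open>On the left \<open>u_hom\<close> is (u - r) + (r - s) W_b, on the right (u - s) + (s -
  r) (1 - W_b). The first summands decay at rate \<alpha>, the second at rate 1, which is at least
  \<alpha>.\<close>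

lemma u_hom_decay: "i < n \<Longrightarrow> strip_decay (u_hom i) d \<alpha> C_f"
proof
  assume i: "i < n"
  show "u_hom i holomorphic_on strip d"
    unfolding u_hom_def[abs_def] by (intro holomorphic_intros u_holomorphic i W_b_holomorphic d)
  fix z assume z: "z \<in> strip d"
  have c: "cos (d / 2) > 0" using cos_half_pos[OF d] .
  have rs: "cmod (r i - s i) \<le> (\<Sum>i<n. cmod (r i - s i))"
    using i by (intro member_le_sum) auto
  have e: "exp (- \<bar>Re z\<bar>) \<le> exp (-\<alpha> * \<bar>Re z\<bar>)"
    using \<alpha> mult_right_mono[of \<alpha> 1 "\<bar>Re z\<bar>"] by simp
  have W: "cmod (r i - s i) * (exp (- \<bar>Re z\<bar>) / cos (d / 2))
      \<le> (\<Sum>i<n. cmod (r i - s i)) / cos (d / 2) * exp (-\<alpha> * \<bar>Re z\<bar>)"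
  proof -
    have "cmod (r i - s i) * (exp (- \<bar>Re z\<bar>) / cos (d / 2))
        \<le> (\<Sum>i<n. cmod (r i - s i)) * (exp (-\<alpha> * \<bar>Re z\<bar>) / cos (d / 2))"
      using rs e c by (intro mult_mono divide_right_mono) (auto intro: sum_nonneg)
    then show ?thesis by simp
  qed
  show "cmod (u_hom i z) \<le> C_f * exp (-\<alpha> * \<bar>Re z\<bar>)"
  proof (cases "Re z \<le> 0")
    case True
    have "u_hom i z = (u i z - r i) + (r i - s i) * W_b z"
      by (simp add: u_hom_def algebra_simps)
    also have "cmod \<dots> \<le> C * B / \<alpha> * exp (\<alpha> * Re z) + cmod (r i - s i) * (exp (- \<bar>Re z\<bar>) / cos (d / 2))"
    proof (intro norm_triangle_mono u_left i z True)
      have "cmod (W_b z) \<le> exp (- \<bar>Re z\<bar>) / cos (d / 2)"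
        using W_b_decay(1)[OF d z] True by simp
      then show "cmod ((r i - s i) * W_b z) \<le> cmod (r i - s i) * (exp (- \<bar>Re z\<bar>) / cos (d / 2))"
        unfolding norm_mult by (rule mult_left_mono) simp
    qed
    also have "\<dots> \<le> C_f * exp (-\<alpha> * \<bar>Re z\<bar>)"
      using W True by (simp add: C_f_def distrib_right)
    finally show ?thesis .
  next
    case False
    have "u_hom i z = (u i z - s i) + (s i - r i) * (1 - W_b z)"
      by (simp add: u_hom_def algebra_simps)
    also have "cmod \<dots> \<le> C * B / \<alpha> * exp (- \<alpha> * Re z) + cmod (r i - s i) * (exp (- \<bar>Re z\<bar>) / cos (d / 2))"
    proof (intro norm_triangle_mono u_right i z)
      have "cmod (1 - W_b z) \<le> exp (- \<bar>Re z\<bar>) / cos (d / 2)"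
        using W_b_decay(2)[OF d z] False by simp
      then show "cmod ((s i - r i) * (1 - W_b z)) \<le> cmod (r i - s i) * (exp (- \<bar>Re z\<bar>) / cos (d / 2))"
        unfolding norm_mult norm_minus_commute[of "s i"] by (rule mult_left_mono) simp
    qed (use False in simp)
    also have "\<dots> \<le> C_f * exp (-\<alpha> * \<bar>Re z\<bar>)"
      using W False by (simp add: C_f_def distrib_right)
    finally show ?thesis .
  qed
qed (use d \<alpha> C_f_nonneg in auto)

text \<open>Bounds the Gronwall exponent, that is h C times the sum of exp (-\<alpha>
  \<bar>jh\<bar>) over the grid, for every admissible h.\<close>

definition "S_bd = 2 * C * (d + 1 / \<alpha>)"

text \<open>The constant of \<open>quadrature_error\<close> for \<open>F i\<close>, with 2 h
  replaced by d so that it does not depend on N.\<close>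

definition "K_u = C * B * (9 * (200 * pi * exp pi / \<alpha> + 32 * d) + d + 1 / \<alpha>)"

lemma K_u_nonneg: "K_u \<ge> 0"
  unfolding K_u_def using C B d \<alpha> by (intro mult_nonneg_nonneg add_nonneg_nonneg) auto

context
  fixes h :: real and N :: nat
  assumes h: "h > 0" "2 * h \<le> d" and N: "N \<ge> 1" and grid: "real N * h\<^sup>2 = pi * d / \<alpha>"
    and small: "exp S_bd * (2 * (h * C) * harm (2 * N + 1)) \<le> 1 / 2"
begin

definition "node p = complex_of_real (of_int (idx N p) * h)"

definition "\<eta> = exp (- (pi * d / h))"

lemma grid_F: "i < n \<Longrightarrow> sinc_grid (F i) d \<alpha> (C * B) h N"
  using F_decay h N grid by (auto simp: sinc_grid_def sinc_grid_axioms_def)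

lemma grid_u_hom: "i < n \<Longrightarrow> sinc_grid (u_hom i) d \<alpha> C_f h N"
  using u_hom_decay h N grid by (auto simp: sinc_grid_def sinc_grid_axioms_def)

lemma system_stability:
  assumes Y: "\<And>i p. i < n \<Longrightarrow> p < 2 * N + 1 \<Longrightarrow>
      Y i p = (\<Sum>q<2 * N + 1. of_real (sigma (idx N p - idx N q)) * (\<Sum>j<n. of_real h * A i j (node q) * Y j q)) + e i p"
    and e: "\<And>i p. i < n \<Longrightarrow> p < 2 * N + 1 \<Longrightarrow> cmod (e i p) \<le> \<beta>"
    and ip: "i < n" "p < 2 * N + 1"
  shows "cmod (Y i p) \<le> 2 * exp S_bd * \<beta>"
proof (rule volterra_stability[where M = "\<lambda>i j q. of_real h * A i j (node q)" and W = "h * C"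
      and w = "\<lambda>q. h * (C * exp (-\<alpha> * \<bar>Re (node q)\<bar>))" and b = e])
  show "Y i p = (\<Sum>q<2 * N + 1. of_real (sigma (int p - int q)) * (\<Sum>j<n. of_real h * A i j (node q) * Y j q)) + e i p"
    if "i < n" "p < 2 * N + 1" for i p
    using Y[OF that] by (simp add: idx_def)
next
  fix i q assume i: "i < n"
  have "node q \<in> strip d" using d by (simp add: node_def del: of_real_mult)
  then have "(\<Sum>j<n. cmod (A i j (node q))) \<le> C * exp (-\<alpha> * \<bar>Re (node q)\<bar>)"
    using bound[OF i] norm_ge_zero[of "G i (node q)"] by (meson add_increasing2 order_trans le_add_same_cancel1)
  then have "h * (\<Sum>j<n. cmod (A i j (node q))) \<le> h * (C * exp (-\<alpha> * \<bar>Re (node q)\<bar>))"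
    using h by (intro mult_left_mono) auto
  then show "(\<Sum>j<n. cmod (of_real h * A i j (node q))) \<le> h * (C * exp (-\<alpha> * \<bar>Re (node q)\<bar>))"
    using h by (simp add: norm_mult sum_distrib_left)
next
  show "h * (C * exp (-\<alpha> * \<bar>Re (node q)\<bar>)) \<le> h * C" for q
    using h C \<alpha> by (intro mult_left_mono mult_left_le) auto
  have "(\<Sum>q<2 * N + 1. h * (C * exp (-\<alpha> * \<bar>Re (node q)\<bar>))) =
      h * C * (\<Sum>j\<in>{- int N..int N}. exp (- (\<alpha> * h) * real_of_int \<bar>j\<bar>))"
    unfolding sum_distrib_left sum_idx[symmetric] using h
    by (intro sum.cong refl) (simp add: node_def abs_mult mult_ac)
  also have "\<dots> \<le> h * C * (2 * (1 + 1 / (\<alpha> * h)))"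
    using h C \<alpha> by (intro mult_left_mono sum_exp_distance_le) auto
  also have "\<dots> = 2 * C * (h + 1 / \<alpha>)"
    using h \<alpha> by (simp add: field_simps)
  also have "\<dots> \<le> S_bd"
    unfolding S_bd_def using h C by (intro mult_left_mono) auto
  finally show "(\<Sum>q<2 * N + 1. h * (C * exp (-\<alpha> * \<bar>Re (node q)\<bar>))) \<le> S_bd" .
qed (use small e ip in auto)

text \<open>In the difference of exact and computed values the terms with \<open>G\<close> and
  \<open>r\<close> cancel; what remains is the homogeneous system with the error of indefinite
  integration of \<open>F i\<close> as inhomogeneity.\<close>

lemma nodal_error:
  assumes Y: "\<And>i p. i < n \<Longrightarrow> p < 2 * N + 1 \<Longrightarrow>
      Y i p = (\<Sum>q<2 * N + 1. of_real (sigma (idx N p - idx N q)) * (\<Sum>j<n. of_real h * A i j (node q) * Y j q))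
        + ((\<Sum>q<2 * N + 1. of_real (sigma (idx N p - idx N q)) * (of_real h * G i (node q))) + r i)"
    and ip: "i < n" "p < 2 * N + 1"
  shows "cmod (u i (node p) - Y i p) \<le> 2 * exp S_bd * (K_u * \<eta>)"
proof (rule system_stability[where Y = "\<lambda>i p. u i (node p) - Y i p" and
      e = "\<lambda>i p. u i (node p) - r i - of_real h * (\<Sum>q<2 * N + 1. of_real (sigma (idx N p - idx N q)) * F i (node q))"])
  fix i p assume i: "i < n" and p: "p < 2 * N + 1"
  show "u i (node p) - Y i p = (\<Sum>q<2 * N + 1. of_real (sigma (idx N p - idx N q)) *
        (\<Sum>j<n. of_real h * A i j (node q) * (u j (node q) - Y j q)))
      + (u i (node p) - r i - of_real h * (\<Sum>q<2 * N + 1. of_real (sigma (idx N p - idx N q)) * F i (node q)))"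
    unfolding Y[OF i p] F_def
    by (simp add: sum_distrib_left sum_subtractf sum.distrib algebra_simps del: sum.lessThan_Suc)
  interpret sinc_grid "F i" d \<alpha> "C * B" h N using grid_F[OF i] .
  have m: "idx N p \<in> {- int N..int N}" using p by (auto simp: idx_def)
  have "cmod (u i (node p) - r i - of_real h * (\<Sum>j\<in>{- int N..int N}. of_real (sigma (idx N p - j)) * F i (of_real (of_int j * h))))
      \<le> C * B * err * (9 * K_frame + 2 * h + 1 / \<alpha>)"
    unfolding node_def using quadrature_error[OF _ lim_r[OF i] m] u_deriv[OF i] by (simp add: F_def)
  also have "\<dots> = C * B * (9 * K_frame + 2 * h + 1 / \<alpha>) * err" by simp
  also have "\<dots> \<le> K_u * \<eta>"
    unfolding K_u_def \<eta>_def err_def[symmetric] K_frame_def using C_nonneg err_pos h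
    by (intro mult_right_mono mult_left_mono add_mono) auto
  finally show "cmod (u i (node p) - r i - of_real h * (\<Sum>q<2 * N + 1. of_real (sigma (idx N p - idx N q)) * F i (node q))) \<le> K_u * \<eta>"
    unfolding node_def by (subst (asm) sum_idx[symmetric])
qed (fact ip)+

text \<open>The interpolant uses Y(- N) and Y(N) in place of the limits r and s; L bounds either
  discrepancy. The error consists of these end terms (2 L), the interpolation error of
  \<open>u_hom\<close>, and the sinc sum of the data errors \<open>D j\<close>, each at most 3 L.
  With the Lebesgue constant 20 sqrt N this gives 62 = 2 + 3 * 20. The first two claims serve the
  end points, where only Y(- N) or Y(N) is left.\<close>

lemma interpolation_error:
  fixes Y :: "int \<Rightarrow> complex"
  assumes i: "i < n"
    and Y: "\<And>j. j \<in> {- int N..int N} \<Longrightarrow> cmod (u i (of_real (of_int j * h)) - Y j) \<le> K * \<eta>"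
  shows "cmod (r i - Y (- int N)) \<le> (C * B / \<alpha> + K) * \<eta>"
    and "cmod (s i - Y (int N)) \<le> (C * B / \<alpha> + K) * \<eta>"
    and "cmod (u i (of_real x) - (Y (- int N) * (1 - W_b (of_real x)) + Y (int N) * W_b (of_real x)
        + (\<Sum>j\<in>{- int N..int N}. (Y j - Y (- int N) * (1 - W_b (of_real (of_int j * h)))
            - Y (int N) * W_b (of_real (of_int j * h))) * of_real (S_sinc j h x))))
      \<le> (C_f * ((200 * pi * exp pi / \<alpha> + 32 * d) / h + 2)
        + 62 * (C * B / \<alpha> + K) * sqrt (real N)) * \<eta>"
proof -
  interpret sinc_grid "u_hom i" d \<alpha> C_f h N using grid_u_hom[OF i] .
  define L where "L = (C * B / \<alpha> + K) * \<eta>"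
  have \<eta>: "\<eta> = err" by (simp add: \<eta>_def err_def)
  have in_strip: "complex_of_real x \<in> strip d" for x using d by simp
  have ends: "cmod (u i (of_real (- (real N * h))) - r i) \<le> C * B / \<alpha> * \<eta>"
    "cmod (u i (of_real (real N * h)) - s i) \<le> C * B / \<alpha> * \<eta>"
    using u_left[OF i in_strip, of "- (real N * h)"] u_right[OF i in_strip, of "real N * h"] h
    by (simp_all add: \<eta> err_alt del: of_real_mult of_real_minus)
  have "r i - Y (- int N) = (r i - u i (of_real (- (real N * h)))) + (u i (of_real (- (real N * h))) - Y (- int N))"
    by simp
  also have "cmod \<dots> \<le> C * B / \<alpha> * \<eta> + K * \<eta>"
    using ends(1) Y[of "- int N"] by (intro norm_triangle_mono) (simp_all add: norm_minus_commute)
  finally have r: "cmod (r i - Y (- int N)) \<le> L" by (simp add: L_def distrib_right)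
  have "s i - Y (int N) = (s i - u i (of_real (real N * h))) + (u i (of_real (real N * h)) - Y (int N))"
    by simp
  also have "cmod \<dots> \<le> C * B / \<alpha> * \<eta> + K * \<eta>"
    using ends(2) Y[of "int N"] by (intro norm_triangle_mono) (simp_all add: norm_minus_commute)
  finally have s: "cmod (s i - Y (int N)) \<le> L" by (simp add: L_def distrib_right)
  show "cmod (r i - Y (- int N)) \<le> (C * B / \<alpha> + K) * \<eta>" "cmod (s i - Y (int N)) \<le> (C * B / \<alpha> + K) * \<eta>"
    using r s by (simp_all add: L_def)
  have L0: "L \<ge> 0" using order_trans[OF norm_ge_zero r] .
  have Wr: "W_b (of_real x) = of_real ((1 + tanh (x / 2)) / 2)" for x
    using W_b_of_real(1)[of 0 1 x] by (simp add: w_b_def psi_SE_def algebra_simps)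
  have W1: "cmod (W_b (of_real x)) \<le> 1" and W2: "cmod (1 - W_b (of_real x)) \<le> 1" for x
  proof -
    have "1 - W_b (of_real x) = of_real ((1 - tanh (x / 2)) / 2)"
      unfolding Wr by (simp add: field_simps)
    then have "cmod (1 - W_b (of_real x)) = \<bar>(1 - tanh (x / 2)) / 2\<bar>"
      by (simp only: norm_of_real)
    moreover have "cmod (W_b (of_real x)) = \<bar>(1 + tanh (x / 2)) / 2\<bar>"
      unfolding Wr by (rule norm_of_real)
    ultimately show "cmod (1 - W_b (of_real x)) \<le> 1" "cmod (W_b (of_real x)) \<le> 1"
      using tanh_real_bounds[of "x / 2"] by auto
  qed
  have W: "cmod ((r i - Y (- int N)) * (1 - W_b (of_real x)) + (s i - Y (int N)) * W_b (of_real x)) \<le> L + L" for x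
    using mult_mono[OF r W2[of x] L0 norm_ge_zero] mult_mono[OF s W1[of x] L0 norm_ge_zero]
    by (intro norm_triangle_mono) (simp_all add: norm_mult)
  define D where "D j = u_hom i (of_real (of_int j * h)) - (Y j - Y (- int N) * (1 - W_b (of_real (of_int j * h)))
            - Y (int N) * W_b (of_real (of_int j * h)))" for j
  have D: "cmod (D j) \<le> 3 * L" if j: "j \<in> {- int N..int N}" for j
  proof -
    have KL: "K * \<eta> \<le> L"
      unfolding L_def \<eta>_def using C B \<alpha> by (intro mult_right_mono) auto
    have "D j = (u i (of_real (of_int j * h)) - Y j) - ((r i - Y (- int N)) * (1 - W_b (of_real (of_int j * h)))
        + (s i - Y (int N)) * W_b (of_real (of_int j * h)))"
      by (simp add: D_def u_hom_def algebra_simps)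
    also have "cmod \<dots> \<le> K * \<eta> + (L + L)"
      by (rule order_trans[OF norm_triangle_ineq4 add_mono[OF Y[OF j] W]])
    finally show ?thesis using KL by simp
  qed
  have "u i (of_real x) - (Y (- int N) * (1 - W_b (of_real x)) + Y (int N) * W_b (of_real x)
        + (\<Sum>j\<in>{- int N..int N}. (Y j - Y (- int N) * (1 - W_b (of_real (of_int j * h)))
            - Y (int N) * W_b (of_real (of_int j * h))) * of_real (S_sinc j h x)))
      = ((r i - Y (- int N)) * (1 - W_b (of_real x)) + (s i - Y (int N)) * W_b (of_real x))
        + (u_hom i (of_real x) - sinc_interp h N (u_hom i) x)
        + (\<Sum>j\<in>{- int N..int N}. D j * of_real (S_sinc j h x))"
    unfolding D_def sinc_interp_def left_diff_distrib sum_subtractf by (simp add: u_hom_def algebra_simps)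
  also have "cmod \<dots> \<le> (L + L) + C_f * err * (K_frame / h + 2) + 3 * L * (20 * sqrt (real N))"
  proof (intro norm_triangle_mono[OF norm_triangle_mono[OF W sinc_interp_error]])
    have "cmod (\<Sum>j\<in>{- int N..int N}. D j * of_real (S_sinc j h x))
        \<le> (\<Sum>j\<in>{- int N..int N}. 3 * L * \<bar>S_sinc j h x\<bar>)"
      using D by (intro sum_norm_le) (auto simp: norm_mult intro!: mult_right_mono)
    also have "\<dots> \<le> 3 * L * (20 * sqrt (real N))"
      unfolding sum_distrib_left[symmetric] using L0 h N
      by (intro mult_left_mono sum_abs_S_sinc_le) auto
    finally show "cmod (\<Sum>j\<in>{- int N..int N}. D j * of_real (S_sinc j h x)) \<le> 3 * L * (20 * sqrt (real N))" .
  qed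
  also have "\<dots> \<le> 2 * (L * sqrt (real N)) + C_f * err * (K_frame / h + 2) + 3 * L * (20 * sqrt (real N))"
    using N L0 mult_left_mono[of 1 "sqrt (real N)" L] by simp
  finally show "cmod (u i (of_real x) - (Y (- int N) * (1 - W_b (of_real x)) + Y (int N) * W_b (of_real x)
        + (\<Sum>j\<in>{- int N..int N}. (Y j - Y (- int N) * (1 - W_b (of_real (of_int j * h)))
            - Y (int N) * W_b (of_real (of_int j * h))) * of_real (S_sinc j h x))))
      \<le> (C_f * ((200 * pi * exp pi / \<alpha> + 32 * d) / h + 2)
        + 62 * (C * B / \<alpha> + K) * sqrt (real N)) * \<eta>"
    by (simp add: L_def \<eta> K_frame_def algebra_simps)
qed

end

end

section \<open>The collocation theorem\<close>

text \<open>The function y is known on the interval only. The system is solved anew on the strip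
  with the value of y at one interior point, and uniqueness on the real line identifies the result
  with y after substitution; this continues y analytically. Its limits at the two ends come from the
  continuity of y on [a, b].\<close>

lemma ivp_strip_system:
  fixes a b d \<alpha> :: real and n :: nat
    and r :: "nat \<Rightarrow> complex" and k :: "nat \<Rightarrow> nat \<Rightarrow> complex \<Rightarrow> complex"
    and g :: "nat \<Rightarrow> complex \<Rightarrow> complex" and y :: "nat \<Rightarrow> real \<Rightarrow> complex"
  assumes ab: "a < b" and d: "0 < d" "d < pi" and \<alpha>: "0 < \<alpha>" "\<alpha> \<le> 1"
    and k: "\<And>i j. i < n \<Longrightarrow> j < n \<Longrightarrow>
           (\<lambda>z. k i j z * Q_fun a b z) \<in> L_space a b \<alpha> (psi_SE a b ` strip d)"
    and g: "\<And>i. i < n \<Longrightarrow> (\<lambda>z. g i z * Q_fun a b z) \<in> L_space a b \<alpha> (psi_SE a b ` strip d)"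
    and ivp: "ivp_solution n a b k g r y"
  defines "A \<equiv> \<lambda>i j z. k i j (psi_SE a b z) * Q_fun a b (psi_SE a b z) / of_real (b - a)"
    and "G \<equiv> \<lambda>i z. g i (psi_SE a b z) * Q_fun a b (psi_SE a b z) / of_real (b - a)"
  obtains C B u where "strip_system n d \<alpha> C B A G u r (\<lambda>i. y i b)"
    and "\<And>i x. i < n \<Longrightarrow> u i (of_real x) = y i (psi_SE a b x)"
proof -
  have "\<exists>C. strip_decay (A i j) d \<alpha> C" if "i < n" "j < n" for i j
    using L_space_transplant[OF ab d \<alpha>(1) k[OF that]] by (auto simp: A_def)
  then obtain CA where CA: "\<And>i j. i < n \<Longrightarrow> j < n \<Longrightarrow> strip_decay (A i j) d \<alpha> (CA i j)"
    by metis
  have "\<exists>C. strip_decay (G i) d \<alpha> C" if "i < n" for i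
    using L_space_transplant[OF ab d \<alpha>(1) g[OF that]] by (auto simp: G_def)
  then obtain CG where CG: "\<And>i. i < n \<Longrightarrow> strip_decay (G i) d \<alpha> (CG i)"
    by metis
  define C where "C = (\<Sum>i<n. (\<Sum>j<n. CA i j) + CG i)"
  have row0: "(\<Sum>j<n. CA i j) + CG i \<ge> 0" if "i < n" for i
    using CA CG that by (intro add_nonneg_nonneg sum_nonneg) (auto simp: strip_decay_def)
  have C0: "C \<ge> 0" unfolding C_def by (intro sum_nonneg row0) auto
  have Ahol: "A i j holomorphic_on strip d" if "i < n" "j < n" for i j
    using CA[OF that] by (simp add: strip_decay_def)
  have Ghol: "G i holomorphic_on strip d" if "i < n" for i
    using CG[OF that] by (simp add: strip_decay_def)
  have bound: "(\<Sum>j<n. cmod (A i j z)) + cmod (G i z) \<le> C * exp (-\<alpha> * \<bar>Re z\<bar>)"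
    if i: "i < n" and z: "z \<in> strip d" for i z
  proof -
    have "(\<Sum>j<n. cmod (A i j z)) + cmod (G i z) \<le> (\<Sum>j<n. CA i j * exp (-\<alpha> * \<bar>Re z\<bar>)) + CG i * exp (-\<alpha> * \<bar>Re z\<bar>)"
      using CA[OF i] CG[OF i] z by (intro add_mono sum_mono) (auto simp: strip_decay_def)
    also have "\<dots> = ((\<Sum>j<n. CA i j) + CG i) * exp (-\<alpha> * \<bar>Re z\<bar>)"
      by (simp add: sum_distrib_right distrib_right)
    also have "\<dots> \<le> C * exp (-\<alpha> * \<bar>Re z\<bar>)"
      unfolding C_def using i row0 by (intro mult_right_mono member_le_sum) auto
    finally show ?thesis .
  qed
  \<comment> \<open>The initial value is taken at the midpoint (a + b) / 2, the image of 0, since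
    the point a itself corresponds to minus infinity.\<close>
  obtain u B where u0: "\<And>i. i < n \<Longrightarrow> u i 0 = y i (psi_SE a b 0)"
    and u': "\<And>i z. i < n \<Longrightarrow> z \<in> strip d \<Longrightarrow>
      (u i has_field_derivative (\<Sum>j<n. A i j z * u j z) + G i z) (at z)"
    and uB: "\<And>i z. i < n \<Longrightarrow> z \<in> strip d \<Longrightarrow> cmod (u i z) \<le> B"
    by (rule linear_ode_strip[where d = d and \<alpha> = \<alpha> and C = C and n = n and A = A and G = G
        and c = "\<lambda>i. y i (psi_SE a b 0)"]) (use d \<alpha> C0 Ahol Ghol bound in blast)+
  define I where "I i t = g i (of_real t) + (\<Sum>j<n. k i j (of_real t) * y j t)" for i t
  have y_cont: "continuous_on {a..b} (y i)" if "i < n" for i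
    using ivp that by (simp add: ivp_solution_def)
  have y_int: "(I i has_integral (y i t - r i)) {a..t}" if "i < n" "t \<in> {a..b}" for i t
    using ivp that by (simp add: ivp_solution_def I_def[abs_def])
  have dy: "(y i has_vector_derivative I i t) (at t)" if i: "i < n" and t: "a < t" "t < b" for i t
  proof -
    have "isCont (y j) t" if "j < n" for j
      using continuous_on_interior[OF y_cont[OF that], of t] t by simp
    then have "isCont (I i) t"
      unfolding I_def[abs_def] using L_space_isCont[OF ab d(1) k _ _] L_space_isCont[OF ab d(1) g] i t
      by (intro continuous_intros) auto
    moreover have "I i integrable_on {a..b}"
      using y_int[OF i, of b] ab by auto
    ultimately have "((\<lambda>x. integral {a..x} (I i)) has_vector_derivative I i t) (at t within {a..b} - {})"
      using t by (intro integral_has_vector_derivative_continuous_at) (auto intro: continuous_at_imp_continuous_at_within)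
    moreover have "at t within {a..b} = at t"
      using t by (intro at_within_interior) simp
    ultimately have "((\<lambda>x. r i + integral {a..x} (I i)) has_vector_derivative I i t) (at t)"
      by (auto intro!: derivative_eq_intros)
    then show ?thesis
    proof (rule has_vector_derivative_transform_within_open)
      show "r i + integral {a..x} (I i) = y i x" if "x \<in> {a<..<b}" for x
        using integral_unique[OF y_int[OF i, of x]] that by simp
    qed (use t in auto)
  qed
  have dv: "((\<lambda>x. y i (psi_SE a b x)) has_vector_derivative
      (\<Sum>j<n. A i j (of_real x) * y j (psi_SE a b x)) + G i (of_real x)) (at x)" if i: "i < n" for i x
  proof -
    have "(psi_SE a b has_real_derivative deriv (psi_SE a b) x) (at x)"
      by (metis DERIV_imp_deriv psi_SE_has_derivative)
    then have D: "(psi_SE a b has_vector_derivative deriv (psi_SE a b) x) (at x)"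
      by (simp add: has_real_derivative_iff_has_vector_derivative)
    have "((\<lambda>x. y i (psi_SE a b x)) has_vector_derivative deriv (psi_SE a b) x *\<^sub>R I i (psi_SE a b x)) (at x)"
      using vector_diff_chain_at[OF D dy[OF i psi_SE_bounds[OF ab]]] by (simp add: o_def)
    also have "deriv (psi_SE a b) x *\<^sub>R I i (psi_SE a b x) =
        (\<Sum>j<n. A i j (of_real x) * y j (psi_SE a b x)) + G i (of_real x)"
      unfolding scaleR_conv_of_real deriv_psi_SE[OF ab] I_def A_def G_def psi_SE_of_real
      by (simp add: sum_distrib_left distrib_left mult_ac)
    finally show ?thesis .
  qed
  have uv: "u i (of_real x) = y i (psi_SE a b x)" if i: "i < n" for i x
  proof -
    have "u i (of_real x) - y i (psi_SE a b x) = 0"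
    proof (rule linear_ode_unique[where n = n and e = "\<lambda>i x. u i (of_real x) - y i (psi_SE a b x)"
          and M = "\<lambda>i j x. A i j (of_real x)" and K = C])
      fix i x assume i: "i < n"
      have "((\<lambda>x. u i (of_real x)) has_vector_derivative
          (\<Sum>j<n. A i j (of_real x) * u j (of_real x)) + G i (of_real x)) (at x)"
        using field_vector_diff_chain_at[OF has_vector_derivative_of_real[OF DERIV_ident] u'[OF i, of "of_real x"]] d
        by (simp add: o_def)
      from has_vector_derivative_diff[OF this dv[OF i]]
      show "((\<lambda>x. u i (of_real x) - y i (psi_SE a b x)) has_vector_derivative
          (\<Sum>j<n. A i j (of_real x) * (u j (of_real x) - y j (psi_SE a b x)))) (at x)"
        by (simp add: right_diff_distrib sum_subtractf)
      have "(\<Sum>j<n. cmod (A i j (of_real x))) + cmod (G i (of_real x)) \<le> C * exp (-\<alpha> * \<bar>x\<bar>)"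
        using bound[OF i, of "of_real x"] d by simp
      also have "\<dots> \<le> C" using C0 \<alpha> by (intro mult_left_le) auto
      finally show "(\<Sum>j<n. cmod (A i j (of_real x))) \<le> C"
        using norm_ge_zero[of "G i (of_real x)"] by linarith
    qed (use u0 i in auto)
    then show ?thesis by simp
  qed
  show thesis
  proof (rule that[OF _ uv])
    \<comment> \<open>Raising the bound to at least 1 lets one factor cover both the solution and
      the bare inhomogeneity in \<open>F_decay\<close>.\<close>
    show "strip_system n d \<alpha> C (max 1 B) A G u r (\<lambda>i. y i b)"
    proof
      fix i assume i: "i < n"
      have ya: "y i a = r i"
        using has_integral_unique[OF y_int[OF i, of a], of 0] ab by (simp add: has_integral_refl)
      have "((\<lambda>x. y i (psi_SE a b x)) \<longlongrightarrow> y i a) at_bot"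
        by (intro continuous_on_tendsto_compose[OF y_cont[OF i] psi_SE_tendsto(1)]) (use ab in \<open>auto intro!: always_eventually less_imp_le psi_SE_bounds\<close>)
      then show "((\<lambda>x. u i (of_real x)) \<longlongrightarrow> r i) at_bot"
        unfolding uv[OF i] ya .
      have "((\<lambda>x. y i (psi_SE a b x)) \<longlongrightarrow> y i b) at_top"
        by (intro continuous_on_tendsto_compose[OF y_cont[OF i] psi_SE_tendsto(2)]) (use ab in \<open>auto intro!: always_eventually less_imp_le psi_SE_bounds\<close>)
      then show "((\<lambda>x. u i (of_real x)) \<longlongrightarrow> y i b) at_top"
        unfolding uv[OF i] .
    qed (use d \<alpha> C0 Ahol Ghol bound u' uB in \<open>auto simp: le_max_iff_disj\<close>)
  qed
qed

text \<open>h log N tends to 0, which fixes the threshold for N: the first condition keeps the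
  contours inside the strip, the second is the absorption condition of the stability
  estimate.\<close>

lemma sinc_step_small:
  fixes c \<kappa> :: real
  assumes "\<kappa> > 0" "d > 0" "c \<ge> 0"
  shows "\<forall>\<^sub>F N in sequentially. 2 * sqrt (\<kappa> / real N) \<le> d
    \<and> c * (sqrt (\<kappa> / real N) * harm (2 * N + 1)) \<le> 1 / 2"
proof (rule eventually_conj)
  have "(\<lambda>N. 2 * sqrt (\<kappa> / real N)) \<longlonglongrightarrow> 0"
    using assms by real_asymp
  then have "\<forall>\<^sub>F N in sequentially. 2 * sqrt (\<kappa> / real N) < d"
    using assms by (intro order_tendstoD)
  then show "\<forall>\<^sub>F N in sequentially. 2 * sqrt (\<kappa> / real N) \<le> d"
    by (rule eventually_mono) simp
  have "(\<lambda>N. sqrt (\<kappa> / real N) * (1 + ln (real (2 * N + 1)))) \<longlonglongrightarrow> 0"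
    using assms by real_asymp
  from tendsto_mult[OF tendsto_const[of c] this]
  have "(\<lambda>N. c * (sqrt (\<kappa> / real N) * (1 + ln (real (2 * N + 1))))) \<longlonglongrightarrow> 0" by simp
  then have "\<forall>\<^sub>F N in sequentially. c * (sqrt (\<kappa> / real N) * (1 + ln (real (2 * N + 1)))) < 1 / 2"
    by (rule order_tendstoD) simp
  then show "\<forall>\<^sub>F N in sequentially. c * (sqrt (\<kappa> / real N) * harm (2 * N + 1)) \<le> 1 / 2"
  proof (rule eventually_mono)
    fix N
    have "c * (sqrt (\<kappa> / real N) * harm (2 * N + 1)) \<le> c * (sqrt (\<kappa> / real N) * (1 + ln (real (2 * N + 1))))"
      using assms by (intro mult_left_mono harm_le_ln) auto
    then show "c * (sqrt (\<kappa> / real N) * (1 + ln (real (2 * N + 1)))) < 1 / 2 \<Longrightarrow>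
        c * (sqrt (\<kappa> / real N) * harm (2 * N + 1)) \<le> 1 / 2" by linarith
  qed
qed


theorem theorem9:
  fixes a b d \<alpha> :: real and n :: nat
    and r :: "nat \<Rightarrow> complex"
    and k :: "nat \<Rightarrow> nat \<Rightarrow> complex \<Rightarrow> complex"
    and g :: "nat \<Rightarrow> complex \<Rightarrow> complex"
    and y :: "nat \<Rightarrow> real \<Rightarrow> complex"
  assumes "a < b" and "n \<ge> 1" and "0 < d" and "d < pi" and "0 < \<alpha>" and "\<alpha> \<le> 1"
    and "\<And>i j. i < n \<Longrightarrow> j < n \<Longrightarrow>
           (\<lambda>z. k i j z * Q_fun a b z) \<in> L_space a b \<alpha> (psi_SE a b ` strip d)"
    and "\<And>i. i < n \<Longrightarrow> (\<lambda>z. g i z * Q_fun a b z) \<in> L_space a b \<alpha> (psi_SE a b ` strip d)"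
    and "ivp_solution n a b k g r y"
  shows "\<exists>(N\<^sub>0::nat) (C::real). \<forall>N::nat. N \<ge> N\<^sub>0 \<and> N > 0 \<longrightarrow>
           (let h = sqrt (pi * d / (\<alpha> * real N)) in
            (\<exists>!Y. sinc_system a b h n N k g r Y) \<and>
            (\<forall>Y. sinc_system a b h n N k g r Y \<longrightarrow>
               (\<forall>i<n. \<forall>t\<in>{a..b}.
                  cmod (y i t - y_SE a b h N Y i t) \<le> C * sqrt (real N) * exp (- sqrt (pi * d * \<alpha> * real N)))))"
proof -
  note ab = assms(1) and d = assms(3,4) and \<alpha> = assms(5,6)
  define A where "A = (\<lambda>i j z. k i j (psi_SE a b z) * Q_fun a b (psi_SE a b z) / of_real (b - a))"
  define G where "G = (\<lambda>i z. g i (psi_SE a b z) * Q_fun a b (psi_SE a b z) / of_real (b - a))"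
  obtain C B u where sys: "strip_system n d \<alpha> C B A G u r (\<lambda>i. y i b)"
    and uy: "\<And>i x. i < n \<Longrightarrow> u i (of_real x) = y i (psi_SE a b x)"
    using ivp_strip_system[OF ab d \<alpha> assms(7-9)] unfolding A_def G_def by blast
  interpret strip_system n d \<alpha> C B A G u r "\<lambda>i. y i b" by (rule sys)
  define \<kappa> where "\<kappa> = pi * d / \<alpha>"
  have \<kappa>: "\<kappa> > 0" using d \<alpha> by (simp add: \<kappa>_def)
  obtain N0 where N0: "\<And>N. N \<ge> N0 \<Longrightarrow> 2 * sqrt (\<kappa> / real N) \<le> d
      \<and> (exp S_bd * 2 * C) * (sqrt (\<kappa> / real N) * harm (2 * N + 1)) \<le> 1 / 2"
    using sinc_step_small[OF \<kappa> d(1), of "exp S_bd * 2 * C"] C unfolding eventually_sequentially by auto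
  define K1 where "K1 = 2 * exp S_bd * K_u"
  define K2 where "K2 = 200 * pi * exp pi / \<alpha> + 32 * d"
  \<comment> \<open>Since 1 / h = sqrt N / sqrt \<kappa>, the factor 1 / h of the interpolation
    error and the Lebesgue constant both become multiples of sqrt N, with these
    coefficients.\<close>
  define K where "K = C_f * (K2 / sqrt \<kappa> + 2) + 62 * (C * B / \<alpha> + K1)"
  have K12: "K1 \<ge> 0" "K2 \<ge> 0"
    using K_u_nonneg d \<alpha> by (simp_all add: K1_def K2_def)
  have CB: "C * B / \<alpha> \<ge> 0" using C B \<alpha> by simp
  show ?thesis
  proof (intro exI[of _ N0] exI[of _ K] allI impI, elim conjE)
    fix N assume N: "N \<ge> N0" "N > 0"
    define h where "h = sqrt (pi * d / (\<alpha> * real N))"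
    have h_eq: "h = sqrt (\<kappa> / real N)" by (simp add: h_def \<kappa>_def)
    have h: "h > 0" "2 * h \<le> d" and small: "exp S_bd * (2 * (h * C) * harm (2 * N + 1)) \<le> 1 / 2"
      using N0[OF N(1)] N(2) \<kappa> by (simp_all add: h_eq mult_ac)
    have N1: "N \<ge> 1" using N by simp
    have grid: "real N * h\<^sup>2 = pi * d / \<alpha>"
      using N \<kappa> unfolding h_eq by (simp add: less_imp_le) (simp add: \<kappa>_def)
    have ctxt: "h > 0" "2 * h \<le> d" "N \<ge> 1" "real N * h\<^sup>2 = pi * d / \<alpha>"
      "exp S_bd * (2 * (h * C) * harm (2 * N + 1)) \<le> 1 / 2"
      using h N1 grid small by auto
    define m where "m = 2 * N + 1"
    define nd where "nd q = complex_of_real (of_int (idx N q) * h)" for q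
    define E where "E = exp (- (pi * d / h))"
    have E_eq: "E = exp (- sqrt (pi * d * \<alpha> * real N))"
    proof -
      have "(pi * d / h)\<^sup>2 = pi * d * \<alpha> * real N"
        using h d \<alpha> N by (simp add: h_def power_divide field_simps power2_eq_square)
      then have "sqrt (pi * d * \<alpha> * real N) = pi * d / h"
        using h d by (intro real_sqrt_unique) auto
      then show ?thesis by (simp add: E_def)
    qed
    \<comment> \<open>The weights of the collocation system turn k and g at the sampling points into
      the transplanted \<open>A\<close> and \<open>G\<close> at the nodes.\<close>
    have coef: "complex_of_real (h * deriv (psi_SE a b :: real \<Rightarrow> real) (of_int (idx N q) * h)) * f (of_real (t_SE a b h (idx N q)))
        = of_real h * (f (psi_SE a b (nd q)) * Q_fun a b (psi_SE a b (nd q)) / of_real (b - a))" for f q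
      unfolding of_real_mult deriv_psi_SE[OF ab] t_SE_def nd_def
      by (simp only: psi_SE_of_real flip: of_real_mult) simp
    have mat: "vec_index (sinc_mat a b h n N k *\<^sub>v v) (i * m + p) = vec_index v (i * m + p)
        - (\<Sum>q<m. of_real (sigma (idx N p - idx N q)) * (\<Sum>j<n. of_real h * A i j (nd q) * vec_index v (j * m + q)))"
      if "v \<in> carrier_vec (n * m)" "i < n" "p < m" for v i p
      unfolding sinc_mat_mult_vec_index[OF m_def that] coef A_def ..
    have rhs: "vec_index (sinc_rhs a b h n N g r) (i * m + p) =
        (\<Sum>q<m. of_real (sigma (idx N p - idx N q)) * (of_real h * G i (nd q))) + r i"
      if "i < n" "p < m" for i p
      unfolding sinc_rhs_index[OF m_def that] coef G_def ..
    have "\<exists>!Y. Y \<in> carrier_vec (n * m) \<and> sinc_mat a b h n N k *\<^sub>v Y = sinc_rhs a b h n N g r"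
    proof (rule unique_solution_of_trivial_kernel[OF sinc_mat_carrier[OF m_def] sinc_rhs_carrier[OF m_def]])
      fix v assume v: "v \<in> carrier_vec (n * m)" and v0: "sinc_mat a b h n N k *\<^sub>v v = 0\<^sub>v (n * m)"
      have "vec_index v (i * m + p) = 0" if ip: "i < n" "p < m" for i p
      proof -
        \<comment> \<open>A kernel vector solves the system with zero inhomogeneity, so the
          stability bound is 0.\<close>
        have "cmod (vec_index v (i * m + p)) \<le> 2 * exp S_bd * 0"
        proof (rule system_stability[OF ctxt, where Y = "\<lambda>i p. vec_index v (i * m + p)" and e = "\<lambda>_ _. 0"])
          fix i p assume "i < n" "p < 2 * N + 1"
          then show "vec_index v (i * m + p) = (\<Sum>q<2 * N + 1. of_real (sigma (idx N p - idx N q)) *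
              (\<Sum>j<n. of_real h * A i j (node h N q) * vec_index v (j * m + q))) + 0"
            using mat[OF v, of i p] block_index(1)[of i n p m]
            unfolding v0 m_def[symmetric] nd_def node_def[OF ctxt] by simp
        qed (use ip in \<open>auto simp: m_def\<close>)
        then show ?thesis by simp
      qed
      then have "\<forall>P<n * m. vec_index v P = 0"
        by (subst all_blocks) blast
      then show "v = 0\<^sub>v (n * m)" using v by (intro eq_vecI) auto
    qed
    moreover have "cmod (y i t - y_SE a b h N Y i t) \<le> K * sqrt (real N) * E"
      if Y: "sinc_system a b h n N k g r Y" and i: "i < n" and t: "t \<in> {a..b}" for Y i t
    proof -
      have Yc: "Y \<in> carrier_vec (n * m)" and Yeq: "sinc_mat a b h n N k *\<^sub>v Y = sinc_rhs a b h n N g r"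
        using Y by (simp_all only: sinc_system_iff m_def)
      have nodal: "cmod (u i (nd p) - vec_index Y (i * m + p)) \<le> K1 * E" if "p < m" for p
      proof -
        have "cmod (u i (node h N p) - vec_index Y (i * m + p)) \<le> 2 * exp S_bd * (K_u * \<eta> h)"
        proof (rule nodal_error[OF ctxt])
          fix i p assume "i < n" "p < 2 * N + 1"
          then show "vec_index Y (i * m + p) = (\<Sum>q<2 * N + 1. of_real (sigma (idx N p - idx N q)) *
              (\<Sum>j<n. of_real h * A i j (node h N q) * vec_index Y (j * m + q)))
              + ((\<Sum>q<2 * N + 1. of_real (sigma (idx N p - idx N q)) * (of_real h * G i (node h N q))) + r i)"
            using mat[OF Yc, of i p] rhs[of i p]
            unfolding Yeq m_def[symmetric] nd_def node_def[OF ctxt] by simp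
        qed (use i that in \<open>auto simp: m_def\<close>)
        then show ?thesis
          by (simp add: node_def[OF ctxt] nd_def \<eta>_def[OF ctxt] E_def K1_def mult_ac)
      qed
      define Z where "Z j = Y_entry N Y i j" for j
      have Z: "cmod (u i (of_real (of_int j * h)) - Z j) \<le> K1 * \<eta> h" if "j \<in> {- int N..int N}" for j
      proof -
        define p where "p = nat (j + int N)"
        have "p < m" "idx N p = j" using that by (auto simp: p_def m_def idx_def)
        then show ?thesis
          using nodal[of p] by (simp add: nd_def Z_def Y_entry_def p_def m_def E_def \<eta>_def[OF ctxt])
      qed
      note err = interpolation_error[OF ctxt i Z]
      have N_sqrt: "sqrt (real N) \<ge> 1" using N1 by simp
      have K_ends: "(C * B / \<alpha> + K1) * E \<le> K * sqrt (real N) * E"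
      proof -
        have "C * B / \<alpha> + K1 \<le> K"
        proof -
          have "0 \<le> C_f * (K2 / sqrt \<kappa> + 2)"
            using C_f_nonneg K12 \<kappa> by (intro mult_nonneg_nonneg add_nonneg_nonneg) auto
          then show ?thesis using K12 CB unfolding K_def by argo
        qed
        also have "K \<le> K * sqrt (real N)"
          using N_sqrt calculation K12 CB mult_left_mono[of 1 "sqrt (real N)" K] by simp
        finally show ?thesis by (intro mult_right_mono) (simp_all add: E_def)
      qed
      have y_SE_eq: "y_SE a b h N Y i t = Z (- int N) * of_real (w_a a b t) + Z (int N) * of_real (w_b a b t)
          + (\<Sum>j\<in>{- int N..int N}. (Z j - Z (- int N) * of_real (w_a a b (t_SE a b h j))
              - Z (int N) * of_real (w_b a b (t_SE a b h j))) * of_real (S_phi a b h j t))"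
        by (simp add: y_SE_def Z_def Let_def)
      \<comment> \<open>The end points have no preimage on the real line. There all sinc terms are 0
        by convention and the interpolant reduces to the outermost nodal value, which is compared
        with y(a) = r or y(b).\<close>
      consider "t = a" | "t = b" | "a < t" "t < b" using t by force
      then show ?thesis
      proof cases
        case 1
        have "y_SE a b h N Y i t = Z (- int N)"
          unfolding y_SE_eq using ab by (simp add: 1 S_phi_def w_a_def w_b_def)
        moreover have "y i a = r i"
        proof -
          have "\<forall>t\<in>{a..b}. ((\<lambda>s. g i (of_real s) + (\<Sum>j<n. k i j (of_real s) * y j s)) has_integral (y i t - r i)) {a..t}"
            using assms(9) i by (simp add: ivp_solution_def)
          from has_integral_unique[OF bspec[OF this, of a], of 0] ab show ?thesis
            by (simp add: has_integral_refl)
        qed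
        ultimately show ?thesis
          using order_trans[OF err(1) K_ends[unfolded E_def, folded \<eta>_def[OF ctxt]]]
          by (simp add: 1 E_def \<eta>_def[OF ctxt])
      next
        case 2
        have "y_SE a b h N Y i t = Z (int N)"
          unfolding y_SE_eq using ab by (simp add: 2 S_phi_def w_a_def w_b_def)
        then show ?thesis
          using order_trans[OF err(2) K_ends[unfolded E_def, folded \<eta>_def[OF ctxt]]]
          by (simp add: 2 E_def \<eta>_def[OF ctxt])
      next
        case 3
        define x where "x = phi_SE a b t"
        have tx: "psi_SE a b x = t" using psi_SE_phi_SE[OF 3] by (simp add: x_def)
        have "y_SE a b h N Y i t = Z (- int N) * (1 - W_b (of_real x)) + Z (int N) * W_b (of_real x)
          + (\<Sum>j\<in>{- int N..int N}. (Z j - Z (- int N) * (1 - W_b (of_real (of_int j * h)))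
              - Z (int N) * W_b (of_real (of_int j * h))) * of_real (S_sinc j h x))"
          unfolding y_SE_eq W_b_of_real(2)[OF ab] unfolding W_b_of_real(1)[OF ab] t_SE_def tx using 3 by (simp add: S_phi_def x_def)
        then have "cmod (y i t - y_SE a b h N Y i t)
            \<le> (C_f * (K2 / h + 2) + 62 * (C * B / \<alpha> + K1) * sqrt (real N)) * E"
          using err(3)[of x] unfolding uy[OF i] tx K2_def E_def \<eta>_def[OF ctxt] by simp
        also have "\<dots> \<le> K * sqrt (real N) * E"
        proof (rule mult_right_mono)
          have "1 / h = sqrt (real N) / sqrt \<kappa>"
            unfolding h_eq by (simp add: real_sqrt_divide)
          then have "K2 / h = K2 / sqrt \<kappa> * sqrt (real N)"
            by (metis times_divide_eq_left times_divide_eq_right mult.right_neutral)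
          then have "K2 / h + 2 \<le> (K2 / sqrt \<kappa> + 2) * sqrt (real N)"
            using N_sqrt by (simp add: distrib_right)
          then have "C_f * (K2 / h + 2) \<le> C_f * ((K2 / sqrt \<kappa> + 2) * sqrt (real N))"
            by (rule mult_left_mono[OF _ C_f_nonneg])
          then show "C_f * (K2 / h + 2) + 62 * (C * B / \<alpha> + K1) * sqrt (real N) \<le> K * sqrt (real N)"
            by (simp add: K_def distrib_right mult.assoc)
        qed (simp add: E_def)
        finally show ?thesis .
      qed
    qed
    ultimately show "let h = sqrt (pi * d / (\<alpha> * real N)) in
            (\<exists>!Y. sinc_system a b h n N k g r Y) \<and>
            (\<forall>Y. sinc_system a b h n N k g r Y \<longrightarrow>
               (\<forall>i<n. \<forall>t\<in>{a..b}.
                  cmod (y i t - y_SE a b h N Y i t) \<le> K * sqrt (real N) * exp (- sqrt (pi * d * \<alpha> * real N))))"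
      unfolding Let_def h_def[symmetric] E_eq[symmetric] sinc_system_iff m_def[symmetric] by blast
  qed
qed

end
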